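(* Let $K$ be a field of characteristic $0$ and let $n$ be any positive integer. Let $V$ be the $K$-vector space with basis $e_1,e_2,\ldots,e_{2n}$, let $E=\bigwedge V$ be its exterior algebra, and set $f=e_1e_2+e_3e_4+\cdots+e_{2n-1}e_{2n}\in E$. Then $\operatorname{reg}_E(E/(f))=n$.
   Context: The exterior algebra $E$ is graded with $\deg(e_i)=1$ for all $i$, and $(f)$ is the (two-sided, homogeneous) ideal of $E$ generated by $f$. For a finitely generated graded $E$-module $M$, the regularity is $\operatorname{reg}_E(M)=\sup\{j-i : \operatorname{Tor}_i^E(M,K)_j\neq 0\}$, where $\operatorname{Tor}_i^E(M,K)_j$ is the component of internal degree $j$ of $\operatorname{Tor}_i^E(M,K)$ and $K=E/(e_1,\ldots,e_{2n})$ is in degree $0$. *)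

theory Defs
  imports
    Complex_Main
    "HOL-Library.Extended_Real"
    "HOL-Algebra.Module"
    "HOL-Algebra.QuotRing"
    "HOL-Algebra.Free_Abelian_Groups"
begin

section \<open>Graded rings and graded one-sided modules\<close>

record 'a graded_ring = "'a ring" +
  ring_part :: "int \<Rightarrow> 'a set"

text \<open>
  The rings are not commutative, so the record \<^type>\<open>module\<close> is used for modules of either side:
  for a left module \<open>smult M r x\<close> stands for \<open>r x\<close>, for a right module it stands for \<open>x r\<close>.
  The fields \<open>mult\<close> and \<open>one\<close> of the record have no meaning for a module.
\<close>

record ('a, 'm) graded_module = "('a, 'm) module" +
  module_part :: "int \<Rightarrow> 'm set"

text \<open>Degree-preserving linear maps; the formula is the same for left and for right modules.\<close>

definition graded_hom ::
  "('a, 'r) graded_ring_scheme \<Rightarrow> ('a, 'm) graded_module \<Rightarrow> ('a, 'n) graded_module \<Rightarrow> ('m \<Rightarrow> 'n) \<Rightarrow> bool"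
  where "graded_hom R A B h \<longleftrightarrow>
     h \<in> carrier A \<rightarrow> carrier B
   \<and> (\<forall>x\<in>carrier A. \<forall>y\<in>carrier A. h (x \<oplus>\<^bsub>A\<^esub> y) = h x \<oplus>\<^bsub>B\<^esub> h y)
   \<and> (\<forall>r\<in>carrier R. \<forall>x\<in>carrier A. h (smult A r x) = smult B r (h x))
   \<and> (\<forall>j. h ` module_part A j \<subseteq> module_part B j)"

text \<open>The quotient of a graded ring by a two-sided ideal, as a right and as a left module over the ring.\<close>

definition right_quotient :: "('a, 'r) graded_ring_scheme \<Rightarrow> 'a set \<Rightarrow> ('a, 'a set) graded_module"
  where "right_quotient R I =
    \<lparr>carrier = carrier (R Quot I), monoid.mult = undefined, monoid.one = undefined,
     ring.zero = ring.zero (R Quot I), ring.add = ring.add (R Quot I),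
     smult = (\<lambda>r X. X \<otimes>\<^bsub>R Quot I\<^esub> (I +>\<^bsub>R\<^esub> r)),
     module_part = (\<lambda>j. (\<lambda>a. I +>\<^bsub>R\<^esub> a) ` ring_part R j)\<rparr>"

definition left_quotient :: "('a, 'r) graded_ring_scheme \<Rightarrow> 'a set \<Rightarrow> ('a, 'a set) graded_module"
  where "left_quotient R I =
    \<lparr>carrier = carrier (R Quot I), monoid.mult = undefined, monoid.one = undefined,
     ring.zero = ring.zero (R Quot I), ring.add = ring.add (R Quot I),
     smult = (\<lambda>r X. (I +>\<^bsub>R\<^esub> r) \<otimes>\<^bsub>R Quot I\<^esub> X),
     module_part = (\<lambda>j. (\<lambda>a. I +>\<^bsub>R\<^esub> a) ` ring_part R j)\<rparr>"

text \<open>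
  The graded free right module with one basis element in each of the degrees listed in \<open>ds\<close>, that is
  the direct sum of the shifts \<open>R(-d)\<close> for \<open>d\<close> in \<open>ds\<close>.  Vectors of length \<open>length ds\<close> are functions
  on \<open>nat\<close> that vanish from \<open>length ds\<close> on.
\<close>

definition graded_free :: "('a, 'r) graded_ring_scheme \<Rightarrow> int list \<Rightarrow> ('a, nat \<Rightarrow> 'a) graded_module"
  where "graded_free R ds =
    \<lparr>carrier = {v. (\<forall>k<length ds. v k \<in> carrier R) \<and> (\<forall>k\<ge>length ds. v k = \<zero>\<^bsub>R\<^esub>)},
     monoid.mult = undefined, monoid.one = undefined,
     ring.zero = (\<lambda>k. \<zero>\<^bsub>R\<^esub>), ring.add = (\<lambda>v w k. v k \<oplus>\<^bsub>R\<^esub> w k),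
     smult = (\<lambda>r v k. v k \<otimes>\<^bsub>R\<^esub> r),
     module_part = (\<lambda>j. {v. (\<forall>k<length ds. v k \<in> ring_part R (j - ds ! k))
                           \<and> (\<forall>k\<ge>length ds. v k = \<zero>\<^bsub>R\<^esub>)})\<rparr>"

text \<open>
  Graded resolutions of a right module by free modules of finite rank (for a finitely generated graded
  module over a Noetherian graded ring these exist).  The differential from \<open>F (Suc i)\<close> to \<open>F i\<close> is
  \<open>d (Suc i)\<close>; the map \<open>d 0\<close> is not used.
\<close>

type_synonym 'a free_complex = "(nat \<Rightarrow> int list) \<times> (nat \<Rightarrow> (nat \<Rightarrow> 'a) \<Rightarrow> (nat \<Rightarrow> 'a))"

definition graded_free_resolution ::
  "('a, 'r) graded_ring_scheme \<Rightarrow> ('a, 'm) graded_module \<Rightarrow> 'a free_complex \<Rightarrow> ((nat \<Rightarrow> 'a) \<Rightarrow> 'm) \<Rightarrow> bool"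
  where "graded_free_resolution R M C aug \<longleftrightarrow>
    (let F = (\<lambda>i. graded_free R (fst C i)); d = snd C in
       graded_hom R (F 0) M aug
     \<and> (\<forall>i. graded_hom R (F (Suc i)) (F i) (d (Suc i)))
     \<and> aug ` carrier (F 0) = carrier M
     \<and> d 1 ` carrier (F 1) = {v \<in> carrier (F 0). aug v = \<zero>\<^bsub>M\<^esub>}
     \<and> (\<forall>i. d (Suc (Suc i)) ` carrier (F (Suc (Suc i)))
              = {v \<in> carrier (F (Suc i)). d (Suc i) v = \<zero>\<^bsub>F i\<^esub>}))"

section \<open>Tensor products\<close>

text \<open>
  The tensor product over \<open>R\<close> of a right module \<open>A\<close> and a left module \<open>B\<close>: the free Abelian group on
  the pairs modulo the subgroup generated by the bilinearity and balancing relations.  It is a group in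
  multiplicative notation, as in \<^theory>\<open>HOL-Algebra.Free_Abelian_Groups\<close>.
\<close>

definition tensor_relations ::
  "('a, 'r) graded_ring_scheme \<Rightarrow> ('a, 'm) graded_module \<Rightarrow> ('a, 'n) graded_module \<Rightarrow> ('m \<times> 'n \<Rightarrow>\<^sub>0 int) set"
  where "tensor_relations R A B =
    generate (free_Abelian_group (carrier A \<times> carrier B))
      ({frag_of (x \<oplus>\<^bsub>A\<^esub> x', y) - frag_of (x, y) - frag_of (x', y) | x x' y.
          x \<in> carrier A \<and> x' \<in> carrier A \<and> y \<in> carrier B}
     \<union> {frag_of (x, y \<oplus>\<^bsub>B\<^esub> y') - frag_of (x, y) - frag_of (x, y') | x y y'.
          x \<in> carrier A \<and> y \<in> carrier B \<and> y' \<in> carrier B}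
     \<union> {frag_of (smult A r x, y) - frag_of (x, smult B r y) | r x y.
          r \<in> carrier R \<and> x \<in> carrier A \<and> y \<in> carrier B})"

definition tensor ::
  "('a, 'r) graded_ring_scheme \<Rightarrow> ('a, 'm) graded_module \<Rightarrow> ('a, 'n) graded_module \<Rightarrow> ('m \<times> 'n \<Rightarrow>\<^sub>0 int) set monoid"
  where "tensor R A B =
    free_Abelian_group (carrier A \<times> carrier B) Mod tensor_relations R A B"

definition pure_tensor ::
  "('a, 'r) graded_ring_scheme \<Rightarrow> ('a, 'm) graded_module \<Rightarrow> ('a, 'n) graded_module
     \<Rightarrow> 'm \<Rightarrow> 'n \<Rightarrow> ('m \<times> 'n \<Rightarrow>\<^sub>0 int) set"
  where "pure_tensor R A B x y =
    tensor_relations R A B #>\<^bsub>free_Abelian_group (carrier A \<times> carrier B)\<^esub> frag_of (x, y)"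

definition tensor_part ::
  "('a, 'r) graded_ring_scheme \<Rightarrow> ('a, 'm) graded_module \<Rightarrow> ('a, 'n) graded_module
     \<Rightarrow> int \<Rightarrow> ('m \<times> 'n \<Rightarrow>\<^sub>0 int) set set"
  where "tensor_part R A B j =
    generate (tensor R A B)
      {pure_tensor R A B x y | x y p q. x \<in> module_part A p \<and> y \<in> module_part B q \<and> p + q = j}"

text \<open>
  The map induced by \<open>h\<close> from the tensor product of \<open>A\<close> and \<open>B\<close> to that of \<open>A'\<close> and \<open>B\<close>.  The union
  over the members \<open>c\<close> of a coset \<open>X\<close> is the usual way to take the image coset: if \<open>h\<close> is linear,
  all these cosets are equal.
\<close>

definition tensor_map ::
  "('a, 'r) graded_ring_scheme \<Rightarrow> ('a, 'm) graded_module \<Rightarrow> ('a, 'n) graded_module \<Rightarrow> ('l \<Rightarrow> 'm)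
     \<Rightarrow> ('l \<times> 'n \<Rightarrow>\<^sub>0 int) set \<Rightarrow> ('m \<times> 'n \<Rightarrow>\<^sub>0 int) set"
  where "tensor_map R A' B h X =
    (\<Union>c\<in>X. tensor_relations R A' B #>\<^bsub>free_Abelian_group (carrier A' \<times> carrier B)\<^esub>
              frag_extend (\<lambda>(x, y). frag_of (h x, y)) c)"

section \<open>Tor and regularity\<close>

text \<open>
  The homology, in homological degree \<open>i\<close> and internal degree \<open>j\<close>, of the complex obtained from a
  complex of free right modules by tensoring with the left module \<open>N\<close>.
\<close>

definition tensor_homology ::
  "('a, 'r) graded_ring_scheme \<Rightarrow> 'a free_complex \<Rightarrow> ('a, 'n) graded_module
     \<Rightarrow> nat \<Rightarrow> int \<Rightarrow> ((nat \<Rightarrow> 'a) \<times> 'n \<Rightarrow>\<^sub>0 int) set set monoid"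
  where "tensor_homology R C N i j =
    (let F = (\<lambda>i. graded_free R (fst C i)); d = snd C;
         cycles = {X \<in> tensor_part R (F i) N j.
                     i = 0 \<or> tensor_map R (F (i - 1)) N (d i) X = \<one>\<^bsub>tensor R (F (i - 1)) N\<^esub>};
         boundaries = tensor_map R (F i) N (d (Suc i)) ` tensor_part R (F (Suc i)) N j
     in (tensor R (F i) N)\<lparr>carrier := cycles\<rparr> Mod boundaries)"

text \<open>
  The component of internal degree \<open>j\<close> of the \<open>i\<close>-th Tor group of the right module \<open>M\<close> and the left
  module \<open>N\<close>, computed from a chosen graded free resolution of \<open>M\<close>.
\<close>

definition Tor ::
  "('a, 'r) graded_ring_scheme \<Rightarrow> ('a, 'm) graded_module \<Rightarrow> ('a, 'n) graded_module
     \<Rightarrow> nat \<Rightarrow> int \<Rightarrow> ((nat \<Rightarrow> 'a) \<times> 'n \<Rightarrow>\<^sub>0 int) set set monoid"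
  where "Tor R M N i j =
    tensor_homology R (SOME C. \<exists>aug. graded_free_resolution R M C aug) N i j"

text \<open>
  \<open>K\<close> is the residue module of \<open>R\<close>, as a left module.  Values are extended reals, so that the supremum
  is infinite when the set is not bounded above.
\<close>

definition regularity ::
  "('a, 'r) graded_ring_scheme \<Rightarrow> ('a, 'k) graded_module \<Rightarrow> ('a, 'm) graded_module \<Rightarrow> ereal"
  where "regularity R K M =
    Sup {ereal (of_int (j - int i)) | i j. carrier (Tor R M K i j) \<noteq> {\<one>\<^bsub>Tor R M K i j\<^esub>}}"

section \<open>Exterior algebras\<close>

text \<open>
  The exterior algebra on a vector space with basis \<open>e\<^sub>1, \<dots>, e\<^sub>m\<close> over the field \<open>'k\<close>.  An element
  is given by its coordinates with respect to the basis of the monomials \<open>e\<^sub>S\<close>, the product of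
  the \<open>e\<^sub>i\<close> with \<open>i \<in> S\<close> in increasing order, for \<open>S \<subseteq> {1..m}\<close>.  For disjoint \<open>T\<close> and \<open>U\<close> the
  product \<open>e\<^sub>T e\<^sub>U\<close> is \<open>e\<^bsub>T \<union> U\<^esub>\<close> up to the sign of the permutation that sorts the factors, and
  it is zero otherwise.
\<close>

definition shuffle_sign :: "nat set \<Rightarrow> nat set \<Rightarrow> 'k::field"
  where "shuffle_sign T U = (- 1) ^ card {(t, u). t \<in> T \<and> u \<in> U \<and> u < t}"

definition ext_mult :: "(nat set \<Rightarrow> 'k) \<Rightarrow> (nat set \<Rightarrow> 'k) \<Rightarrow> nat set \<Rightarrow> 'k::field"
  where "ext_mult a b S = (\<Sum>T\<in>Pow S. shuffle_sign T (S - T) * a T * b (S - T))"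

definition ext_monomial :: "nat set \<Rightarrow> nat set \<Rightarrow> 'k::field"
  where "ext_monomial S = (\<lambda>T. if T = S then 1 else 0)"

definition ext_gen :: "nat \<Rightarrow> nat set \<Rightarrow> 'k::field"
  where "ext_gen i = ext_monomial {i}"

definition exterior_algebra :: "nat \<Rightarrow> (nat set \<Rightarrow> 'k::field) graded_ring"
  where "exterior_algebra m =
    \<lparr>carrier = {a. \<forall>S. a S \<noteq> 0 \<longrightarrow> S \<subseteq> {1..m}},
     monoid.mult = ext_mult, monoid.one = ext_monomial {},
     ring.zero = (\<lambda>S. 0), ring.add = (\<lambda>a b S. a S + b S),
     ring_part = (\<lambda>j. {a. \<forall>S. a S \<noteq> 0 \<longrightarrow> S \<subseteq> {1..m} \<and> int (card S) = j})\<rparr>"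

definition ext_regularity :: "nat \<Rightarrow> (nat set \<Rightarrow> 'k::field, 'm) graded_module \<Rightarrow> ereal"
  where "ext_regularity m M =
    (let E = exterior_algebra m
     in regularity E (left_quotient E (Idl\<^bsub>E\<^esub> (ext_gen ` {1..m}))) M)"

subsection \<open>The exterior algebra is a ring with the expected relations\<close>

lemma shuffle_sign_empty [simp]: "shuffle_sign {} U = 1" "shuffle_sign T {} = 1"
  by (simp_all add: shuffle_sign_def)

lemma finite_inversions:
  assumes "finite T" "finite U"
  shows "finite {(t, u). t \<in> T \<and> u \<in> U \<and> u < (t::nat)}"
  by (rule finite_subset[of _ "T \<times> U"]) (use assms in auto)

lemma shuffle_sign_Un_left:
  assumes "finite T" "finite T'" "finite U" "T \<inter> T' = {}"
  shows "(shuffle_sign (T \<union> T') U :: 'k::field) = shuffle_sign T U * shuffle_sign T' U"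
proof -
  have eq: "{(t, u). t \<in> T \<union> T' \<and> u \<in> U \<and> u < t} =
        {(t, u). t \<in> T \<and> u \<in> U \<and> u < t} \<union> {(t, u). t \<in> T' \<and> u \<in> U \<and> u < t}"
    by auto
  show ?thesis
    unfolding shuffle_sign_def eq power_add[symmetric]
    by (subst card_Un_disjoint) (use assms finite_inversions in auto)
qed

lemma shuffle_sign_Un_right:
  assumes "finite T" "finite U" "finite U'" "U \<inter> U' = {}"
  shows "(shuffle_sign T (U \<union> U') :: 'k::field) = shuffle_sign T U * shuffle_sign T U'"
proof -
  have eq: "{(t, u). t \<in> T \<and> u \<in> U \<union> U' \<and> u < t} =
        {(t, u). t \<in> T \<and> u \<in> U \<and> u < t} \<union> {(t, u). t \<in> T \<and> u \<in> U' \<and> u < t}"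
    by auto
  show ?thesis
    unfolding shuffle_sign_def eq power_add[symmetric]
    by (subst card_Un_disjoint) (use assms finite_inversions in auto)
qed

lemma ext_mult_infinite: "infinite S \<Longrightarrow> ext_mult a b S = 0"
  by (simp add: ext_mult_def)

lemma ext_mult_assoc:
  "ext_mult (ext_mult a b) c = (ext_mult a (ext_mult b c) :: nat set \<Rightarrow> 'k::field)"
proof
  fix S :: "nat set"
  show "ext_mult (ext_mult a b) c S = ext_mult a (ext_mult b c) S"
  proof (cases "finite S")
    case False
    then show ?thesis by (simp add: ext_mult_infinite)
  next
    case fin: True
    let ?g = "\<lambda>U V. shuffle_sign U V * shuffle_sign U (S - U - V) * shuffle_sign V (S - U - V)
                      * a U * b V * c (S - U - V)"
    have fs: "finite X" if "X \<subseteq> S" for X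
      using fin that finite_subset by blast
    have "ext_mult (ext_mult a b) c S =
          (\<Sum>T\<in>Pow S. \<Sum>U\<in>Pow T. shuffle_sign T (S - T) * shuffle_sign U (T - U) * a U * b (T - U) * c (S - T))"
      by (simp add: ext_mult_def sum_distrib_left sum_distrib_right mult.assoc)
    also have "\<dots> = (\<Sum>(T, U)\<in>(SIGMA T:Pow S. Pow T).
          shuffle_sign T (S - T) * shuffle_sign U (T - U) * a U * b (T - U) * c (S - T))"
      by (rule sum.Sigma) (use fin fs in auto)
    also have "\<dots> = (\<Sum>(U, V)\<in>(SIGMA U:Pow S. Pow (S - U)). ?g U V)"
    proof -
      have key: "?g U (T - U) =
           shuffle_sign T (S - T) * shuffle_sign U (T - U) * a U * b (T - U) * c (S - T)"
        if TU: "T \<subseteq> S" "U \<subseteq> T" for T U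
      proof -
        have T: "T = U \<union> (T - U)" using TU by auto
        have ST: "S - U - (T - U) = S - T" using TU by auto
        have "(shuffle_sign T (S - T) :: 'k) = shuffle_sign U (S - T) * shuffle_sign (T - U) (S - T)"
          by (subst T, rule shuffle_sign_Un_left) (use TU fs in auto)
        then show ?thesis
          by (simp add: ST)
      qed
      show ?thesis
      proof (rule sum.reindex_bij_witness[of _ "\<lambda>(U, V). (U \<union> V, U)" "\<lambda>(T, U). (U, T - U)"])
        fix p assume p: "p \<in> (SIGMA T:Pow S. Pow T)"
        then obtain T U where TU: "p = (T, U)" "T \<subseteq> S" "U \<subseteq> T" by auto
        show "(case case p of (T, U) \<Rightarrow> (U, T - U) of (U, V) \<Rightarrow> ?g U V) =
          (case p of (T, U) \<Rightarrow>
            shuffle_sign T (S - T) * shuffle_sign U (T - U) * a U * b (T - U) * c (S - T))"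
          using key[OF TU(2,3)] unfolding TU(1) by (simp only: prod.case)
      qed auto
    qed
    also have "\<dots> = (\<Sum>U\<in>Pow S. \<Sum>V\<in>Pow (S - U). ?g U V)"
      by (rule sum.Sigma[symmetric]) (use fin fs in auto)
    also have "\<dots> = (\<Sum>U\<in>Pow S. \<Sum>V\<in>Pow (S - U). shuffle_sign U (S - U) * a U *
                       (shuffle_sign V (S - U - V) * b V * c (S - U - V)))"
    proof (intro sum.cong refl)
      fix U V assume UV: "U \<in> Pow S" "V \<in> Pow (S - U)"
      have SU: "S - U = V \<union> (S - U - V)" using UV by auto
      have "(shuffle_sign U (S - U) :: 'k) = shuffle_sign U V * shuffle_sign U (S - U - V)"
        by (subst SU, rule shuffle_sign_Un_right) (use UV in \<open>auto intro: fs\<close>)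
      then show "?g U V = shuffle_sign U (S - U) * a U * (shuffle_sign V (S - U - V) * b V * c (S - U - V))"
        by simp
    qed
    also have "\<dots> = ext_mult a (ext_mult b c) S"
      by (simp add: ext_mult_def sum_distrib_left)
    finally show ?thesis .
  qed
qed

lemma ext_mult_monomials:
  assumes "finite T" "finite U"
  shows "ext_mult (ext_monomial T) (ext_monomial U) =
    (if T \<inter> U = {} then (\<lambda>S. shuffle_sign T U * ext_monomial (T \<union> U) S) else (\<lambda>S. 0 :: 'k::field))"
proof
  fix S
  have "ext_mult (ext_monomial T) (ext_monomial U) S =
      (\<Sum>X\<in>Pow S. if X = T then (if S - T = U then shuffle_sign T U else 0) else (0::'k))"
    unfolding ext_mult_def by (rule sum.cong) (auto simp: ext_monomial_def)
  also have "\<dots> = (if finite S \<and> T \<subseteq> S \<and> S - T = U then shuffle_sign T U else 0)"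
    by (cases "finite S") auto
  also have "(finite S \<and> T \<subseteq> S \<and> S - T = U) \<longleftrightarrow> (S = T \<union> U \<and> T \<inter> U = {})"
    using assms by auto
  finally show "ext_mult (ext_monomial T) (ext_monomial U) S =
    (if T \<inter> U = {} then (\<lambda>S. shuffle_sign T U * ext_monomial (T \<union> U) S) else (\<lambda>S. 0 :: 'k)) S"
    by (auto simp: ext_monomial_def)
qed

lemma ext_gen_square: "ext_mult (ext_gen i) (ext_gen i) = (\<lambda>S. 0 :: 'k::field)"
  by (simp add: ext_gen_def ext_mult_monomials)

lemma ext_gen_anticommute:
  "ext_mult (ext_gen i) (ext_gen j) = (\<lambda>S. - ext_mult (ext_gen j) (ext_gen i) S :: 'k::field)"
proof (cases "i = j")
  case True
  then show ?thesis by (simp add: ext_gen_square)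
next
  case False
  have inv: "{(t, u). t \<in> {i} \<and> u \<in> {j} \<and> u < t} = (if j < i then {(i, j)} else {})" for i j :: nat
    by auto
  have sign: "(shuffle_sign {i} {j} :: 'k) = (if j < i then -1 else 1)" for i j
    unfolding shuffle_sign_def inv by simp
  show ?thesis
    using False
    by (cases i j rule: linorder_cases)
       (auto simp: ext_gen_def ext_mult_monomials sign insert_commute fun_eq_iff)
qed

lemma ext_monomial_insert_gen:
  assumes "finite S" "\<And>s. s \<in> S \<Longrightarrow> i < s"
  shows "(ext_monomial (insert i S) :: nat set \<Rightarrow> 'k::field) = ext_mult (ext_gen i) (ext_monomial S)"
proof -
  have empty: "{(t, u). t \<in> {i} \<and> u \<in> S \<and> u < t} = {}" and "i \<notin> S"
    using assms(2) by fastforce+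
  have "(shuffle_sign {i} S :: 'k) = 1"
    unfolding shuffle_sign_def empty by simp
  with \<open>i \<notin> S\<close> show ?thesis
    using assms(1) by (simp add: ext_gen_def ext_mult_monomials)
qed

lemma ext_mult_add:
  fixes a b c :: "nat set \<Rightarrow> 'k::field"
  shows "ext_mult (\<lambda>S. a S + b S) c = (\<lambda>S. ext_mult a c S + ext_mult b c S)"
    and "ext_mult c (\<lambda>S. a S + b S) = (\<lambda>S. ext_mult c a S + ext_mult c b S)"
  by (simp_all add: ext_mult_def fun_eq_iff distrib_left distrib_right sum.distrib)

lemma ring_exterior_algebra: "ring (exterior_algebra m :: (nat set \<Rightarrow> 'k::field) graded_ring)"
proof (rule ringI)
  let ?E = "exterior_algebra m :: (nat set \<Rightarrow> 'k) graded_ring"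
  show "abelian_group ?E"
  proof (rule abelian_groupI)
    fix a assume "a \<in> carrier ?E"
    then show "\<exists>b\<in>carrier ?E. b \<oplus>\<^bsub>?E\<^esub> a = \<zero>\<^bsub>?E\<^esub>"
      by (intro bexI[of _ "\<lambda>S. - a S"]) (auto simp: exterior_algebra_def)
  next
    fix a b assume "a \<in> carrier ?E" "b \<in> carrier ?E"
    then have "S \<subseteq> {1..m}" if "a S + b S \<noteq> 0" for S
      using that by (cases "a S = 0") (simp_all add: exterior_algebra_def)
    then show "a \<oplus>\<^bsub>?E\<^esub> b \<in> carrier ?E"
      by (simp add: exterior_algebra_def)
  qed (simp_all add: exterior_algebra_def add_ac)
  show "monoid ?E"
  proof (rule monoidI)
    fix a b assume ab: "a \<in> carrier ?E" "b \<in> carrier ?E"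
    have "S \<subseteq> {1..m}" if nz: "ext_mult a b S \<noteq> 0" for S
    proof -
      obtain T where "T \<in> Pow S" "shuffle_sign T (S - T) * a T * b (S - T) \<noteq> 0"
        by (rule sum.not_neutral_contains_not_neutral[OF nz[unfolded ext_mult_def]])
      then have "T \<subseteq> {1..m}" "S - T \<subseteq> {1..m}"
        using ab by (auto simp: exterior_algebra_def)
      then show ?thesis by blast
    qed
    then show "a \<otimes>\<^bsub>?E\<^esub> b \<in> carrier ?E"
      by (auto simp: exterior_algebra_def)
  next
    show "\<one>\<^bsub>?E\<^esub> \<in> carrier ?E"
      by (auto simp: exterior_algebra_def ext_monomial_def)
  next
    fix a b c
    show "a \<otimes>\<^bsub>?E\<^esub> b \<otimes>\<^bsub>?E\<^esub> c = a \<otimes>\<^bsub>?E\<^esub> (b \<otimes>\<^bsub>?E\<^esub> c)"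
      by (simp add: exterior_algebra_def ext_mult_assoc)
  next
    fix a assume a: "a \<in> carrier ?E"
    have inf: "a S = 0" if "infinite S" for S
      using a that finite_subset[of S "{1..m}"] by (auto simp: exterior_algebra_def)
    have "ext_mult (ext_monomial {}) a S = a S" for S
    proof -
      have "ext_mult (ext_monomial {}) a S = (\<Sum>T\<in>Pow S. if T = {} then a S else 0)"
        unfolding ext_mult_def by (rule sum.cong) (auto simp: ext_monomial_def)
      then show ?thesis using inf by (cases "finite S") auto
    qed
    then show "\<one>\<^bsub>?E\<^esub> \<otimes>\<^bsub>?E\<^esub> a = a"
      by (auto simp: exterior_algebra_def)
    have "ext_mult a (ext_monomial {}) S = a S" for S
    proof -
      have "ext_mult a (ext_monomial {}) S = (\<Sum>T\<in>Pow S. if T = S then a S else 0)"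
        unfolding ext_mult_def by (rule sum.cong) (auto simp: ext_monomial_def)
      then show ?thesis using inf by (cases "finite S") auto
    qed
    then show "a \<otimes>\<^bsub>?E\<^esub> \<one>\<^bsub>?E\<^esub> = a"
      by (auto simp: exterior_algebra_def)
  qed
qed (simp_all add: exterior_algebra_def ext_mult_add)

end

theory Submission
  imports Defs "HOL-Library.Function_Algebras"
begin

text \<open>
  Tensoring a graded free module with the residue field keeps the constant terms of the coordinates, so
  for every graded free resolution \<open>F\<close> of \<open>E/(f)\<close> the vanishing of \<open>Tor\<close> says that an element
  with \<open>d v\<close> in the ideal \<open>(e\<^sub>1, \<dots>, e\<^bsub>2n\<^esub>)F\<close> is a boundary modulo this ideal.

  Multiplication by \<open>f\<close> maps degree \<open>n - 1\<close> onto degree \<open>n + 1\<close> in characteristic \<open>0\<close>: after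
  splitting off the unpaired generators, this is the invertibility of the inclusion matrix between the two
  middle levels of a Boolean lattice.  Hence \<open>E/(f)\<close> vanishes above degree \<open>n\<close>, and a filtration argument
  along \<open>E \<rightarrow> E/(e\<^sub>1) \<rightarrow> E/(e\<^sub>1, e\<^sub>2) \<rightarrow> \<dots>\<close> bounds the regularity by \<open>n\<close>.  By duality \<open>f\<close> has no annihilator
  in degree \<open>n - 1\<close>, so its annihilator \<open>e\<^sub>1 e\<^sub>3 \<cdots> e\<^bsub>2n-1\<^esub>\<close> of degree \<open>n\<close> is a minimal
  syzygy and gives a nonzero class in \<open>Tor\<^sub>2\<close> of internal degree \<open>n + 2\<close>.
\<close>

section \<open>Arithmetic of the exterior algebra\<close>

text \<open>\<open>Tor\<close> is computed from a resolution picked by \<open>SOME\<close>, of which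
  only exactness and the grading are known; it need not be minimal. Hence one graded free resolution
  is constructed, and both bounds are proved for every such resolution, on representatives of
  homology classes.

  The upper bound rests on the exact sequences 0 -> E/(e_1,...,e_(k+1))(-1) -> E/(e_1,...,e_k) ->
  E/(e_1,...,e_(k+1)) -> 0 of left modules, whose left map is right multiplication by e_(k+1). The
  connecting map lowers homological and internal degree by one each, so j - i is unchanged and the
  degree bound for E/(f) passes to all \<open>Tor\<close> groups.

  For the lower bound, a chain map to E <- E(-2) replaces minimality: it separates the syzygy from
  the boundaries, because an obstruction would be an annihilator of f of degree n - 1.

  Characteristic 0 enters through the division by (t + 1)! in the inverse inclusion matrix. Free
  modules carry their scalars on the right, so linear maps bring in no signs; those of the product
  vanish for f because its blocks consist of adjacent generators.\<close>

lemma ext_ring_simps [simp]: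
  "x \<otimes>\<^bsub>exterior_algebra m\<^esub> y = ext_mult x y"
  "x \<oplus>\<^bsub>exterior_algebra m\<^esub> y = x + y"
  "\<one>\<^bsub>exterior_algebra m\<^esub> = ext_monomial {}"
  "\<zero>\<^bsub>exterior_algebra m\<^esub> = 0"
  by (simp_all add: exterior_algebra_def plus_fun_def zero_fun_def)

lemma ext_carrier_iff: "a \<in> carrier (exterior_algebra m) \<longleftrightarrow> (\<forall>S. a S \<noteq> 0 \<longrightarrow> S \<subseteq> {1..m})"
  by (simp add: exterior_algebra_def)

lemma ext_part_iff:
  "a \<in> ring_part (exterior_algebra m) j \<longleftrightarrow> (\<forall>S. a S \<noteq> 0 \<longrightarrow> S \<subseteq> {1..m} \<and> int (card S) = j)"
  by (simp add: exterior_algebra_def)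

lemma ext_part_carrier: "a \<in> ring_part (exterior_algebra m) j \<Longrightarrow> a \<in> carrier (exterior_algebra m)"
  by (simp add: ext_part_iff ext_carrier_iff)

lemma ext_carrier_infinite: "a \<in> carrier (exterior_algebra m) \<Longrightarrow> infinite S \<Longrightarrow> a S = 0"
  by (metis ext_carrier_iff finite_atLeastAtMost finite_subset)

definition ext_scale :: "'k \<Rightarrow> (nat set \<Rightarrow> 'k) \<Rightarrow> nat set \<Rightarrow> 'k::field"
  where "ext_scale c a = (\<lambda>S. c * a S)"

lemma ext_carrier_intros [intro, simp]:
  "0 \<in> carrier (exterior_algebra m)"
  "a \<in> carrier (exterior_algebra m) \<Longrightarrow> b \<in> carrier (exterior_algebra m) \<Longrightarrow> a + b \<in> carrier (exterior_algebra m)"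
  "a \<in> carrier (exterior_algebra m) \<Longrightarrow> b \<in> carrier (exterior_algebra m) \<Longrightarrow> a - b \<in> carrier (exterior_algebra m)"
  "a \<in> carrier (exterior_algebra m) \<Longrightarrow> - a \<in> carrier (exterior_algebra m)"
  "a \<in> carrier (exterior_algebra m) \<Longrightarrow> ext_scale c a \<in> carrier (exterior_algebra m)"
  "S \<subseteq> {1..m} \<Longrightarrow> ext_monomial S \<in> carrier (exterior_algebra m)"
  "1 \<le> i \<Longrightarrow> i \<le> m \<Longrightarrow> ext_gen i \<in> carrier (exterior_algebra m)"
       apply (simp_all add: ext_carrier_iff ext_scale_def ext_monomial_def ext_gen_def)
   apply (metis add.right_neutral)
  by (metis diff_zero)

lemma ext_mult_closed [intro, simp]:
  assumes "a \<in> carrier (exterior_algebra m)" "b \<in> carrier (exterior_algebra m)"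
  shows "ext_mult a b \<in> carrier (exterior_algebra m)"
  using ring.ring_simprules(5)[OF ring_exterior_algebra assms] by simp

lemma ext_mult_one [simp]:
  assumes "a \<in> carrier (exterior_algebra m)"
  shows "ext_mult a (ext_monomial {}) = a" "ext_mult (ext_monomial {}) a = a"
  using monoid.r_one[OF ring.is_monoid[OF ring_exterior_algebra] assms]
    monoid.l_one[OF ring.is_monoid[OF ring_exterior_algebra] assms] by simp_all

lemma ext_mult_distrib:
  "ext_mult (a + b) c = ext_mult a c + ext_mult b c"
  "ext_mult c (a + b) = ext_mult c a + ext_mult c b"
  by (simp_all add: ext_mult_add plus_fun_def)

lemma ext_mult_zero [simp]: "ext_mult 0 c = 0" "ext_mult c 0 = 0"
  by (simp_all add: ext_mult_def fun_eq_iff)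

lemma ext_mult_uminus: "ext_mult (- a) c = - ext_mult a c" "ext_mult c (- a) = - ext_mult c a"
  by (simp_all add: ext_mult_def fun_eq_iff sum_negf)

lemma ext_mult_diff:
  "ext_mult (a - b) c = ext_mult a c - ext_mult b c"
  "ext_mult c (a - b) = ext_mult c a - ext_mult c b"
  by (simp_all only: diff_conv_add_uminus ext_mult_distrib ext_mult_uminus)

lemma ext_mult_sum:
  "ext_mult (\<Sum>x\<in>A. g x) c = (\<Sum>x\<in>A. ext_mult (g x) c)"
  "ext_mult c (\<Sum>x\<in>A. g x) = (\<Sum>x\<in>A. ext_mult c (g x))"
  by (induction A rule: infinite_finite_induct) (simp_all add: ext_mult_distrib)

lemma ext_mult_scale:
  "ext_mult (ext_scale c a) b = ext_scale c (ext_mult a b)"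
  "ext_mult a (ext_scale c b) = ext_scale c (ext_mult a b)"
  by (simp_all add: ext_mult_def ext_scale_def fun_eq_iff sum_distrib_left mult_ac)

lemma ext_sum_closed [intro]:
  "(\<And>x. x \<in> A \<Longrightarrow> g x \<in> carrier (exterior_algebra m)) \<Longrightarrow> (\<Sum>x\<in>A. g x) \<in> carrier (exterior_algebra m)"
  by (induction A rule: infinite_finite_induct) auto

lemma sum_fun_apply: "(\<Sum>x\<in>A. g x) y = (\<Sum>x\<in>A. g x y)"
  by (induction A rule: infinite_finite_induct) simp_all

lemma ext_part_zero [intro, simp]: "0 \<in> ring_part (exterior_algebra m) j"
  by (simp add: ext_part_iff)

lemma ext_part_add [intro]:
  assumes "a \<in> ring_part (exterior_algebra m) j" "b \<in> ring_part (exterior_algebra m) j"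
  shows "a + b \<in> ring_part (exterior_algebra m) j"
  using assms unfolding ext_part_iff plus_fun_apply by (metis add_0)

lemma ext_part_uminus [intro]:
  assumes "a \<in> ring_part (exterior_algebra m) j"
  shows "- a \<in> ring_part (exterior_algebra m) j"
  using assms unfolding ext_part_iff by simp

lemma ext_part_sum [intro]:
  "(\<And>x. x \<in> A \<Longrightarrow> g x \<in> ring_part (exterior_algebra m) j) \<Longrightarrow> (\<Sum>x\<in>A. g x) \<in> ring_part (exterior_algebra m) j"
  by (induction A rule: infinite_finite_induct) auto

lemma ext_part_scale [intro]:
  "a \<in> ring_part (exterior_algebra m) j \<Longrightarrow> ext_scale c a \<in> ring_part (exterior_algebra m) j"
  by (simp add: ext_part_iff ext_scale_def)

lemma ext_part_monomial [intro]:
  "S \<subseteq> {1..m} \<Longrightarrow> int (card S) = j \<Longrightarrow> ext_monomial S \<in> ring_part (exterior_algebra m) j"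
  by (simp add: ext_part_iff ext_monomial_def)

lemma ext_part_mult [intro]:
  assumes "a \<in> ring_part (exterior_algebra m) p" "b \<in> ring_part (exterior_algebra m) q"
  shows "ext_mult a b \<in> ring_part (exterior_algebra m) (p + q)"
  unfolding ext_part_iff
proof (intro allI impI)
  fix S assume nz: "ext_mult a b S \<noteq> 0"
  obtain T where T: "T \<in> Pow S" "shuffle_sign T (S - T) * a T * b (S - T) \<noteq> 0"
    by (rule sum.not_neutral_contains_not_neutral[OF nz[unfolded ext_mult_def]])
  then have *: "T \<subseteq> {1..m}" "S - T \<subseteq> {1..m}" "int (card T) = p" "int (card (S - T)) = q"
    using assms by (auto simp: ext_part_iff)
  have "finite T" "finite (S - T)" using * finite_subset by blast+
  then have "card S = card T + card (S - T)"
    using T(1) card_Un_disjoint[of T "S - T"] by (simp add: Un_absorb1)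
  then show "S \<subseteq> {1..m} \<and> int (card S) = p + q"
    using * T(1) by auto
qed

lemma ext_mult_monomial_left:
  "ext_mult (ext_monomial T) a S = (if T \<subseteq> S \<and> finite S then shuffle_sign T (S - T) * a (S - T) else 0)"
proof -
  have "ext_mult (ext_monomial T) a S = (\<Sum>X\<in>Pow S. if X = T then shuffle_sign T (S - T) * a (S - T) else 0)"
    unfolding ext_mult_def by (rule sum.cong) (auto simp: ext_monomial_def)
  then show ?thesis by (cases "finite S") auto
qed

lemma ext_mult_monomial_right:
  "ext_mult a (ext_monomial T) S = (if T \<subseteq> S \<and> finite S then shuffle_sign (S - T) T * a (S - T) else 0)"
proof -
  have "ext_mult a (ext_monomial T) S =
      (\<Sum>X\<in>Pow S. if X = S - T then (if T \<subseteq> S then shuffle_sign (S - T) T * a (S - T) else 0) else 0)"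
    unfolding ext_mult_def
  proof (rule sum.cong)
    fix X assume X: "X \<in> Pow S"
    have "S - X = T \<longleftrightarrow> X = S - T \<and> T \<subseteq> S" using X by auto
    then show "shuffle_sign X (S - X) * a X * ext_monomial T (S - X) =
         (if X = S - T then (if T \<subseteq> S then shuffle_sign (S - T) T * a (S - T) else 0) else 0)"
      by (auto simp: ext_monomial_def double_diff)
  qed simp
  then show ?thesis by (cases "finite S") auto
qed

lemma shuffle_sign_square [simp]: "shuffle_sign T U * shuffle_sign T U = 1"
  by (simp add: shuffle_sign_def power_add[symmetric] mult_2[symmetric])

lemma shuffle_sign_square' [simp]: "shuffle_sign T U * (shuffle_sign T U * x) = x"
  using shuffle_sign_square[of T U] by (simp flip: mult.assoc)

lemma shuffle_sign_nonzero [simp]: "shuffle_sign T U \<noteq> 0"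
  by (simp add: shuffle_sign_def)

lemma ext_expand:
  assumes "a \<in> carrier (exterior_algebra m)"
  shows "a = (\<Sum>S\<in>Pow {1..m}. ext_scale (a S) (ext_monomial S))"
proof
  fix S
  have "(\<Sum>T\<in>Pow {1..m}. a T * (if S = T then 1 else 0)) = (\<Sum>T\<in>Pow {1..m}. if S = T then a T else 0)"
    by (rule sum.cong) auto
  also have "\<dots> = (if S \<in> Pow {1..m} then a S else 0)"
    by (rule sum.delta') simp
  finally show "a S = (\<Sum>S\<in>Pow {1..m}. ext_scale (a S) (ext_monomial S)) S"
    using assms by (auto simp: sum_fun_apply ext_scale_def ext_monomial_def ext_carrier_iff)
qed

section \<open>Ideals, cosets and finite sums, expressed by the pointwise operations\<close>

lemma ext_uminus:
  assumes "a \<in> carrier (exterior_algebra m)"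
  shows "\<ominus>\<^bsub>exterior_algebra m\<^esub> a = - a"
  by (rule abelian_group.minus_equality[OF ring.is_abelian_group[OF ring_exterior_algebra]])
     (use assms in auto)

lemma ext_minus:
  assumes "a \<in> carrier (exterior_algebra m)" "b \<in> carrier (exterior_algebra m)"
  shows "a \<ominus>\<^bsub>exterior_algebra m\<^esub> b = a - b"
  using assms by (simp add: a_minus_def ext_uminus)

lemma ext_idealI:
  assumes "I \<subseteq> carrier (exterior_algebra m)" "0 \<in> I"
    and "\<And>a b. a \<in> I \<Longrightarrow> b \<in> I \<Longrightarrow> a + b \<in> I"
    and "\<And>a r. a \<in> I \<Longrightarrow> r \<in> carrier (exterior_algebra m) \<Longrightarrow> ext_mult r a \<in> I"
    and "\<And>a r. a \<in> I \<Longrightarrow> r \<in> carrier (exterior_algebra m) \<Longrightarrow> ext_mult a r \<in> I"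
  shows "ideal I (exterior_algebra m :: (nat set \<Rightarrow> 'k::field) graded_ring)"
proof (rule idealI)
  show "ring (exterior_algebra m :: (nat set \<Rightarrow> 'k) graded_ring)" by (rule ring_exterior_algebra)
  show "subgroup I (add_monoid (exterior_algebra m))"
  proof (rule subgroup.intro)
    fix a assume a: "a \<in> I"
    then have ac: "a \<in> carrier (exterior_algebra m)" using assms(1) by auto
    have "inv\<^bsub>add_monoid (exterior_algebra m)\<^esub> a = - a"
      using ext_uminus[OF ac] by (simp add: a_inv_def)
    \<comment> \<open>Negation is multiplication by minus one, so closure under right multiplication
      supplies additive inverses.\<close>
    moreover have "- a = ext_mult a (- ext_monomial {})"
      using ac by (simp add: ext_mult_uminus)
    moreover have "ext_mult a (- ext_monomial {}) \<in> I"
      by (rule assms(5)[OF a]) auto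
    ultimately show "inv\<^bsub>add_monoid (exterior_algebra m)\<^esub> a \<in> I" by simp
  qed (use assms in auto)
qed (use assms in auto)

lemma ext_coset_mem:
  "b \<in> I +>\<^bsub>exterior_algebra m\<^esub> a \<longleftrightarrow> b - a \<in> I"
  by (auto simp: a_r_coset_def r_coset_def intro: bexI[of _ "b - a"])

lemma ext_coset_eq_iff:
  assumes "ideal I (exterior_algebra m)" "a \<in> carrier (exterior_algebra m)" "b \<in> carrier (exterior_algebra m)"
  shows "I +>\<^bsub>exterior_algebra m\<^esub> a = I +>\<^bsub>exterior_algebra m\<^esub> b \<longleftrightarrow> a - b \<in> I"
  using ring.quotient_eq_iff_same_a_r_cos[OF ring_exterior_algebra assms]
  by (simp add: ext_minus assms)

lemma ext_coset_mult:
  assumes "ideal I (exterior_algebra m)" "a \<in> carrier (exterior_algebra m)" "b \<in> carrier (exterior_algebra m)"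
  shows "(I +>\<^bsub>exterior_algebra m\<^esub> a) \<otimes>\<^bsub>exterior_algebra m Quot I\<^esub> (I +>\<^bsub>exterior_algebra m\<^esub> b)
     = I +>\<^bsub>exterior_algebra m\<^esub> ext_mult a b"
  using ideal.rcoset_mult_add[OF assms] by (simp add: FactRing_def)

lemma ext_coset_add:
  assumes "ideal I (exterior_algebra m)" "a \<in> carrier (exterior_algebra m)" "b \<in> carrier (exterior_algebra m)"
  shows "(I +>\<^bsub>exterior_algebra m\<^esub> a) \<oplus>\<^bsub>exterior_algebra m Quot I\<^esub> (I +>\<^bsub>exterior_algebra m\<^esub> b)
     = I +>\<^bsub>exterior_algebra m\<^esub> (a + b)"
  using abelian_subgroup.a_rcos_sum[OF abelian_subgroupI3 assms(2,3), of I] assms(1)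
  by (simp add: FactRing_def ideal.axioms(1) additive_subgroup.a_subgroup ring.is_abelian_group ring_exterior_algebra)

lemma finsum_exterior_algebra:
  assumes "\<And>x. x \<in> A \<Longrightarrow> g x \<in> carrier (exterior_algebra m)"
  shows "finsum (exterior_algebra m) g A = (\<Sum>x\<in>A. g x :: nat set \<Rightarrow> 'k::field)"
  using assms
proof (induction A rule: infinite_finite_induct)
  \<comment> \<open>On an infinite index set both sums take the default value zero.\<close>
  case (infinite A)
  then show ?case by (simp add: finsum_def finprod_def)
next
  case empty
  then show ?case
    using abelian_monoid.finsum_empty[OF abelian_group.axioms(1)[OF ring.is_abelian_group[OF ring_exterior_algebra]], of m g]
    by (simp only: ext_ring_simps sum.empty)
next
  case (insert x A)
  then show ?case
    using abelian_monoid.finsum_insert[OF abelian_group.axioms(1)[OF ring.is_abelian_group[OF ring_exterior_algebra]],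
        of A x g m] by auto
qed

section \<open>Multiplication by the symplectic form\<close>

definition pair_block :: "nat \<Rightarrow> nat set"
  where "pair_block i = {2 * i - 1, 2 * i}"

definition symplectic_form :: "nat \<Rightarrow> nat set \<Rightarrow> 'k::field"
  where "symplectic_form n = (\<Sum>i\<in>{1..n}. ext_monomial (pair_block i))"

section \<open>The blocks of paired generators and the product with their sum\<close>

lemma mem_pair_block: "1 \<le> i \<Longrightarrow> x \<in> pair_block i \<longleftrightarrow> i = (x + 1) div 2"
  unfolding pair_block_def by auto

lemma card_pair_block: "1 \<le> i \<Longrightarrow> card (pair_block i) = 2"
  unfolding pair_block_def by (subst card_insert_disjoint) auto

lemma finite_pair_block [simp]: "finite (pair_block i)"
  by (simp add: pair_block_def)

lemma pair_block_disjoint: "1 \<le> i \<Longrightarrow> 1 \<le> j \<Longrightarrow> i \<noteq> j \<Longrightarrow> pair_block i \<inter> pair_block j = {}"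
  by (auto simp: mem_pair_block)

lemma pair_block_subset: "1 \<le> i \<Longrightarrow> i \<le> n \<Longrightarrow> pair_block i \<subseteq> {1..2 * n}"
  by (auto simp: pair_block_def)

text \<open>A block consists of two consecutive numbers, so an element outside lies above both or
  below both. Inversions with the block therefore come in pairs.\<close>

lemma shuffle_sign_pair_block:
  assumes "1 \<le> i" "pair_block i \<inter> U = {}"
  shows "shuffle_sign (pair_block i) U = 1" "shuffle_sign U (pair_block i) = 1"
proof -
  have lt: "u < 2 * i \<longleftrightarrow> u < 2 * i - 1" "2 * i - 1 < u \<longleftrightarrow> 2 * i < u" if "u \<in> U" for u
  proof -
    have "u \<noteq> 2 * i" "u \<noteq> 2 * i - 1" using that assms(2) unfolding pair_block_def by auto
    then show "u < 2 * i \<longleftrightarrow> u < 2 * i - 1" "2 * i - 1 < u \<longleftrightarrow> 2 * i < u" using assms(1) by arith+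
  qed
  have 1: "{(t, u). t \<in> pair_block i \<and> u \<in> U \<and> u < t} = pair_block i \<times> {u \<in> U. u < 2 * i}"
    and 2: "{(t, u). t \<in> U \<and> u \<in> pair_block i \<and> u < t} = {t \<in> U. 2 * i < t} \<times> pair_block i"
    using lt by (auto simp: pair_block_def)
  show "shuffle_sign (pair_block i) U = 1" "shuffle_sign U (pair_block i) = 1"
    unfolding shuffle_sign_def 1 2 card_cartesian_product using assms(1) by (simp_all add: card_pair_block)
qed

lemma symplectic_form_eq_gens:
  "symplectic_form n = (\<Sum>i\<in>{1..n}. ext_mult (ext_gen (2 * i - 1)) (ext_gen (2 * i)))"
  unfolding symplectic_form_def
proof (rule sum.cong)
  fix i assume "i \<in> {1..n}"
  then have i: "1 \<le> i" by simp
  have inv: "{(t, u). t \<in> {2 * i - 1} \<and> u \<in> {2 * i} \<and> u < t} = {}"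
    by auto
  have "(shuffle_sign {2 * i - 1} {2 * i} :: 'a) = 1"
    unfolding shuffle_sign_def inv by simp
  then show "ext_monomial (pair_block i) = (ext_mult (ext_gen (2 * i - 1)) (ext_gen (2 * i)) :: nat set \<Rightarrow> 'a)"
    using i by (simp add: ext_gen_def ext_mult_monomials pair_block_def insert_commute)
qed simp

lemma symplectic_form_part [intro, simp]: "symplectic_form n \<in> ring_part (exterior_algebra (2 * n)) 2"
  unfolding symplectic_form_def
  by (intro ext_part_sum ext_part_monomial) (auto simp: card_pair_block dest: subsetD[OF pair_block_subset, rotated 2])

lemma symplectic_form_carrier [intro, simp]: "symplectic_form n \<in> carrier (exterior_algebra (2 * n))"
  using symplectic_form_part ext_part_carrier by blast

text \<open>All signs are those of a block against its complement, hence trivial. The two formulas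
  agree, which gives centrality of the form.\<close>

lemma symplectic_form_mult:
  "ext_mult (symplectic_form n) a S = (\<Sum>i\<in>{1..n}. if pair_block i \<subseteq> S \<and> finite S then a (S - pair_block i) else 0)"
  "ext_mult a (symplectic_form n) S = (\<Sum>i\<in>{1..n}. if pair_block i \<subseteq> S \<and> finite S then a (S - pair_block i) else 0)"
proof -
  have disj: "pair_block i \<inter> (S - pair_block i) = {}" for i by auto
  show "ext_mult (symplectic_form n) a S = (\<Sum>i\<in>{1..n}. if pair_block i \<subseteq> S \<and> finite S then a (S - pair_block i) else 0)"
    unfolding symplectic_form_def ext_mult_sum sum_fun_apply ext_mult_monomial_left
    by (rule sum.cong) (auto simp: shuffle_sign_pair_block(1)[OF _ disj])
  show "ext_mult a (symplectic_form n) S = (\<Sum>i\<in>{1..n}. if pair_block i \<subseteq> S \<and> finite S then a (S - pair_block i) else 0)"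
    unfolding symplectic_form_def ext_mult_sum sum_fun_apply ext_mult_monomial_right
    by (rule sum.cong) (auto simp: shuffle_sign_pair_block(2)[OF _ disj])
qed

lemma symplectic_form_commute: "ext_mult a (symplectic_form n) = ext_mult (symplectic_form n) a"
  by (rule ext) (simp add: symplectic_form_mult)

text \<open>Multiplication by the form acts as an up operator: it adds one block disjoint from
  \<open>R\<close>, always with coefficient one. This is where the Boolean lattice of blocks
  appears.\<close>

lemma symplectic_form_monomial:
  assumes "finite R"
  shows "ext_mult (symplectic_form n) (ext_monomial R) =
    (\<Sum>i | i \<in> {1..n} \<and> pair_block i \<inter> R = {}. ext_monomial (R \<union> pair_block i) :: nat set \<Rightarrow> 'k::field)"
proof -
  have "ext_mult (symplectic_form n) (ext_monomial R) =
     (\<Sum>i\<in>{1..n}. if pair_block i \<inter> R = {} then ext_monomial (R \<union> pair_block i) else (0 :: nat set \<Rightarrow> 'k))"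
    unfolding symplectic_form_def ext_mult_sum
    by (rule sum.cong)
       (auto simp: ext_mult_monomials assms shuffle_sign_pair_block Un_commute zero_fun_def)
  also have "\<dots> = (\<Sum>i | i \<in> {1..n} \<and> pair_block i \<inter> R = {}. ext_monomial (R \<union> pair_block i))"
    by (simp add: sum.inter_filter[symmetric])
  finally show ?thesis .
qed

text \<open>
  The inverse of the inclusion matrix between the \<open>t\<close>-subsets and the \<open>(t+1)\<close>-subsets of a set of
  size \<open>2t+1\<close> has the entry \<open>middle_weight t s\<close> where \<open>s\<close> elements of the smaller set lie outside the larger one.
\<close>

definition middle_weight :: "nat \<Rightarrow> nat \<Rightarrow> 'k::field_char_0"
  where "middle_weight t s = (- 1) ^ s * fact s * fact (t - s) / fact (t + 1)"

text \<open>Up to opposite signs both summands equal s! (t + 1 - s)! / (t + 1)!, so they cancel. For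
  \<open>s = 0\<close> the first one has coefficient zero and the second one is 1.\<close>

lemma middle_weight_recurrence:
  assumes "s \<le> t"
  shows "of_nat s * middle_weight t (s - 1) + of_nat (t + 1 - s) * middle_weight t s
    = (if s = 0 then 1 else 0 :: 'k::field_char_0)"
proof (cases s)
  case 0
  have "fact (t + 1) = of_nat (t + 1) * (fact t :: 'k)" by simp
  then show ?thesis using 0
    by (simp add: middle_weight_def del: of_nat_Suc of_nat_add)
next
  case (Suc r)
  then obtain q where q: "t = s + q" using assms less_eqE by blast
  have "fact (Suc q) = of_nat (Suc q) * (fact q :: 'k)" "fact (Suc r) = of_nat (Suc r) * (fact r :: 'k)"
    by simp_all
  moreover have "t - r = Suc q" "t - s = q" "t + 1 - s = Suc q" "s - 1 = r"
    using Suc q by simp_all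
  ultimately show ?thesis unfolding middle_weight_def
    by (simp add: Suc mult_ac del: fact_Suc of_nat_Suc)
qed

text \<open>One entry of the matrix product: \<open>B - {x}\<close> runs through the
  \<open>t\<close>-subsets of \<open>B\<close>, and the summand depends only on whether
  \<open>x\<close> lies in \<open>C\<close>. A common element keeps \<open>card (B - C)\<close> at
  most \<open>t\<close>, the range of the recurrence.\<close>

lemma middle_weight_sum:
  assumes "finite B" "card B = t + 1" "B \<inter> C \<noteq> {}"
  shows "(\<Sum>x\<in>B. middle_weight t (card (B - {x} - C))) = (if B \<subseteq> C then 1 else 0 :: 'k::field_char_0)"
proof -
  let ?s = "card (B - C)"
  have "B - C \<subset> B" using assms(3) by auto
  then have le: "?s \<le> t" using psubset_card_mono[OF assms(1), of "B - C"] assms(2) by simp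
  have c: "card (B \<inter> C) = t + 1 - ?s"
    using card_Int_Diff[OF assms(1), of C] assms(2) by simp
  have "(\<Sum>x\<in>B. middle_weight t (card (B - {x} - C))) =
     (\<Sum>x\<in>B - C. middle_weight t (card (B - {x} - C))) + (\<Sum>x\<in>B \<inter> C. middle_weight t (card (B - {x} - C)) :: 'k)"
    by (subst sum.Int_Diff[OF assms(1), of _ C]) (rule add.commute)
  also have "(\<Sum>x\<in>B - C. middle_weight t (card (B - {x} - C))) = (\<Sum>x\<in>B - C. middle_weight t (?s - 1) :: 'k)"
  proof (rule sum.cong)
    fix x assume "x \<in> B - C"
    moreover have "B - {x} - C = B - C - {x}" by auto
    ultimately show "middle_weight t (card (B - {x} - C)) = (middle_weight t (?s - 1) :: 'k)"
      by simp
  qed simp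
  also have "(\<Sum>x\<in>B \<inter> C. middle_weight t (card (B - {x} - C))) = (\<Sum>x\<in>B \<inter> C. middle_weight t ?s :: 'k)"
  proof (rule sum.cong)
    fix x assume "x \<in> B \<inter> C"
    then have "B - {x} - C = B - C" by auto
    then show "middle_weight t (card (B - {x} - C)) = (middle_weight t ?s :: 'k)" by simp
  qed simp
  finally show ?thesis
    using middle_weight_recurrence[OF le, where 'k = 'k] assms(1) by (simp add: c del: of_nat_Suc)
qed

lemma symplectic_form_hits_monomial:
  assumes "S \<subseteq> {1..2 * n}" "card S = n + 1"
  shows "\<exists>c\<in>carrier (exterior_algebra (2 * n)).
    ext_mult (symplectic_form n) c = (ext_monomial S :: nat set \<Rightarrow> 'k::field_char_0)"
proof -
  \<comment> \<open>\<open>X\<close> collects the elements of \<open>S\<close> whose partner is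
    missing from \<open>S\<close>. Multiplication by the form leaves \<open>X\<close> alone and acts
    only on the blocks in \<open>P\<close>, so the problem moves to subsets of \<open>P\<close>,
    with \<open>A\<close> standing for the monomial of \<open>U A\<close>.\<close>
  define B where "B = {i \<in> {1..n}. pair_block i \<subseteq> S}"
  define X where "X = S - (\<Union>i\<in>B. pair_block i)"
  define P where "P = {i \<in> {1..n}. pair_block i \<inter> X = {}}"
  define U where "U A = X \<union> (\<Union>i\<in>A. pair_block i)" for A
  have finS: "finite S" using assms finite_subset by blast
  have finP: "finite P" "finite B" unfolding P_def B_def by auto
  have BP: "B \<subseteq> P" unfolding B_def P_def X_def by auto
  have SU: "S = U B" unfolding U_def X_def B_def by auto
  have mem: "i = (x + 1) div 2 \<longleftrightarrow> x \<in> pair_block i" if "i \<in> {1..n}" for i x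
    using mem_pair_block[of i x] that by simp
  have range: "(x + 1) div 2 \<in> {1..n}" if "x \<in> S" for x
    using that assms(1) by (auto dest!: subsetD)
  \<comment> \<open>A block that meets \<open>X\<close> does so in one element only, since blocks
    contained in \<open>S\<close> were removed. So \<open>X\<close> is in bijection with the blocks
    it meets.\<close>
  have cardX: "card X = card ({1..n} - P)"
  proof (rule bij_betw_same_card, rule bij_betw_imageI)
    show "inj_on (\<lambda>x. (x + 1) div 2) X"
    proof (rule inj_onI)
      fix x y assume xy: "x \<in> X" "y \<in> X" "(x + 1) div 2 = (y + 1) div 2"
      define i where "i = (x + 1) div 2"
      have i: "i \<in> {1..n}" using range xy(1) unfolding i_def X_def by blast
      have xi: "x \<in> pair_block i" "y \<in> pair_block i"
        using mem[OF i] xy(3) unfolding i_def by auto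
      show "x = y"
      proof (rule ccontr)
        assume "x \<noteq> y"
        then have "pair_block i = {x, y}" using xi unfolding pair_block_def by auto
        then have "i \<in> B" using xy i unfolding B_def X_def by auto
        then show False using xy(1) xi(1) unfolding X_def by auto
      qed
    qed
    show "(\<lambda>x. (x + 1) div 2) ` X = {1..n} - P"
    proof (intro subset_antisym subsetI)
      fix i assume "i \<in> (\<lambda>x. (x + 1) div 2) ` X"
      then obtain x where x: "x \<in> X" "i = (x + 1) div 2" by auto
      then have i: "i \<in> {1..n}" using range unfolding X_def by blast
      then show "i \<in> {1..n} - P" using x mem[OF i] unfolding P_def by auto
    next
      fix i assume "i \<in> {1..n} - P"
      then obtain x where "i \<in> {1..n}" "x \<in> X" "x \<in> pair_block i" unfolding P_def by auto
      then show "i \<in> (\<lambda>x. (x + 1) div 2) ` X" using mem by blast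
    qed
  qed
  have cardU: "card (U A) = card X + 2 * card A" if "A \<subseteq> P" for A
  proof -
    have fA: "finite A" using that finP finite_subset by blast
    have "card (\<Union>i\<in>A. pair_block i) = (\<Sum>i\<in>A. card (pair_block i))"
    proof (rule card_UN_disjoint)
      show "\<forall>i\<in>A. \<forall>j\<in>A. i \<noteq> j \<longrightarrow> pair_block i \<inter> pair_block j = {}"
        using that pair_block_disjoint unfolding P_def by (metis (no_types, lifting) atLeastAtMost_iff mem_Collect_eq subsetD)
    qed (use fA in auto)
    also have "\<dots> = (\<Sum>i\<in>A. 2)"
      by (rule sum.cong) (use that in \<open>auto simp: P_def card_pair_block\<close>)
    finally have "card (\<Union>i\<in>A. pair_block i) = 2 * card A" by simp
    moreover have "card (U A) = card X + card (\<Union>i\<in>A. pair_block i)"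
      unfolding U_def by (rule card_Un_disjoint) (use fA finS that in \<open>auto simp: X_def P_def\<close>)
    ultimately show ?thesis by simp
  qed
  have cX: "card X + card P = n"
  proof -
    have P: "P \<subseteq> {1..n}" unfolding P_def by auto
    then show ?thesis
      using cardX card_Diff_subset[OF finP(1) P] card_mono[OF _ P] by simp
  qed
  have cS: "card X + 2 * card B = n + 1"
    using cardU[OF BP] assms(2) SU by simp
  \<comment> \<open>If \<open>B\<close> were empty, \<open>X\<close> would have n + 1 elements,
    against \<open>cX\<close>. Comparing \<open>cX\<close> with \<open>cS\<close> then gives
    \<open>card P = 2 * card B - 1\<close>, which puts \<open>B\<close> just above the middle of the
    lattice.\<close>
  obtain t where t: "card B = t + 1"
    using cX cS by (cases "card B") auto
  have cP: "card P = 2 * t + 1" using cX cS t by simp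
  have Usub: "U A \<subseteq> {1..2 * n}" if "A \<subseteq> P" for A
  proof -
    have "pair_block i \<subseteq> {1..2 * n}" if "i \<in> A" for i
      by (rule pair_block_subset) (use that \<open>A \<subseteq> P\<close> in \<open>auto simp: P_def\<close>)
    then show ?thesis using assms(1) unfolding U_def X_def by blast
  qed
  have mult_U: "ext_mult (symplectic_form n) (ext_monomial (U A)) =
       (\<Sum>i\<in>P - A. ext_monomial (U (insert i A)) :: nat set \<Rightarrow> 'k)" if "A \<subseteq> P" for A
  proof -
    have "{i. i \<in> {1..n} \<and> pair_block i \<inter> U A = {}} = P - A"
    proof (intro subset_antisym subsetI)
      fix i assume "i \<in> {i. i \<in> {1..n} \<and> pair_block i \<inter> U A = {}}"
      moreover have "pair_block i \<noteq> {}" by (simp add: pair_block_def)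
      ultimately show "i \<in> P - A" unfolding P_def U_def by blast
    next
      fix i assume i: "i \<in> P - A"
      then have "pair_block i \<inter> pair_block j = {}" if "j \<in> A" for j
        using pair_block_disjoint[of i j] that \<open>A \<subseteq> P\<close> unfolding P_def by auto
      then show "i \<in> {i. i \<in> {1..n} \<and> pair_block i \<inter> U A = {}}"
        using i unfolding P_def U_def by blast
    qed
    moreover have "U A \<union> pair_block i = U (insert i A)" for i unfolding U_def by auto
    moreover have "finite (U A)" using Usub[OF that] finite_subset by blast
    ultimately show ?thesis using symplectic_form_monomial[of "U A" n] by simp
  qed
  \<comment> \<open>The coefficients of \<open>c\<close> below form the column of the inverse
    inclusion matrix that belongs to \<open>B\<close>.\<close>
  let ?w = "\<lambda>A. middle_weight t (card (A - B)) :: 'k"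
  define \<A> where "\<A> = {A. A \<subseteq> P \<and> card A = t}"
  define \<B> where "\<B> = {A. A \<subseteq> P \<and> card A = t + 1}"
  have fin: "finite \<A>" "finite \<B>" unfolding \<A>_def \<B>_def using finP by auto
  define c where "c = (\<Sum>A\<in>\<A>. ext_scale (?w A) (ext_monomial (U A)))"
  have "ext_mult (symplectic_form n) c =
      (\<Sum>A\<in>\<A>. \<Sum>i\<in>P - A. ext_scale (?w A) (ext_monomial (U (insert i A))))"
    unfolding c_def ext_mult_sum ext_mult_scale
    by (rule sum.cong) (auto simp: \<A>_def mult_U ext_scale_def sum_fun_apply sum_distrib_left fun_eq_iff)
  also have "\<dots> = (\<Sum>(A, i)\<in>(SIGMA A:\<A>. P - A). ext_scale (?w A) (ext_monomial (U (insert i A))))"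
    by (rule sum.Sigma) (use fin finP in auto)
  \<comment> \<open>Regrouping by the enlarged set \<open>D = insert i A\<close> collects the
    coefficient of each monomial \<open>U D\<close>.\<close>
  also have "\<dots> = (\<Sum>(D, x)\<in>(SIGMA D:\<B>. D). ext_scale (?w (D - {x})) (ext_monomial (U D)))"
  proof (rule sum.reindex_bij_witness[of _ "\<lambda>(D, x). (D - {x}, x)" "\<lambda>(A, i). (insert i A, i)"])
    fix p assume "p \<in> (SIGMA A:\<A>. P - A)"
    then obtain A i where p: "p = (A, i)" "A \<subseteq> P" "card A = t" "i \<in> P" "i \<notin> A"
      unfolding \<A>_def by auto
    have fA: "finite A" using p(2) finP finite_subset by blast
    show "(case case p of (A, i) \<Rightarrow> (insert i A, i) of (D, x) \<Rightarrow> (D - {x}, x)) = p"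
      "(case p of (A, i) \<Rightarrow> (insert i A, i)) \<in> (SIGMA D:\<B>. D)"
      "(case case p of (A, i) \<Rightarrow> (insert i A, i) of (D, x) \<Rightarrow> ext_scale (?w (D - {x})) (ext_monomial (U D)))
        = (case p of (A, i) \<Rightarrow> ext_scale (?w A) (ext_monomial (U (insert i A))))"
      using p fA by (auto simp: \<B>_def)
  next
    fix p assume "p \<in> (SIGMA D:\<B>. D)"
    then obtain D x where p: "p = (D, x)" "D \<subseteq> P" "card D = t + 1" "x \<in> D"
      unfolding \<B>_def by auto
    have fA: "finite D" using p(2) finP finite_subset by blast
    show "(case case p of (D, x) \<Rightarrow> (D - {x}, x) of (A, i) \<Rightarrow> (insert i A, i)) = p"
      "(case p of (D, x) \<Rightarrow> (D - {x}, x)) \<in> (SIGMA A:\<A>. P - A)"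
      using p fA by (auto simp: \<A>_def)
  qed
  also have "\<dots> = (\<Sum>D\<in>\<B>. \<Sum>x\<in>D. ext_scale (?w (D - {x})) (ext_monomial (U D)))"
    by (rule sum.Sigma[symmetric]) (use fin finP finite_subset in \<open>auto simp: \<B>_def\<close>)
  also have "\<dots> = (\<Sum>D\<in>\<B>. ext_scale (\<Sum>x\<in>D. ?w (D - {x})) (ext_monomial (U D)))"
    by (simp add: ext_scale_def fun_eq_iff sum_fun_apply sum_distrib_right)
  also have "\<dots> = (\<Sum>D\<in>\<B>. if D = B then ext_monomial (U B) else 0)"
  proof (rule sum.cong)
    fix D assume D: "D \<in> \<B>"
    then have fD: "finite D" "card D = t + 1" using finP finite_subset unfolding \<B>_def by auto
    \<comment> \<open>Two sets of size t + 1 inside a set of size 2t + 1 cannot be disjoint.\<close>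
    have meet: "D \<inter> B \<noteq> {}"
    proof
      assume "D \<inter> B = {}"
      then have "card (D \<union> B) = 2 * t + 2" using card_Un_disjoint[OF fD(1) finP(2)] fD t by simp
      moreover have "card (D \<union> B) \<le> card P" using D BP finP unfolding \<B>_def by (intro card_mono) auto
      ultimately show False using cP by simp
    qed
    have "D \<subseteq> B \<longleftrightarrow> D = B"
      using card_subset_eq[OF finP(2), of D] t fD(2) by auto
    then show "ext_scale (\<Sum>x\<in>D. ?w (D - {x})) (ext_monomial (U D)) = (if D = B then ext_monomial (U B) else 0)"
      using middle_weight_sum[OF fD meet, where 'k = 'k] by (auto simp: ext_scale_def fun_eq_iff)
  qed simp
  also have "\<dots> = ext_monomial (U B)"
    using fin BP t by (simp add: \<B>_def)
  finally have "ext_mult (symplectic_form n) c = ext_monomial S" using SU by simp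
  moreover have "c \<in> carrier (exterior_algebra (2 * n))"
    unfolding c_def by (intro ext_sum_closed ext_carrier_intros Usub) (simp add: \<A>_def)
  ultimately show ?thesis by blast
qed

text \<open>Centrality makes the right multiples of the form a two-sided ideal. Membership in the
  ideal thus means a single cofactor.\<close>

lemma symplectic_form_ideal:
  "Idl\<^bsub>exterior_algebra (2 * n)\<^esub> {symplectic_form n} =
     ext_mult (symplectic_form n) ` carrier (exterior_algebra (2 * n) :: (nat set \<Rightarrow> 'k::field) graded_ring)"
    (is "Idl\<^bsub>?E\<^esub> {?f} = ?I")
proof
  have "ideal ?I ?E"
  proof (rule ext_idealI)
    show "0 \<in> ?I" by (rule image_eqI[of _ _ 0]) auto
    fix a b assume "a \<in> ?I" "b \<in> ?I"
    then show "a + b \<in> ?I" by (auto simp: ext_mult_distrib(2)[symmetric] image_iff)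
  next
    fix a r assume a: "a \<in> ?I" and r: "r \<in> carrier ?E"
    then obtain c where c: "c \<in> carrier ?E" "a = ext_mult ?f c" by auto
    have "ext_mult r a = ext_mult ?f (ext_mult r c)"
      unfolding c(2) by (simp only: ext_mult_assoc[symmetric] symplectic_form_commute)
    then show "ext_mult r a \<in> ?I" using c r by auto
    have "ext_mult a r = ext_mult ?f (ext_mult c r)"
      unfolding c(2) by (simp only: ext_mult_assoc)
    then show "ext_mult a r \<in> ?I" using c r by auto
  qed auto
  moreover have "?f \<in> ?I"
    by (rule image_eqI[of _ _ "ext_monomial {}"]) (auto simp: ext_mult_one[OF symplectic_form_carrier])
  ultimately show "Idl\<^bsub>?E\<^esub> {?f} \<subseteq> ?I"
    using ring.genideal_minimal[OF ring_exterior_algebra] by blast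
  have "ideal (Idl\<^bsub>?E\<^esub> {?f}) ?E" "?f \<in> Idl\<^bsub>?E\<^esub> {?f}"
    using ring.genideal_ideal[OF ring_exterior_algebra, of "{?f}"]
      ring.genideal_self'[OF ring_exterior_algebra] by auto
  then show "?I \<subseteq> Idl\<^bsub>?E\<^esub> {?f}"
    using ideal.I_r_closed[of "Idl\<^bsub>?E\<^esub> {?f}" ?E ?f] by auto
qed

text \<open>A monomial of degree above \<open>n\<close> has a factor of degree \<open>n + 1\<close>,
  which is already a multiple of the form; general elements are sums of scaled monomials.\<close>

lemma symplectic_form_ideal_high_degree:
  assumes "a \<in> ring_part (exterior_algebra (2 * n)) j" "j > int n"
  shows "(a :: nat set \<Rightarrow> 'k::field_char_0) \<in> ext_mult (symplectic_form n) ` carrier (exterior_algebra (2 * n))"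
proof -
  let ?I = "ext_mult (symplectic_form n) ` carrier (exterior_algebra (2 * n) :: (nat set \<Rightarrow> 'k) graded_ring)"
  have sum: "(\<Sum>x\<in>A. g x) \<in> ?I" if "\<And>x. x \<in> A \<Longrightarrow> g x \<in> ?I" for A and g :: "nat set \<Rightarrow> nat set \<Rightarrow> 'k"
    using that
  proof (induction A rule: infinite_finite_induct)
    case (insert x A)
    have "g x \<in> ?I" "sum g A \<in> ?I" using insert by auto
    then obtain b c where "b \<in> carrier (exterior_algebra (2 * n))" "c \<in> carrier (exterior_algebra (2 * n))"
      "g x = ext_mult (symplectic_form n) b" "sum g A = ext_mult (symplectic_form n) c"
      by fast
    then have "b + c \<in> carrier (exterior_algebra (2 * n))" "sum g (insert x A) = ext_mult (symplectic_form n) (b + c)"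
      using insert(1,2) by (simp_all add: ext_mult_distrib(2))
    then show ?case by blast
  qed (auto intro: image_eqI[of _ _ 0])
  have mono: "ext_scale x (ext_monomial S) \<in> ?I" if S: "S \<subseteq> {1..2 * n}" "card S \<ge> n + 1" for S and x :: 'k
  proof -
    obtain S1 where S1: "S1 \<subseteq> S" "card S1 = n + 1"
      using obtain_subset_with_card_n[OF S(2)] by blast
    obtain c where c: "c \<in> carrier (exterior_algebra (2 * n))"
      "ext_mult (symplectic_form n) c = (ext_monomial S1 :: nat set \<Rightarrow> 'k)"
      using symplectic_form_hits_monomial[of S1 n] S1 S by blast
    have "finite S" using S(1) finite_subset by blast
    then have fin: "finite S1" "finite (S - S1)" using S1(1) finite_subset by auto
    have "S1 \<inter> (S - S1) = {}" "S1 \<union> (S - S1) = S" using S1 by auto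
    then have m: "ext_mult (ext_monomial S1) (ext_monomial (S - S1)) =
        ext_scale (shuffle_sign S1 (S - S1)) (ext_monomial S :: nat set \<Rightarrow> 'k)"
      using ext_mult_monomials[OF fin] by (simp add: ext_scale_def)
    \<comment> \<open>The factor \<open>shuffle_sign S1 (S - S1)\<close> cancels the sign produced
      by splitting off \<open>S1\<close>, since signs square to one.\<close>
    have "ext_mult (symplectic_form n)
        (ext_scale (x * shuffle_sign S1 (S - S1)) (ext_mult c (ext_monomial (S - S1)))) = ext_scale x (ext_monomial S)"
      unfolding ext_mult_scale ext_mult_assoc[symmetric] c(2) m by (simp add: ext_scale_def mult.assoc)
    moreover have "ext_scale (x * shuffle_sign S1 (S - S1)) (ext_mult c (ext_monomial (S - S1)))
        \<in> carrier (exterior_algebra (2 * n))"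
      using c S by (intro ext_carrier_intros ext_mult_closed) auto
    ultimately show ?thesis by (metis imageI)
  qed
  have "ext_scale (a S) (ext_monomial S) \<in> ?I" if "S \<in> Pow {1..2 * n}" for S
  proof (cases "a S = 0")
    case True
    then show ?thesis by (intro image_eqI[of _ _ 0]) (auto simp: ext_scale_def)
  next
    case False
    then show ?thesis using assms that by (intro mono) (auto simp: ext_part_iff)
  qed
  then have "(\<Sum>S\<in>Pow {1..2 * n}. ext_scale (a S) (ext_monomial S)) \<in> ?I"
    by (rule sum)
  then show ?thesis
    by (simp only: ext_expand[OF ext_part_carrier[OF assms(1)], symmetric])
qed

text \<open>
  Surjectivity onto degree \<open>n + 1\<close> gives injectivity on degree \<open>n - 1\<close> because the product into
  the top degree is a perfect pairing and the form is central.
\<close>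

lemma symplectic_form_annihilator:
  assumes a: "a \<in> ring_part (exterior_algebra (2 * n)) (int n - 1)"
    and fa: "ext_mult (symplectic_form n) a = (0 :: nat set \<Rightarrow> 'k::field_char_0)"
  shows "a = 0"
proof (rule ccontr)
  assume "a \<noteq> 0"
  then obtain S where S: "a S \<noteq> 0" by (auto simp: fun_eq_iff)
  \<comment> \<open>The complement has 2n - (n - 1) = n + 1 elements, so its monomial is a multiple
    of the form. Multiplying \<open>a\<close> by it shows, up to sign, the coefficient
    \<open>a S\<close> in the top degree.\<close>
  define T where "T = {1..2 * n} - S"
  have S': "S \<subseteq> {1..2 * n}" "int (card S) = int n - 1" using a S by (auto simp: ext_part_iff)
  then have "card T = n + 1" unfolding T_def by (subst card_Diff_subset) (auto intro: finite_subset)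
  then obtain c where c: "ext_mult (symplectic_form n) c = (ext_monomial T :: nat set \<Rightarrow> 'k)"
    using symplectic_form_hits_monomial[of T n] unfolding T_def by blast
  have "ext_mult a (ext_monomial T) = ext_mult (ext_mult (symplectic_form n) a) c"
    unfolding c[symmetric] by (simp only: ext_mult_assoc[symmetric] symplectic_form_commute)
  then have "ext_mult a (ext_monomial T) {1..2 * n} = 0" using fa by simp
  moreover have "T \<subseteq> {1..2 * n}" "{1..2 * n} - T = S" using S' unfolding T_def by auto
  ultimately show False using S by (simp add: ext_mult_monomial_right)
qed

section \<open>The ideals generated by the first generators\<close>

text \<open>The ideal (e_1,...,e_k) in coordinates: only monomials involving one of these generators
  occur. Supports are not confined to \<open>{1..m}\<close>, so membership in the carrier is stated
  separately.\<close>

definition initial_ideal :: "nat \<Rightarrow> (nat set \<Rightarrow> 'k::field) set"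
  where "initial_ideal k = {a. \<forall>S. S \<inter> {1..k} = {} \<longrightarrow> a S = 0}"

text \<open>Strips a right factor e_i from the monomials that contain it, with the sign for moving
  e_i to the right end, and drops the other monomials.\<close>

definition right_divide :: "nat \<Rightarrow> (nat set \<Rightarrow> 'k::field) \<Rightarrow> nat set \<Rightarrow> 'k"
  where "right_divide i a = (\<lambda>T. if i \<in> T then 0 else shuffle_sign T {i} * a (insert i T))"

lemma ext_mult_gen_right:
  "ext_mult a (ext_gen i) S = (if i \<in> S \<and> finite S then shuffle_sign (S - {i}) {i} * a (S - {i}) else 0)"
  by (simp add: ext_gen_def ext_mult_monomial_right)

lemma right_divide_mult:
  assumes "a \<in> carrier (exterior_algebra m)"
  shows "ext_mult (right_divide i a) (ext_gen i) S = (if i \<in> S then a S else 0)"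
  using ext_carrier_infinite[OF assms]
  by (auto simp: ext_mult_gen_right right_divide_def insert_absorb)

lemma right_divide_carrier [intro]:
  "a \<in> carrier (exterior_algebra m) \<Longrightarrow> right_divide i a \<in> carrier (exterior_algebra m)"
  by (auto simp: right_divide_def ext_carrier_iff)

lemma right_divide_part [intro]:
  assumes "a \<in> ring_part (exterior_algebra m) j"
  shows "right_divide i a \<in> ring_part (exterior_algebra m) (j - 1)"
  unfolding ext_part_iff
proof (intro allI impI)
  fix T assume "right_divide i a T \<noteq> 0"
  then have T: "i \<notin> T" "a (insert i T) \<noteq> 0" by (auto simp: right_divide_def split: if_splits)
  then have *: "insert i T \<subseteq> {1..m}" "int (card (insert i T)) = j"
    using assms[unfolded ext_part_iff, rule_format, OF T(2)] by simp_all
  have "finite T" by (rule finite_subset[of _ "{1..m}"]) (use * in auto)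
  then show "T \<subseteq> {1..m} \<and> int (card T) = j - 1" using T * by auto
qed

lemma initial_ideal_intros [intro]:
  "0 \<in> initial_ideal k"
  "a \<in> initial_ideal k \<Longrightarrow> b \<in> initial_ideal k \<Longrightarrow> a + b \<in> initial_ideal k"
  "a \<in> initial_ideal k \<Longrightarrow> b \<in> initial_ideal k \<Longrightarrow> a - b \<in> initial_ideal k"
  by (simp_all add: initial_ideal_def)

lemma initial_ideal_mult:
  assumes "a \<in> initial_ideal k"
  shows "ext_mult a b \<in> initial_ideal k" "ext_mult b a \<in> initial_ideal k"
proof -
  have "a T = 0" "a (S - T) = 0" if "S \<inter> {1..k} = {}" "T \<subseteq> S" for S T
    using assms that unfolding initial_ideal_def by blast+
  then show "ext_mult a b \<in> initial_ideal k" "ext_mult b a \<in> initial_ideal k"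
    unfolding initial_ideal_def ext_mult_def by (auto intro!: sum.neutral)
qed

lemma initial_ideal_0: "a \<in> initial_ideal 0 \<longleftrightarrow> a = 0"
  by (auto simp: initial_ideal_def fun_eq_iff)

lemma initial_ideal_Suc: "a \<in> initial_ideal k \<Longrightarrow> a \<in> initial_ideal (Suc k)"
  unfolding initial_ideal_def by (auto simp: atLeastAtMostSuc_conv)

lemma ext_gen_initial_ideal: "1 \<le> i \<Longrightarrow> i \<le> k \<Longrightarrow> ext_gen i \<in> initial_ideal k"
  by (auto simp: initial_ideal_def ext_gen_def ext_monomial_def)

text \<open>A monomial of \<open>a\<close> either involves one of the first \<open>k\<close>
  generators, or contains e_(k+1) and is killed by the additional factor.\<close>

lemma initial_ideal_Suc_times_gen:
  assumes "a \<in> initial_ideal (Suc k)"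
  shows "ext_mult a (ext_gen (Suc k)) \<in> initial_ideal k"
  unfolding initial_ideal_def
proof (intro CollectI allI impI)
  fix S assume S: "S \<inter> {1..k} = {}"
  then have "(S - {Suc k}) \<inter> {1..Suc k} = {}" by auto
  then show "ext_mult a (ext_gen (Suc k)) S = 0"
    using assms unfolding ext_mult_gen_right initial_ideal_def by auto
qed

text \<open>Converse of the preceding lemma. Together they say that the annihilator of e_(k+1)
  modulo (e_1,...,e_k) is generated by e_(k+1), which is the exactness behind the
  filtration.\<close>

lemma initial_ideal_times_gen_cancel:
  assumes "a \<in> carrier (exterior_algebra m)" "ext_mult a (ext_gen (Suc k)) \<in> initial_ideal k"
  shows "a \<in> initial_ideal (Suc k)"
  unfolding initial_ideal_def
proof (intro CollectI allI impI)
  fix S assume S: "S \<inter> {1..Suc k} = {}"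
  then have *: "insert (Suc k) S \<inter> {1..k} = {}" "Suc k \<notin> S" by auto
  then have "ext_mult a (ext_gen (Suc k)) (insert (Suc k) S) = 0"
    using assms(2) unfolding initial_ideal_def by blast
  then show "a S = 0"
    using * ext_carrier_infinite[OF assms(1)] by (auto simp: ext_mult_gen_right split: if_splits)
qed

text \<open>Division by the last generator. Repeating it reduces a claim about (e_1,...,e_k) to the
  zero ideal, the pattern of the inductions on \<open>k\<close> below.\<close>

lemma initial_ideal_remainder:
  assumes "a \<in> carrier (exterior_algebra m)" "a \<in> initial_ideal (Suc k)"
  shows "a - ext_mult (right_divide (Suc k) a) (ext_gen (Suc k)) \<in> initial_ideal k"
  unfolding initial_ideal_def
proof (intro CollectI allI impI)
  fix S assume S: "S \<inter> {1..k} = {}"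
  have "a S = 0" if "Suc k \<notin> S"
  proof -
    have "S \<inter> {1..Suc k} = {}" using S that by (auto simp: le_Suc_eq)
    then show ?thesis using assms(2) unfolding initial_ideal_def by blast
  qed
  then show "(a - ext_mult (right_divide (Suc k) a) (ext_gen (Suc k))) S = 0"
    by (simp add: right_divide_mult[OF assms(1)])
qed

lemma initial_ideal_top:
  assumes "a \<in> carrier (exterior_algebra m)"
  shows "a \<in> initial_ideal m \<longleftrightarrow> a {} = 0"
proof
  assume "a {} = 0"
  have "a S = 0" if "S \<inter> {1..m} = {}" for S
  proof (rule ccontr)
    assume "a S \<noteq> 0"
    then have "S \<subseteq> {1..m}" using assms by (simp add: ext_carrier_iff)
    then have "S = {}" using that by auto
    then show False using \<open>a S \<noteq> 0\<close> \<open>a {} = 0\<close> by simp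
  qed
  then show "a \<in> initial_ideal m" by (simp add: initial_ideal_def)
qed (simp add: initial_ideal_def)

lemma ideal_gens_eq:
  "Idl\<^bsub>exterior_algebra m\<^esub> (ext_gen ` {1..m}) =
     {a \<in> carrier (exterior_algebra m :: (nat set \<Rightarrow> 'k::field) graded_ring). a {} = 0}"
    (is "Idl\<^bsub>?E\<^esub> ?G = ?I")
proof
  have I: "?I = carrier ?E \<inter> initial_ideal m" using initial_ideal_top by auto
  have "ideal ?I ?E"
    unfolding I by (rule ext_idealI) (auto intro: initial_ideal_mult)
  moreover have "?G \<subseteq> ?I"
    unfolding I by (auto intro: ext_gen_initial_ideal)
  ultimately show "Idl\<^bsub>?E\<^esub> ?G \<subseteq> ?I"
    using ring.genideal_minimal[OF ring_exterior_algebra] by blast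
  have sub: "?G \<subseteq> carrier ?E" by auto
  then have J: "ideal (Idl\<^bsub>?E\<^esub> ?G) ?E" "?G \<subseteq> Idl\<^bsub>?E\<^esub> ?G"
    using ring.genideal_ideal[OF ring_exterior_algebra sub] ring.genideal_self[OF ring_exterior_algebra sub] by auto
  have "a \<in> Idl\<^bsub>?E\<^esub> ?G" if "a \<in> carrier ?E" "a \<in> initial_ideal k" "k \<le> m" for a k
    using that
  proof (induction k arbitrary: a)
    case 0
    then show ?case
      using additive_subgroup.zero_closed[OF ideal.axioms(1)[OF J(1)]]
      unfolding initial_ideal_0 ext_ring_simps by metis
  next
    case (Suc k)
    let ?q = "right_divide (Suc k) a"
    have q: "?q \<in> carrier ?E" "ext_gen (Suc k) \<in> carrier ?E" using Suc.prems by auto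
    have 1: "a - ext_mult ?q (ext_gen (Suc k)) \<in> Idl\<^bsub>?E\<^esub> ?G"
      by (rule Suc.IH[OF ext_carrier_intros(3)[OF Suc.prems(1) ext_mult_closed[OF q]]
            initial_ideal_remainder[OF Suc.prems(1,2)]]) (use Suc.prems in simp)
    have "ext_gen (Suc k) \<in> Idl\<^bsub>?E\<^esub> ?G" using J(2) Suc.prems by auto
    then have 2: "ext_mult ?q (ext_gen (Suc k)) \<in> Idl\<^bsub>?E\<^esub> ?G"
      using ideal.I_l_closed[OF J(1) _ q(1)] by simp
    show ?case
      using additive_subgroup.a_closed[OF ideal.axioms(1)[OF J(1)] 1 2] by simp
  qed
  then show "?I \<subseteq> Idl\<^bsub>?E\<^esub> ?G" using I by auto
qed

section \<open>Graded free modules and their homomorphisms\<close>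

abbreviation ext_free :: "nat \<Rightarrow> int list \<Rightarrow> (nat set \<Rightarrow> 'k::field, nat \<Rightarrow> nat set \<Rightarrow> 'k) graded_module"
  where "ext_free m ds \<equiv> graded_free (exterior_algebra m) ds"

definition vec_mult :: "(nat \<Rightarrow> nat set \<Rightarrow> 'k::field) \<Rightarrow> (nat set \<Rightarrow> 'k) \<Rightarrow> nat \<Rightarrow> nat set \<Rightarrow> 'k"
  where "vec_mult v r = (\<lambda>k. ext_mult (v k) r)"

definition vec_single :: "nat \<Rightarrow> (nat set \<Rightarrow> 'k::field) \<Rightarrow> nat \<Rightarrow> nat set \<Rightarrow> 'k"
  where "vec_single k a = (\<lambda>t. if t = k then a else 0)"

definition vec_part :: "int list \<Rightarrow> int \<Rightarrow> (nat \<Rightarrow> nat set \<Rightarrow> 'k::field) \<Rightarrow> nat \<Rightarrow> nat set \<Rightarrow> 'k"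
  where "vec_part ds j v = (\<lambda>k S. if k < length ds \<and> int (card S) = j - ds ! k then v k S else 0)"

text \<open>For a free module \<open>F\<close> this describes F(e_1,...,e_k). At
  \<open>k = m\<close> it is the kernel of the passage from F to F \<otimes> K.\<close>

definition vec_initial :: "nat \<Rightarrow> (nat \<Rightarrow> nat set \<Rightarrow> 'k::field) set"
  where "vec_initial k = {v. \<forall>t. v t \<in> initial_ideal k}"

lemma ext_free_simps [simp]:
  "v \<oplus>\<^bsub>ext_free m ds\<^esub> w = v + w"
  "\<zero>\<^bsub>ext_free m ds\<^esub> = 0"
  "smult (ext_free m ds) r v = vec_mult v r"
  by (simp_all add: graded_free_def vec_mult_def plus_fun_def zero_fun_def)

lemma ext_free_carrier_iff:
  "v \<in> carrier (ext_free m ds) \<longleftrightarrow> (\<forall>k. v k \<in> carrier (exterior_algebra m)) \<and> (\<forall>k\<ge>length ds. v k = 0)"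
  by (auto simp: graded_free_def) (metis ext_carrier_intros(1) not_less)

lemma ext_free_part_iff:
  "v \<in> module_part (ext_free m ds) j \<longleftrightarrow>
     (\<forall>k<length ds. v k \<in> ring_part (exterior_algebra m) (j - ds ! k)) \<and> (\<forall>k\<ge>length ds. v k = 0)"
  by (auto simp: graded_free_def)

lemma ext_free_part_carrier: "v \<in> module_part (ext_free m ds) j \<Longrightarrow> v \<in> carrier (ext_free m ds)"
  by (auto simp: ext_free_part_iff ext_free_carrier_iff)
     (metis ext_carrier_intros(1) ext_part_carrier not_less)

lemma ext_free_closed [intro]:
  "0 \<in> carrier (ext_free m ds)"
  "v \<in> carrier (ext_free m ds) \<Longrightarrow> w \<in> carrier (ext_free m ds) \<Longrightarrow> v + w \<in> carrier (ext_free m ds)"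
  "v \<in> carrier (ext_free m ds) \<Longrightarrow> w \<in> carrier (ext_free m ds) \<Longrightarrow> v - w \<in> carrier (ext_free m ds)"
  "v \<in> carrier (ext_free m ds) \<Longrightarrow> - v \<in> carrier (ext_free m ds)"
  "v \<in> carrier (ext_free m ds) \<Longrightarrow> r \<in> carrier (exterior_algebra m) \<Longrightarrow> vec_mult v r \<in> carrier (ext_free m ds)"
  "k < length ds \<Longrightarrow> r \<in> carrier (exterior_algebra m) \<Longrightarrow> vec_single k r \<in> carrier (ext_free m ds)"
  by (auto simp: ext_free_carrier_iff vec_mult_def vec_single_def)

lemma ext_free_part_closed [intro]:
  "0 \<in> module_part (ext_free m ds) j"
  "v \<in> module_part (ext_free m ds) j \<Longrightarrow> w \<in> module_part (ext_free m ds) j \<Longrightarrow> v + w \<in> module_part (ext_free m ds) j"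
  "v \<in> module_part (ext_free m ds) j \<Longrightarrow> - v \<in> module_part (ext_free m ds) j"
  by (auto simp: ext_free_part_iff)

lemma ext_free_part_diff [intro]:
  "v \<in> module_part (ext_free m ds) j \<Longrightarrow> w \<in> module_part (ext_free m ds) j \<Longrightarrow> v - w \<in> module_part (ext_free m ds) j"
  using ext_free_part_closed(2)[OF _ ext_free_part_closed(3), of v m ds j w] by simp

lemma ext_free_part_mult [intro]:
  assumes "v \<in> module_part (ext_free m ds) p" "r \<in> ring_part (exterior_algebra m) q"
  shows "vec_mult v r \<in> module_part (ext_free m ds) (p + q)"
proof -
  have "p + q - ds ! k = (p - ds ! k) + q" for k by simp
  then show ?thesis using assms
    unfolding ext_free_part_iff vec_mult_def by (metis ext_mult_zero(1) ext_part_mult)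
qed

lemma ext_gen_part: "1 \<le> i \<Longrightarrow> i \<le> m \<Longrightarrow> ext_gen i \<in> ring_part (exterior_algebra m) 1"
  unfolding ext_gen_def by (rule ext_part_monomial) auto

lemma vec_mult_distrib:
  "vec_mult (v + w) r = vec_mult v r + vec_mult w r"
  "vec_mult (v - w) r = vec_mult v r - vec_mult w r"
  "vec_mult v (r + s) = vec_mult v r + vec_mult v s"
  "vec_mult 0 r = 0" "vec_mult v 0 = 0"
  by (simp_all add: vec_mult_def fun_eq_iff ext_mult_distrib ext_mult_diff)

lemma vec_mult_assoc: "vec_mult (vec_mult v r) s = vec_mult v (ext_mult r s)"
  by (simp add: vec_mult_def ext_mult_assoc)

lemma vec_mult_one: "v \<in> carrier (ext_free m ds) \<Longrightarrow> vec_mult v (ext_monomial {}) = v"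
  unfolding vec_mult_def ext_free_carrier_iff by (rule ext) (metis ext_mult_one(1))

lemma vec_part_in [intro]:
  "v \<in> carrier (ext_free m ds) \<Longrightarrow> vec_part ds j v \<in> module_part (ext_free m ds) j"
  by (auto simp: ext_free_carrier_iff ext_free_part_iff ext_part_iff ext_carrier_iff vec_part_def fun_eq_iff)

lemma vec_part_add: "vec_part ds j (v + w) = vec_part ds j v + vec_part ds j w"
  by (simp add: vec_part_def fun_eq_iff)

lemma vec_part_homogeneous:
  assumes "v \<in> module_part (ext_free m ds) i"
  shows "vec_part ds j v = (if i = j then v else 0)"
proof (intro ext)
  fix k S
  show "vec_part ds j v k S = (if i = j then v else 0) k S"
  proof (cases "k < length ds")
    case True
    then have "v k S = 0 \<or> int (card S) = i - ds ! k" using assms by (auto simp: ext_free_part_iff ext_part_iff)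
    then show ?thesis using True by (auto simp: vec_part_def)
  next
    case False
    then show ?thesis using assms by (auto simp: vec_part_def ext_free_part_iff)
  qed
qed

lemma vec_initial_intros [intro]:
  "0 \<in> vec_initial k"
  "v \<in> vec_initial k \<Longrightarrow> w \<in> vec_initial k \<Longrightarrow> v + w \<in> vec_initial k"
  "v \<in> vec_initial k \<Longrightarrow> w \<in> vec_initial k \<Longrightarrow> v - w \<in> vec_initial k"
  "v \<in> vec_initial k \<Longrightarrow> vec_mult v r \<in> vec_initial k"
  "r \<in> initial_ideal k \<Longrightarrow> vec_mult v r \<in> vec_initial k"
  "v \<in> vec_initial k \<Longrightarrow> v \<in> vec_initial (Suc k)"
  by (auto simp: vec_initial_def vec_mult_def initial_ideal_mult initial_ideal_Suc)

lemma vec_initial_0: "v \<in> vec_initial 0 \<longleftrightarrow> v = 0"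
  by (auto simp: vec_initial_def initial_ideal_0 fun_eq_iff)

lemma vec_initial_top:
  "v \<in> carrier (ext_free m ds) \<Longrightarrow> v \<in> vec_initial m \<longleftrightarrow> (\<forall>t. v t {} = 0)"
  by (simp add: vec_initial_def ext_free_carrier_iff initial_ideal_top)

text \<open>Division in each coordinate. The same quotient serves with and without grading, since
  \<open>right_divide\<close> lowers the degree of a homogeneous element by one.\<close>

lemma vec_initial_split:
  assumes "v \<in> carrier (ext_free m ds)" "v \<in> vec_initial (Suc k)"
  obtains w where "w \<in> carrier (ext_free m ds)" "v - vec_mult w (ext_gen (Suc k)) \<in> vec_initial k"
    "\<And>j. v \<in> module_part (ext_free m ds) j \<Longrightarrow> w \<in> module_part (ext_free m ds) (j - 1)"
proof
  let ?w = "\<lambda>t. right_divide (Suc k) (v t)"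
  have zero: "right_divide (Suc k) 0 = 0" by (auto simp: right_divide_def)
  show "?w \<in> carrier (ext_free m ds)"
    using assms by (auto simp: ext_free_carrier_iff zero)
  show "v - vec_mult ?w (ext_gen (Suc k)) \<in> vec_initial k"
    using assms by (auto simp: vec_initial_def vec_mult_def ext_free_carrier_iff intro!: initial_ideal_remainder)
  fix j assume "v \<in> module_part (ext_free m ds) j"
  moreover have "j - 1 - ds ! t = j - ds ! t - 1" for t by simp
  ultimately show "?w \<in> module_part (ext_free m ds) (j - 1)"
    unfolding ext_free_part_iff by (metis right_divide_part zero)
qed

lemma vec_initial_Suc_times_gen:
  "v \<in> vec_initial (Suc k) \<Longrightarrow> vec_mult v (ext_gen (Suc k)) \<in> vec_initial k"
  by (simp add: vec_initial_def vec_mult_def initial_ideal_Suc_times_gen)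

lemma vec_initial_times_gen_cancel:
  "v \<in> carrier (ext_free m ds) \<Longrightarrow> vec_mult v (ext_gen (Suc k)) \<in> vec_initial k \<Longrightarrow> v \<in> vec_initial (Suc k)"
  by (auto simp: vec_initial_def vec_mult_def ext_free_carrier_iff intro: initial_ideal_times_gen_cancel)

lemma ext_free_sum_induct:
  assumes "\<And>x. x \<in> A \<Longrightarrow> P (g x)" "P 0"
    and "\<And>v w. P v \<Longrightarrow> P w \<Longrightarrow> P (v + w)"
  shows "P (\<Sum>x\<in>A. g x)"
  using assms(1) by (induction A rule: infinite_finite_induct) (auto intro: assms(2,3))

text \<open>Replaces linear extension from a basis: an identity of additive maps has to be checked
  only on multiples of basis vectors.\<close>

lemma ext_free_induct_basis [consumes 1, case_names basis zero add]:
  assumes v: "v \<in> carrier (ext_free m ds)"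
    and basis: "\<And>k a. k < length ds \<Longrightarrow> a \<in> carrier (exterior_algebra m) \<Longrightarrow> P (vec_mult (vec_single k (ext_monomial {})) a)"
    and zero: "P 0"
    and add: "\<And>v w. v \<in> carrier (ext_free m ds) \<Longrightarrow> w \<in> carrier (ext_free m ds) \<Longrightarrow> P v \<Longrightarrow> P w \<Longrightarrow> P (v + w)"
  shows "P v"
proof -
  let ?g = "\<lambda>k. vec_mult (vec_single k (ext_monomial {})) (v k)"
  have eq: "?g k = vec_single k (v k)" for k
  proof
    fix t show "?g k t = vec_single k (v k) t"
      using v ext_mult_one(2)[of "v k" m] by (simp add: vec_mult_def vec_single_def ext_free_carrier_iff)
  qed
  have "v = (\<Sum>k<length ds. ?g k)"
  proof
    fix t
    have "(\<Sum>k<length ds. ?g k) t = (\<Sum>k<length ds. if t = k then v k else 0)"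
      unfolding eq by (simp add: sum_fun_apply vec_single_def)
    also have "\<dots> = v t"
      using v by (auto simp: ext_free_carrier_iff)
    finally show "v t = (\<Sum>k<length ds. ?g k) t" by (rule sym)
  qed
  moreover have "(\<Sum>k<length ds. ?g k) \<in> carrier (ext_free m ds) \<and> P (\<Sum>k<length ds. ?g k)"
  proof (rule ext_free_sum_induct[where P = "\<lambda>v. v \<in> carrier (ext_free m ds) \<and> P v"])
    fix k assume "k \<in> {..<length ds}"
    then show "?g k \<in> carrier (ext_free m ds) \<and> P (?g k)"
      using v basis by (auto simp: ext_free_carrier_iff[of v] intro!: ext_free_closed)
  qed (use zero add in auto)
  ultimately show ?thesis by simp
qed

text \<open>Basis vectors times scaled monomials are homogeneous and span the free module
  additively.\<close>

lemma ext_free_induct_homogeneous [consumes 1, case_names homogeneous add]: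
  assumes v: "v \<in> carrier (ext_free m ds)"
    and hom: "\<And>j v. v \<in> module_part (ext_free m ds) j \<Longrightarrow> P v"
    and add: "\<And>v w. v \<in> carrier (ext_free m ds) \<Longrightarrow> w \<in> carrier (ext_free m ds) \<Longrightarrow> P v \<Longrightarrow> P w \<Longrightarrow> P (v + w)"
  shows "P v"
  using v
proof (induction rule: ext_free_induct_basis)
  case (basis k a)
  let ?b = "\<lambda>S. vec_mult (vec_single k (ext_monomial {})) (ext_scale (a S) (ext_monomial S))"
  have "vec_mult (vec_single k (ext_monomial {})) a = (\<Sum>S\<in>Pow {1..m}. ?b S)"
    by (subst ext_expand[OF basis(2)])
       (auto simp: vec_mult_def fun_eq_iff sum_fun_apply ext_mult_sum)
  moreover have "(\<Sum>S\<in>Pow {1..m}. ?b S) \<in> carrier (ext_free m ds) \<and> P (\<Sum>S\<in>Pow {1..m}. ?b S)"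
  proof (rule ext_free_sum_induct[where P = "\<lambda>v. v \<in> carrier (ext_free m ds) \<and> P v"])
    fix S assume S: "S \<in> Pow {1..m}"
    have "vec_single k (ext_monomial {}) \<in> module_part (ext_free m ds) (ds ! k)"
      using basis(1) by (auto simp: ext_free_part_iff vec_single_def)
    then have "?b S \<in> module_part (ext_free m ds) (ds ! k + int (card S))"
      using S by (intro ext_free_part_mult ext_part_scale ext_part_monomial) auto
    then show "?b S \<in> carrier (ext_free m ds) \<and> P (?b S)"
      using hom ext_free_part_carrier by blast
  qed (use hom[of 0] add in auto)
  ultimately show ?case by simp
next
  case zero
  show "P 0" by (rule hom[OF ext_free_part_closed(1)])
next
  case (add v w)
  then show "P (v + w)" by (rule assms(3))
qed

section \<open>Degree-preserving linear maps between free modules\<close>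

locale ext_free_hom =
  fixes m :: nat and ds ds' :: "int list" and h :: "(nat \<Rightarrow> nat set \<Rightarrow> 'k::field) \<Rightarrow> nat \<Rightarrow> nat set \<Rightarrow> 'k"
  assumes graded_hom: "graded_hom (exterior_algebra m) (ext_free m ds) (ext_free m ds') h"
begin

lemma map_closed [intro]: "v \<in> carrier (ext_free m ds) \<Longrightarrow> h v \<in> carrier (ext_free m ds')"
  and map_add: "v \<in> carrier (ext_free m ds) \<Longrightarrow> w \<in> carrier (ext_free m ds) \<Longrightarrow> h (v + w) = h v + h w"
  and map_mult: "v \<in> carrier (ext_free m ds) \<Longrightarrow> r \<in> carrier (exterior_algebra m) \<Longrightarrow> h (vec_mult v r) = vec_mult (h v) r"
  and map_part [intro]: "v \<in> module_part (ext_free m ds) j \<Longrightarrow> h v \<in> module_part (ext_free m ds') j"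
  using graded_hom by (auto simp: graded_hom_def image_subset_iff)

lemma map_zero: "h 0 = 0"
  using map_add[of 0 0] by auto

lemma map_uminus: "v \<in> carrier (ext_free m ds) \<Longrightarrow> h (- v) = - h v"
  using map_add[of v "- v"] map_zero by (metis add.right_inverse ext_free_closed(4) minus_unique)

lemma map_diff: "v \<in> carrier (ext_free m ds) \<Longrightarrow> w \<in> carrier (ext_free m ds) \<Longrightarrow> h (v - w) = h v - h w"
  using map_add[of v "- w"] map_uminus[of w] by (metis diff_conv_add_uminus ext_free_closed(4))

lemma map_vec_part:
  assumes "v \<in> carrier (ext_free m ds)"
  shows "h (vec_part ds j v) = vec_part ds' j (h v)"
  using assms
proof (induction rule: ext_free_induct_homogeneous)
  case (homogeneous i v)
  then show ?case
    using vec_part_homogeneous[OF homogeneous] vec_part_homogeneous[OF map_part[OF homogeneous]] map_zero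
    by (cases "i = j") metis+
next
  case (add v w)
  have "h (vec_part ds j v + vec_part ds j w) = h (vec_part ds j v) + h (vec_part ds j w)"
    using add(1,2) by (intro map_add ext_free_part_carrier[OF vec_part_in])
  then show "h (vec_part ds j (v + w)) = vec_part ds' j (h (v + w))"
    using add by (simp only: vec_part_add map_add)
qed

text \<open>By linearity the image of \<open>w\<close> times a generator is the image of
  \<open>w\<close> times that generator; splitting off the generators one at a time reduces to
  \<open>h 0 = 0\<close>.\<close>

lemma map_vec_initial:
  assumes "v \<in> carrier (ext_free m ds)" "v \<in> vec_initial k" "k \<le> m"
  shows "h v \<in> vec_initial k"
  using assms
proof (induction k arbitrary: v)
  case 0
  then show ?case using map_zero unfolding vec_initial_0 by metis
next
  case (Suc k)
  obtain w where w: "w \<in> carrier (ext_free m ds)" "v - vec_mult w (ext_gen (Suc k)) \<in> vec_initial k"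
    using vec_initial_split[OF Suc.prems(1,2)] by blast
  have g: "ext_gen (Suc k) \<in> carrier (exterior_algebra m)" using Suc.prems by auto
  have wc: "v - vec_mult w (ext_gen (Suc k)) \<in> carrier (ext_free m ds)"
    using Suc.prems(1) w(1) g by blast
  have 1: "h (v - vec_mult w (ext_gen (Suc k))) \<in> vec_initial k"
    by (rule Suc.IH[OF wc w(2)]) (use Suc.prems in simp)
  have "h v = h (v - vec_mult w (ext_gen (Suc k))) + vec_mult (h w) (ext_gen (Suc k))"
    using Suc.prems w g by (subst map_diff) (auto simp: map_mult)
  then show ?case
    using 1 by (metis ext_gen_initial_ideal le_refl vec_initial_intros(2,5,6) Suc_le_mono le0 One_nat_def)
qed

end

section \<open>Tensoring with the residue field\<close>

definition irrelevant_ideal :: "nat \<Rightarrow> (nat set \<Rightarrow> 'k::field) set"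
  where "irrelevant_ideal m = Idl\<^bsub>exterior_algebra m\<^esub> (ext_gen ` {1..m})"

abbreviation ext_residue :: "nat \<Rightarrow> (nat set \<Rightarrow> 'k::field, (nat set \<Rightarrow> 'k) set) graded_module"
  where "ext_residue m \<equiv> left_quotient (exterior_algebra m) (irrelevant_ideal m)"

definition residue_class :: "nat \<Rightarrow> (nat set \<Rightarrow> 'k::field) \<Rightarrow> (nat set \<Rightarrow> 'k) set"
  where "residue_class m a = irrelevant_ideal m +>\<^bsub>exterior_algebra m\<^esub> a"

text \<open>Identifies the residue module with \<open>K\<close>. The choice of a member is harmless
  because the constant term does not vary on a coset of the irrelevant ideal.\<close>

definition residue_value :: "(nat set \<Rightarrow> 'k::field) set \<Rightarrow> 'k"
  where "residue_value Y = (SOME a. a \<in> Y) {}"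

lemma ideal_irrelevant: "ideal (irrelevant_ideal m) (exterior_algebra m :: (nat set \<Rightarrow> 'k::field) graded_ring)"
  unfolding irrelevant_ideal_def by (rule ring.genideal_ideal[OF ring_exterior_algebra]) auto

lemma irrelevant_ideal_mem: "a \<in> irrelevant_ideal m \<longleftrightarrow> a \<in> carrier (exterior_algebra m) \<and> a {} = 0"
  unfolding irrelevant_ideal_def ideal_gens_eq by simp

lemma residue_class_eq_iff:
  assumes "a \<in> carrier (exterior_algebra m)" "b \<in> carrier (exterior_algebra m)"
  shows "residue_class m a = residue_class m b \<longleftrightarrow> a {} = b {}"
  using assms by (simp add: residue_class_def ext_coset_eq_iff[OF ideal_irrelevant] irrelevant_ideal_mem)

lemma residue_value_class:
  assumes "a \<in> carrier (exterior_algebra m)"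
  shows "residue_value (residue_class m a) = a {}"
proof -
  have mem: "b \<in> residue_class m a \<longleftrightarrow> b - a \<in> carrier (exterior_algebra m) \<and> b {} = a {}" for b
    unfolding residue_class_def ext_coset_mem irrelevant_ideal_mem by simp
  then have "a \<in> residue_class m a" by simp
  then have "(SOME b. b \<in> residue_class m a) \<in> residue_class m a" by (rule someI[of "\<lambda>b. b \<in> residue_class m a"])
  then show ?thesis unfolding residue_value_def using mem by blast
qed

lemma ext_residue_carrier: "carrier (ext_residue m) = residue_class m ` carrier (exterior_algebra m)"
  unfolding left_quotient_def FactRing_def A_RCOSETS_def' residue_class_def by auto

lemma ext_residue_part: "module_part (ext_residue m) j = residue_class m ` ring_part (exterior_algebra m) j"
  by (simp add: left_quotient_def residue_class_def)

lemma ext_residue_add: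
  assumes "a \<in> carrier (exterior_algebra m)" "b \<in> carrier (exterior_algebra m)"
  shows "residue_class m a \<oplus>\<^bsub>ext_residue m\<^esub> residue_class m b = residue_class m (a + b)"
  using ext_coset_add[OF ideal_irrelevant assms] by (simp add: left_quotient_def residue_class_def)

lemma ext_residue_smult:
  assumes "a \<in> carrier (exterior_algebra m)" "b \<in> carrier (exterior_algebra m)"
  shows "smult (ext_residue m) a (residue_class m b) = residue_class m (ext_mult a b)"
  using ext_coset_mult[OF ideal_irrelevant assms] by (simp add: left_quotient_def residue_class_def)

section \<open>The tensor product with K as a quotient of a free Abelian group\<close>

abbreviation residue_pairs ::
    "nat \<Rightarrow> int list \<Rightarrow> ((nat \<Rightarrow> nat set \<Rightarrow> 'k::field) \<times> (nat set \<Rightarrow> 'k) set \<Rightarrow>\<^sub>0 int) monoid"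
  where "residue_pairs m ds \<equiv> free_Abelian_group (carrier (ext_free m ds) \<times> carrier (ext_residue m))"

abbreviation residue_relations ::
    "nat \<Rightarrow> int list \<Rightarrow> ((nat \<Rightarrow> nat set \<Rightarrow> 'k::field) \<times> (nat set \<Rightarrow> 'k) set \<Rightarrow>\<^sub>0 int) set"
  where "residue_relations m ds \<equiv> tensor_relations (exterior_algebra m) (ext_free m ds) (ext_residue m)"

abbreviation residue_tensor ::
    "nat \<Rightarrow> int list \<Rightarrow> ((nat \<Rightarrow> nat set \<Rightarrow> 'k::field) \<times> (nat set \<Rightarrow> 'k) set \<Rightarrow>\<^sub>0 int) set monoid"
  where "residue_tensor m ds \<equiv> tensor (exterior_algebra m) (ext_free m ds) (ext_residue m)"

abbreviation residue_unit :: "nat \<Rightarrow> (nat set \<Rightarrow> 'k::field) set"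
  where "residue_unit m \<equiv> residue_class m (ext_monomial {})"

text \<open>The tensor v \<otimes> 1. Balancing turns v \<otimes> a into va \<otimes> 1, so these
  elements exhaust the pure tensors and cosets can be handled through vectors.\<close>

definition tensor_unit ::
    "nat \<Rightarrow> int list \<Rightarrow> (nat \<Rightarrow> nat set \<Rightarrow> 'k::field) \<Rightarrow> ((nat \<Rightarrow> nat set \<Rightarrow> 'k) \<times> (nat set \<Rightarrow> 'k) set \<Rightarrow>\<^sub>0 int) set"
  where "tensor_unit m ds v =
    pure_tensor (exterior_algebra m) (ext_free m ds) (ext_residue m) v (residue_unit m)"

lemma residue_unit_carrier [intro, simp]: "residue_unit m \<in> carrier (ext_residue m)"
  by (auto simp: ext_residue_carrier)

lemma ext_residue_add_closed:
  "y \<in> carrier (ext_residue m) \<Longrightarrow> y' \<in> carrier (ext_residue m) \<Longrightarrow> y \<oplus>\<^bsub>ext_residue m\<^esub> y' \<in> carrier (ext_residue m)"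
  by (auto simp: ext_residue_carrier ext_residue_add)

lemma ext_residue_smult_closed:
  "r \<in> carrier (exterior_algebra m) \<Longrightarrow> y \<in> carrier (ext_residue m) \<Longrightarrow> smult (ext_residue m) r y \<in> carrier (ext_residue m)"
  by (auto simp: ext_residue_carrier ext_residue_smult)

definition residue_generators ::
    "nat \<Rightarrow> int list \<Rightarrow> ((nat \<Rightarrow> nat set \<Rightarrow> 'k::field) \<times> (nat set \<Rightarrow> 'k) set \<Rightarrow>\<^sub>0 int) set"
  where "residue_generators m ds =
      {frag_of (x + x', y) - frag_of (x, y) - frag_of (x', y) | x x' y.
          x \<in> carrier (ext_free m ds) \<and> x' \<in> carrier (ext_free m ds) \<and> y \<in> carrier (ext_residue m)}
     \<union> {frag_of (x, y \<oplus>\<^bsub>ext_residue m\<^esub> y') - frag_of (x, y) - frag_of (x, y') | x y y'.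
          x \<in> carrier (ext_free m ds) \<and> y \<in> carrier (ext_residue m) \<and> y' \<in> carrier (ext_residue m)}
     \<union> {frag_of (vec_mult x r, y) - frag_of (x, smult (ext_residue m) r y) | r x y.
          r \<in> carrier (exterior_algebra m) \<and> x \<in> carrier (ext_free m ds) \<and> y \<in> carrier (ext_residue m)}"

lemma residue_relations_eq: "residue_relations m ds = generate (residue_pairs m ds) (residue_generators m ds)"
  unfolding tensor_relations_def residue_generators_def by simp

lemma residue_relations_generators:
  shows "x \<in> carrier (ext_free m ds) \<Longrightarrow> x' \<in> carrier (ext_free m ds) \<Longrightarrow> y \<in> carrier (ext_residue m) \<Longrightarrow>
      frag_of (x + x', y) - frag_of (x, y) - frag_of (x', y) \<in> residue_relations m ds"
    and "x \<in> carrier (ext_free m ds) \<Longrightarrow> y \<in> carrier (ext_residue m) \<Longrightarrow> y' \<in> carrier (ext_residue m) \<Longrightarrow>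
      frag_of (x, y \<oplus>\<^bsub>ext_residue m\<^esub> y') - frag_of (x, y) - frag_of (x, y') \<in> residue_relations m ds"
    and "r \<in> carrier (exterior_algebra m) \<Longrightarrow> x \<in> carrier (ext_free m ds) \<Longrightarrow> y \<in> carrier (ext_residue m) \<Longrightarrow>
      frag_of (vec_mult x r, y) - frag_of (x, smult (ext_residue m) r y) \<in> residue_relations m ds"
  unfolding residue_relations_eq residue_generators_def by (rule generate.incl, blast)+

text \<open>Membership in the carrier is carried along in the conclusion, because the group inverse
  is rewritten to \<open>-\<close> for elements of the carrier.\<close>

lemma residue_relations_induct [consumes 1, case_names zero left right balance uminus add]:
  fixes ds :: "int list" and c :: "(nat \<Rightarrow> nat set \<Rightarrow> 'k::field) \<times> (nat set \<Rightarrow> 'k) set \<Rightarrow>\<^sub>0 int"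
  assumes c: "c \<in> residue_relations m ds" and "P 0"
    and left: "\<And>x x' y. x \<in> carrier (ext_free m ds) \<Longrightarrow> x' \<in> carrier (ext_free m ds) \<Longrightarrow> y \<in> carrier (ext_residue m)
       \<Longrightarrow> P (frag_of (x + x', y) - frag_of (x, y) - frag_of (x', y))"
    and right: "\<And>x y y'. x \<in> carrier (ext_free m ds) \<Longrightarrow> y \<in> carrier (ext_residue m) \<Longrightarrow> y' \<in> carrier (ext_residue m)
       \<Longrightarrow> P (frag_of (x, y \<oplus>\<^bsub>ext_residue m\<^esub> y') - frag_of (x, y) - frag_of (x, y'))"
    and balance: "\<And>r x y. r \<in> carrier (exterior_algebra m) \<Longrightarrow> x \<in> carrier (ext_free m ds) \<Longrightarrow> y \<in> carrier (ext_residue m)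
       \<Longrightarrow> P (frag_of (vec_mult x r, y) - frag_of (x, smult (ext_residue m) r y))"
    and uminus: "\<And>c. P c \<Longrightarrow> P (- c)"
    and add: "\<And>c c'. P c \<Longrightarrow> P c' \<Longrightarrow> P (c + c')"
  shows "P c \<and> c \<in> carrier (residue_pairs m ds)"
proof -
  have gen: "P h \<and> h \<in> carrier (residue_pairs m ds)" if "h \<in> residue_generators m ds" for h
  proof -
    have sub: "a - b \<in> carrier (residue_pairs m ds)"
      if "a \<in> carrier (residue_pairs m ds)" "b \<in> carrier (residue_pairs m ds)"
      for a b :: "(nat \<Rightarrow> nat set \<Rightarrow> 'k) \<times> (nat set \<Rightarrow> 'k) set \<Rightarrow>\<^sub>0 int"
      using that keys_diff[of a b] by auto
    from that show ?thesis
      unfolding residue_generators_def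
    proof (elim UnE CollectE exE conjE)
      fix x x' :: "nat \<Rightarrow> nat set \<Rightarrow> 'k" and y :: "(nat set \<Rightarrow> 'k) set"
      assume h: "h = frag_of (x + x', y) - frag_of (x, y) - frag_of (x', y)"
        and x: "x \<in> carrier (ext_free m ds)" "x' \<in> carrier (ext_free m ds)" "y \<in> carrier (ext_residue m)"
      have "h \<in> carrier (residue_pairs m ds)"
        unfolding h using ext_free_closed(2)[OF x(1,2)] x
        by (intro sub) (simp_all only: frag_of_in_free_Abelian_group mem_Sigma_iff)
      then show ?thesis using left[OF x] h by simp
    next
      fix x :: "nat \<Rightarrow> nat set \<Rightarrow> 'k" and y y' :: "(nat set \<Rightarrow> 'k) set"
      assume h: "h = frag_of (x, y \<oplus>\<^bsub>ext_residue m\<^esub> y') - frag_of (x, y) - frag_of (x, y')"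
        and x: "x \<in> carrier (ext_free m ds)" "y \<in> carrier (ext_residue m)" "y' \<in> carrier (ext_residue m)"
      have "h \<in> carrier (residue_pairs m ds)"
        unfolding h using ext_residue_add_closed[OF x(2,3)] x
        by (intro sub) (simp_all only: frag_of_in_free_Abelian_group mem_Sigma_iff)
      then show ?thesis using right[OF x] h by simp
    next
      fix r :: "nat set \<Rightarrow> 'k" and x :: "nat \<Rightarrow> nat set \<Rightarrow> 'k" and y :: "(nat set \<Rightarrow> 'k) set"
      assume h: "h = frag_of (vec_mult x r, y) - frag_of (x, smult (ext_residue m) r y)"
        and x: "r \<in> carrier (exterior_algebra m)" "x \<in> carrier (ext_free m ds)" "y \<in> carrier (ext_residue m)"
      have "h \<in> carrier (residue_pairs m ds)"
        unfolding h using ext_free_closed(5)[OF x(2,1)] ext_residue_smult_closed[OF x(1,3)] x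
        by (intro sub) (simp_all only: frag_of_in_free_Abelian_group mem_Sigma_iff)
      then show ?thesis using balance[OF x] h by simp
    qed
  qed
  show ?thesis using c unfolding residue_relations_eq
  proof (induction rule: generate.induct)
    case one
    then show ?case using \<open>P 0\<close> by simp
  next
    case (incl h)
    then show ?case by (rule gen)
  next
    case (inv h)
    have h: "P h" "h \<in> carrier (residue_pairs m ds)" using gen[OF inv] by blast+
    then have "inv\<^bsub>residue_pairs m ds\<^esub> h = - h" by simp
    then show ?case using uminus[OF h(1)] h(2) by simp
  next
    case (eng h1 h2)
    have "Poly_Mapping.keys (h1 + h2) \<subseteq> carrier (ext_free m ds) \<times> carrier (ext_residue m)"
      using eng.IH keys_add[of h1 h2] by auto
    then show ?case using add eng.IH by simp
  qed
qed

lemma residue_relations_carrier: "c \<in> residue_relations m ds \<Longrightarrow> c \<in> carrier (residue_pairs m ds)"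
  using residue_relations_induct[of c m ds "\<lambda>_. True"] by blast

lemma residue_relations_add:
  "c \<in> residue_relations m ds \<Longrightarrow> c' \<in> residue_relations m ds \<Longrightarrow> c + c' \<in> residue_relations m ds"
  unfolding residue_relations_eq using generate.eng by (metis mult_free_Abelian_group)

lemma residue_relations_zero: "0 \<in> residue_relations m ds"
  unfolding residue_relations_eq using generate.one by (metis one_free_Abelian_group)

lemma residue_relations_uminus:
  assumes "c \<in> residue_relations m ds" shows "- c \<in> residue_relations m ds"
proof -
  have "residue_generators m ds \<subseteq> carrier (residue_pairs m ds)"
    using residue_relations_carrier unfolding residue_relations_eq by (blast intro: generate.incl)
  then have "inv\<^bsub>residue_pairs m ds\<^esub> c \<in> residue_relations m ds"
    using assms unfolding residue_relations_eq
    by (intro subgroup.m_inv_closed group.generate_is_subgroup) simp_all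
  then show ?thesis
    using residue_relations_carrier[OF assms] by simp
qed

lemma residue_relations_diff:
  "c \<in> residue_relations m ds \<Longrightarrow> c' \<in> residue_relations m ds \<Longrightarrow> c - c' \<in> residue_relations m ds"
  using residue_relations_add[OF _ residue_relations_uminus] by (metis diff_conv_add_uminus)

lemma residue_relations_normal: "residue_relations m ds \<lhd> residue_pairs m ds"
proof -
  have "subgroup (residue_relations m ds) (residue_pairs m ds)"
  proof (rule subgroup.intro)
    show "residue_relations m ds \<subseteq> carrier (residue_pairs m ds)"
      using residue_relations_carrier by blast
    fix c assume c: "c \<in> residue_relations m ds"
    have "Poly_Mapping.keys c \<subseteq> carrier (ext_free m ds) \<times> carrier (ext_residue m)"
      using residue_relations_carrier[OF c] unfolding carrier_free_Abelian_group_iff .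
    then show "inv\<^bsub>residue_pairs m ds\<^esub> c \<in> residue_relations m ds"
      using residue_relations_uminus[OF c] by simp
  qed (simp_all add: residue_relations_add residue_relations_zero)
  then show ?thesis
    by (simp add: abelian_free_Abelian_group comm_group.normal_iff_subgroup)
qed

lemma residue_coset_mem:
  "c \<in> residue_relations m ds #>\<^bsub>residue_pairs m ds\<^esub> x \<longleftrightarrow> c - x \<in> residue_relations m ds"
  by (auto simp: r_coset_def intro: bexI[of _ "c - x"])

lemma residue_coset_eq_iff:
  "residue_relations m ds #>\<^bsub>residue_pairs m ds\<^esub> x = residue_relations m ds #>\<^bsub>residue_pairs m ds\<^esub> y
     \<longleftrightarrow> x - y \<in> residue_relations m ds"
proof
  assume "residue_relations m ds #>\<^bsub>residue_pairs m ds\<^esub> x = residue_relations m ds #>\<^bsub>residue_pairs m ds\<^esub> y"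
  then show "x - y \<in> residue_relations m ds"
    using residue_coset_mem[of x m ds x] residue_coset_mem[of x m ds y] residue_relations_zero by simp
next
  assume xy: "x - y \<in> residue_relations m ds"
  have "c - x \<in> residue_relations m ds \<longleftrightarrow> c - y \<in> residue_relations m ds" for c
    using residue_relations_add[OF _ xy, of "c - x"] residue_relations_diff[OF _ xy, of "c - y"] by auto
  then show "residue_relations m ds #>\<^bsub>residue_pairs m ds\<^esub> x = residue_relations m ds #>\<^bsub>residue_pairs m ds\<^esub> y"
    using residue_coset_mem by blast
qed

lemma tensor_unit_def':
  "tensor_unit m ds v = residue_relations m ds #>\<^bsub>residue_pairs m ds\<^esub> frag_of (v, residue_unit m)"
  by (simp add: tensor_unit_def pure_tensor_def)

lemma pure_tensor_residue:
  assumes "v \<in> carrier (ext_free m ds)" "a \<in> carrier (exterior_algebra m)"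
  shows "pure_tensor (exterior_algebra m) (ext_free m ds) (ext_residue m) v (residue_class m a) = tensor_unit m ds (vec_mult v a)"
proof -
  have "frag_of (vec_mult v a, residue_unit m) - frag_of (v, residue_class m a) \<in> residue_relations m ds"
    using residue_relations_generators(3)[OF assms(2,1), of "residue_unit m"] assms
    by (simp add: ext_residue_smult)
  then show ?thesis
    unfolding tensor_unit_def' pure_tensor_def residue_coset_eq_iff
    using residue_relations_uminus minus_diff_eq by metis
qed

text \<open>For a generator e one has we \<otimes> 1 = w \<otimes> e = w \<otimes> 0 = 0. Splitting
  off one generator after the other extends this to all of \<open>vec_initial k\<close>.\<close>

lemma residue_relations_vanish:
  assumes "z \<in> carrier (ext_free m ds)" "z \<in> vec_initial k" "k \<le> m"
  shows "frag_of (z, residue_unit m) \<in> residue_relations m ds"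
  using assms
proof (induction k arbitrary: z)
  case 0
  then have z: "z = 0" by (simp only: vec_initial_0)
  \<comment> \<open>The additivity relation for 0 + 0 collapses to minus the symbol itself.\<close>
  have "frag_of (0 + 0, residue_unit m) - frag_of (0, residue_unit m) - frag_of (0, residue_unit m) \<in> residue_relations m ds"
    by (rule residue_relations_generators(1)) auto
  then have "- frag_of (0, residue_unit m) \<in> residue_relations m ds" by simp
  then have "frag_of (0, residue_unit m) \<in> residue_relations m ds"
    using residue_relations_uminus by fastforce
  then show "frag_of (z, residue_unit m) \<in> residue_relations m ds" unfolding z .
next
  case (Suc k)
  obtain w where w: "w \<in> carrier (ext_free m ds)" "z - vec_mult w (ext_gen (Suc k)) \<in> vec_initial k"
    using vec_initial_split[OF Suc.prems(1,2)] by blast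
  define e where "e = (ext_gen (Suc k) :: nat set \<Rightarrow> 'a)"
  have e: "e \<in> carrier (exterior_algebra m)" "e {} = 0"
    unfolding e_def using Suc.prems by (auto, simp add: ext_gen_def ext_monomial_def)
  have we: "vec_mult w e \<in> carrier (ext_free m ds)" using w(1) e(1) by blast
  then have zw: "z - vec_mult w e \<in> carrier (ext_free m ds)" using Suc.prems(1) by blast
  have 1: "frag_of (z - vec_mult w e, residue_unit m) \<in> residue_relations m ds"
    by (rule Suc.IH[OF zw w(2)[folded e_def]]) (use Suc.prems in simp)
  have zc: "residue_class m 0 \<in> carrier (ext_residue m)" by (auto simp: ext_residue_carrier)
  have "frag_of (w, residue_class m 0 \<oplus>\<^bsub>ext_residue m\<^esub> residue_class m 0) - frag_of (w, residue_class m 0)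
       - frag_of (w, residue_class m 0) \<in> residue_relations m ds"
    by (rule residue_relations_generators(2)[OF w(1) zc zc])
  then have "- frag_of (w, residue_class m 0) \<in> residue_relations m ds"
    by (simp add: ext_residue_add)
  then have 2: "frag_of (w, residue_class m 0) \<in> residue_relations m ds"
    using residue_relations_uminus by fastforce
  have "residue_class m e = residue_class m 0"
    by (subst residue_class_eq_iff) (use e in auto)
  then have "frag_of (vec_mult w e, residue_unit m) - frag_of (w, residue_class m 0) \<in> residue_relations m ds"
    using residue_relations_generators(3)[OF e(1) w(1) residue_unit_carrier] e(1)
    by (simp add: ext_residue_smult)
  then have 3: "frag_of (vec_mult w e, residue_unit m) \<in> residue_relations m ds"
    using residue_relations_add[OF _ 2] by fastforce
  have "frag_of ((z - vec_mult w e) + vec_mult w e, residue_unit m) - frag_of (z - vec_mult w e, residue_unit m)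
       - frag_of (vec_mult w e, residue_unit m) \<in> residue_relations m ds"
    by (rule residue_relations_generators(1)[OF zw we residue_unit_carrier])
  from residue_relations_add[OF residue_relations_add[OF this 3] 1]
  show "frag_of (z, residue_unit m) \<in> residue_relations m ds" by simp
qed

text \<open>The \<open>t\<close>-th coordinate of the isomorphism from F \<otimes> K to a power of
  K, defined first on formal sums of pairs.\<close>

definition tensor_value :: "nat \<Rightarrow> ((nat \<Rightarrow> nat set \<Rightarrow> 'k::field) \<times> (nat set \<Rightarrow> 'k) set \<Rightarrow>\<^sub>0 int) \<Rightarrow> 'k"
  where "tensor_value t c =
    (\<Sum>p\<in>Poly_Mapping.keys c. of_int (Poly_Mapping.lookup c p) * (fst p t {} * residue_value (snd p)))"

lemma tensor_value_add: "tensor_value t (c + c') = tensor_value t c + tensor_value t c'"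
  unfolding tensor_value_def
  by (rule setsum_keys_plus_distrib[where f = "\<lambda>p x. of_int x * (fst p t {} * residue_value (snd p))"])
     (simp_all add: distrib_right)

lemma tensor_value_zero: "tensor_value t 0 = 0"
  by (simp add: tensor_value_def)

lemma tensor_value_uminus: "tensor_value t (- c) = - tensor_value t c"
  using tensor_value_add[of t c "- c"] by (simp add: tensor_value_zero add_eq_0_iff)

lemma tensor_value_diff: "tensor_value t (c - c') = tensor_value t c - tensor_value t c'"
  by (simp only: diff_conv_add_uminus tensor_value_add tensor_value_uminus)

lemma tensor_value_frag_of: "tensor_value t (frag_of (x, y)) = x t {} * residue_value y"
  by (simp add: tensor_value_def)

lemma ext_mult_empty: "ext_mult a b {} = a {} * b {}"
  by (simp add: ext_mult_def)

text \<open>The balancing relation is respected because taking the constant term is multiplicative;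
  the other relations need only additivity. So the coordinate descends to the tensor
  product.\<close>

lemma tensor_value_relations:
  fixes c :: "(nat \<Rightarrow> nat set \<Rightarrow> 'k::field) \<times> (nat set \<Rightarrow> 'k) set \<Rightarrow>\<^sub>0 int"
  assumes "c \<in> residue_relations m ds"
  shows "tensor_value t c = 0"
proof -
  have "tensor_value t c = 0 \<and> c \<in> carrier (residue_pairs m ds)"
    using assms
  proof (rule residue_relations_induct)
    fix x :: "nat \<Rightarrow> nat set \<Rightarrow> 'k" and y y' :: "(nat set \<Rightarrow> 'k) set"
    assume "x \<in> carrier (ext_free m ds)" "y \<in> carrier (ext_residue m)" "y' \<in> carrier (ext_residue m)"
    then show "tensor_value t (frag_of (x, y \<oplus>\<^bsub>ext_residue m\<^esub> y') - frag_of (x, y) - frag_of (x, y')) = 0"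
      by (auto simp: tensor_value_diff tensor_value_frag_of ext_residue_carrier ext_residue_add residue_value_class
          distrib_left)
  next
    fix r :: "nat set \<Rightarrow> 'k" and x :: "nat \<Rightarrow> nat set \<Rightarrow> 'k" and y :: "(nat set \<Rightarrow> 'k) set"
    assume "r \<in> carrier (exterior_algebra m)" "x \<in> carrier (ext_free m ds)" "y \<in> carrier (ext_residue m)"
    then show "tensor_value t (frag_of (vec_mult x r, y) - frag_of (x, smult (ext_residue m) r y)) = 0"
      by (auto simp: tensor_value_diff tensor_value_frag_of ext_residue_carrier ext_residue_smult residue_value_class
          ext_mult_empty vec_mult_def)
  qed (simp_all add: tensor_value_diff tensor_value_frag_of tensor_value_zero tensor_value_uminus tensor_value_add
       distrib_right)
  then show ?thesis by blast
qed

text \<open>The coordinates \<open>tensor_value t\<close> detect a nonzero constant term, and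
  \<open>residue_relations_vanish\<close> kills everything without one. From here on, equality in F
  \<otimes> K is a congruence of vectors.\<close>

lemma tensor_unit_eq_iff:
  assumes "v \<in> carrier (ext_free m ds)" "w \<in> carrier (ext_free m ds)"
  shows "tensor_unit m ds v = tensor_unit m ds w \<longleftrightarrow> v - w \<in> vec_initial m"
proof
  assume "tensor_unit m ds v = tensor_unit m ds w"
  then have *: "frag_of (v, residue_unit m) - frag_of (w, residue_unit m) \<in> residue_relations m ds"
    unfolding tensor_unit_def' residue_coset_eq_iff .
  have "residue_value (residue_unit m) = (1 :: 'a)"
    using residue_value_class[OF ext_carrier_intros(6)[OF empty_subsetI, of m]] by (simp add: ext_monomial_def)
  then have "(v - w) t {} = 0" for t
    using tensor_value_relations[OF *, of t] by (simp add: tensor_value_diff tensor_value_frag_of)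
  then show "v - w \<in> vec_initial m"
    by (subst vec_initial_top) (use assms in blast)+
next
  assume vw: "v - w \<in> vec_initial m"
  have c: "v - w \<in> carrier (ext_free m ds)" using assms by blast
  have "frag_of ((v - w) + w, residue_unit m) - frag_of (v - w, residue_unit m) - frag_of (w, residue_unit m)
       \<in> residue_relations m ds"
    by (rule residue_relations_generators(1)[OF c assms(2) residue_unit_carrier])
  from residue_relations_add[OF this residue_relations_vanish[OF c vw order_refl]]
  show "tensor_unit m ds v = tensor_unit m ds w"
    unfolding tensor_unit_def' residue_coset_eq_iff by simp
qed

section \<open>Group structure and grading of the tensor product with K\<close>

lemma tensor_unit_add:
  assumes "v \<in> carrier (ext_free m ds)" "w \<in> carrier (ext_free m ds)"
  shows "tensor_unit m ds v \<otimes>\<^bsub>residue_tensor m ds\<^esub> tensor_unit m ds w = tensor_unit m ds (v + w)"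
proof -
  let ?u = "residue_unit m"
  have "frag_of (v, ?u) \<in> carrier (residue_pairs m ds)" "frag_of (w, ?u) \<in> carrier (residue_pairs m ds)"
    using assms by (simp_all only: frag_of_in_free_Abelian_group mem_Sigma_iff residue_unit_carrier)
  then have "tensor_unit m ds v \<otimes>\<^bsub>residue_tensor m ds\<^esub> tensor_unit m ds w
      = residue_relations m ds #>\<^bsub>residue_pairs m ds\<^esub> (frag_of (v, ?u) + frag_of (w, ?u))"
    unfolding tensor_unit_def' tensor_def mult_FactGroup
    by (subst normal.rcos_sum[OF residue_relations_normal]) simp_all
  also have "\<dots> = tensor_unit m ds (v + w)"
  proof -
    have "- (frag_of (v + w, ?u) - frag_of (v, ?u) - frag_of (w, ?u)) \<in> residue_relations m ds"
      using residue_relations_uminus residue_relations_generators(1)[OF assms residue_unit_carrier] by blast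
    then show ?thesis unfolding tensor_unit_def' residue_coset_eq_iff by (simp add: algebra_simps)
  qed
  finally show ?thesis .
qed

lemma tensor_unit_zero: "tensor_unit m ds 0 = \<one>\<^bsub>residue_tensor m ds\<^esub>"
proof -
  have "frag_of (0, residue_unit m) \<in> residue_relations m ds"
    by (rule residue_relations_vanish[of _ _ _ 0]) auto
  then have "tensor_unit m ds 0 = residue_relations m ds #>\<^bsub>residue_pairs m ds\<^esub> 0"
    unfolding tensor_unit_def' residue_coset_eq_iff by simp
  also have "\<dots> = residue_relations m ds" by (auto simp: residue_coset_mem)
  finally show ?thesis by (simp add: tensor_def)
qed

lemma tensor_unit_carrier: "v \<in> carrier (ext_free m ds) \<Longrightarrow> tensor_unit m ds v \<in> carrier (residue_tensor m ds)"
  unfolding tensor_def tensor_unit_def' carrier_FactGroup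
  by (intro imageI) (simp only: frag_of_in_free_Abelian_group mem_Sigma_iff residue_unit_carrier)

lemma group_residue_tensor: "group (residue_tensor m ds)"
  unfolding tensor_def by (rule normal.factorgroup_is_group[OF residue_relations_normal])

lemma tensor_unit_inv:
  assumes "v \<in> carrier (ext_free m ds)"
  shows "inv\<^bsub>residue_tensor m ds\<^esub> tensor_unit m ds v = tensor_unit m ds (- v)"
proof (rule group.inv_equality[OF group_residue_tensor])
  have v: "- v \<in> carrier (ext_free m ds)" using assms by blast
  show "tensor_unit m ds (- v) \<otimes>\<^bsub>residue_tensor m ds\<^esub> tensor_unit m ds v = \<one>\<^bsub>residue_tensor m ds\<^esub>"
    using tensor_unit_add[OF v assms] by (simp add: tensor_unit_zero)
  show "tensor_unit m ds v \<in> carrier (residue_tensor m ds)" "tensor_unit m ds (- v) \<in> carrier (residue_tensor m ds)"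
    using assms v by (blast intro: tensor_unit_carrier)+
qed

text \<open>The tensors v \<otimes> 1 with \<open>v\<close> homogeneous of degree \<open>j\<close>
  already form a subgroup, so generating adds nothing to them.\<close>

lemma residue_tensor_part:
  "tensor_part (exterior_algebra m) (ext_free m ds) (ext_residue m) j = tensor_unit m ds ` module_part (ext_free m ds) j"
  unfolding tensor_part_def
proof
  let ?P = "{pure_tensor (exterior_algebra m) (ext_free m ds) (ext_residue m) x y | x y p q.
      x \<in> module_part (ext_free m ds) p \<and> y \<in> module_part (ext_residue m) q \<and> p + q = j}"
  have P: "?P \<subseteq> tensor_unit m ds ` module_part (ext_free m ds) j"
  proof
    fix X assume "X \<in> ?P"
    then obtain x p q a where x: "x \<in> module_part (ext_free m ds) p" "a \<in> ring_part (exterior_algebra m) q" "p + q = j"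
      and X: "X = pure_tensor (exterior_algebra m) (ext_free m ds) (ext_residue m) x (residue_class m a)"
      by (auto simp: ext_residue_part)
    have "X = tensor_unit m ds (vec_mult x a)"
      unfolding X by (rule pure_tensor_residue[OF ext_free_part_carrier[OF x(1)] ext_part_carrier[OF x(2)]])
    then show "X \<in> tensor_unit m ds ` module_part (ext_free m ds) j"
      using ext_free_part_mult[OF x(1,2)] x(3) by blast
  qed
  show "generate (residue_tensor m ds) ?P \<subseteq> tensor_unit m ds ` module_part (ext_free m ds) j"
  proof
    fix X assume "X \<in> generate (residue_tensor m ds) ?P"
    then show "X \<in> tensor_unit m ds ` module_part (ext_free m ds) j"
    proof (induction rule: generate.induct)
      case one
      show ?case unfolding tensor_unit_zero[symmetric] by blast
    next
      case (incl h)
      then show ?case using P by blast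
    next
      case (inv h)
      then obtain v where v: "v \<in> module_part (ext_free m ds) j" "h = tensor_unit m ds v" using P by blast
      show ?case unfolding v(2) tensor_unit_inv[OF ext_free_part_carrier[OF v(1)]] using v(1) by blast
    next
      case (eng h1 h2)
      then obtain v w where v: "v \<in> module_part (ext_free m ds) j" "h1 = tensor_unit m ds v"
        and w: "w \<in> module_part (ext_free m ds) j" "h2 = tensor_unit m ds w" by blast
      show ?case
        unfolding v(2) w(2) tensor_unit_add[OF ext_free_part_carrier[OF v(1)] ext_free_part_carrier[OF w(1)]]
        using v(1) w(1) by blast
    qed
  qed
  show "tensor_unit m ds ` module_part (ext_free m ds) j \<subseteq> generate (residue_tensor m ds) ?P"
  proof
    fix X assume "X \<in> tensor_unit m ds ` module_part (ext_free m ds) j"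
    then obtain v where v: "v \<in> module_part (ext_free m ds) j" "X = tensor_unit m ds v" by blast
    have "residue_unit m \<in> module_part (ext_residue m) 0"
      unfolding ext_residue_part by (intro imageI ext_part_monomial) auto
    then have "X \<in> ?P" using v unfolding tensor_unit_def by (metis (mono_tags, lifting) add.right_neutral mem_Collect_eq)
    then show "X \<in> generate (residue_tensor m ds) ?P" by (rule generate.incl)
  qed
qed

section \<open>Induced maps on tensor products\<close>

context ext_free_hom
begin

abbreviation frag_map ::
    "((nat \<Rightarrow> nat set \<Rightarrow> 'k) \<times> (nat set \<Rightarrow> 'k) set \<Rightarrow>\<^sub>0 int) \<Rightarrow> ((nat \<Rightarrow> nat set \<Rightarrow> 'k) \<times> (nat set \<Rightarrow> 'k) set \<Rightarrow>\<^sub>0 int)"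
  where "frag_map c \<equiv> frag_extend (\<lambda>(x, y). frag_of (h x, y)) c"

lemma frag_map_relations:
  assumes "c \<in> residue_relations m ds"
  shows "frag_map c \<in> residue_relations m ds'"
proof -
  have "frag_map c \<in> residue_relations m ds' \<and> c \<in> carrier (residue_pairs m ds)"
    using assms
  proof (rule residue_relations_induct)
    fix x x' :: "nat \<Rightarrow> nat set \<Rightarrow> 'k" and y :: "(nat set \<Rightarrow> 'k) set"
    assume x: "x \<in> carrier (ext_free m ds)" "x' \<in> carrier (ext_free m ds)" "y \<in> carrier (ext_residue m)"
    show "frag_map (frag_of (x + x', y) - frag_of (x, y) - frag_of (x', y)) \<in> residue_relations m ds'"
      using residue_relations_generators(1)[OF map_closed[OF x(1)] map_closed[OF x(2)] x(3)]
      by (simp only: frag_extend_diff frag_extend_of prod.case map_add[OF x(1,2)])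
  next
    fix x :: "nat \<Rightarrow> nat set \<Rightarrow> 'k" and y y' :: "(nat set \<Rightarrow> 'k) set"
    assume x: "x \<in> carrier (ext_free m ds)" "y \<in> carrier (ext_residue m)" "y' \<in> carrier (ext_residue m)"
    show "frag_map (frag_of (x, y \<oplus>\<^bsub>ext_residue m\<^esub> y') - frag_of (x, y) - frag_of (x, y')) \<in> residue_relations m ds'"
      using residue_relations_generators(2)[OF map_closed[OF x(1)] x(2,3)]
      by (simp only: frag_extend_diff frag_extend_of prod.case)
  next
    fix r :: "nat set \<Rightarrow> 'k" and x :: "nat \<Rightarrow> nat set \<Rightarrow> 'k" and y :: "(nat set \<Rightarrow> 'k) set"
    assume x: "r \<in> carrier (exterior_algebra m)" "x \<in> carrier (ext_free m ds)" "y \<in> carrier (ext_residue m)"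
    show "frag_map (frag_of (vec_mult x r, y) - frag_of (x, smult (ext_residue m) r y)) \<in> residue_relations m ds'"
      using residue_relations_generators(3)[OF x(1) map_closed[OF x(2)] x(3)]
      by (simp only: frag_extend_diff frag_extend_of prod.case map_mult[OF x(2,1)])
  qed (simp_all only: frag_extend_0 frag_extend_minus frag_extend_add residue_relations_zero residue_relations_uminus
        residue_relations_add)
  then show ?thesis by blast
qed

lemma tensor_map_unit:
  assumes "v \<in> carrier (ext_free m ds)"
  shows "tensor_map (exterior_algebra m) (ext_free m ds') (ext_residue m) h (tensor_unit m ds v) = tensor_unit m ds' (h v)"
proof -
  let ?f = "frag_of (v, residue_unit m)"
  have "residue_relations m ds' #>\<^bsub>residue_pairs m ds'\<^esub> frag_map c = tensor_unit m ds' (h v)"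
    if "c \<in> tensor_unit m ds v" for c
  proof -
    have "c - ?f \<in> residue_relations m ds" using that unfolding tensor_unit_def' residue_coset_mem .
    from frag_map_relations[OF this] show ?thesis
      unfolding tensor_unit_def' residue_coset_eq_iff by (simp only: frag_extend_diff frag_extend_of prod.case)
  qed
  \<comment> \<open>The union in \<open>tensor_map\<close> is over equal cosets; a member is
    exhibited because an empty union would not be that coset.\<close>
  moreover have "?f \<in> tensor_unit m ds v"
    unfolding tensor_unit_def' residue_coset_mem using residue_relations_zero by simp
  ultimately show ?thesis unfolding tensor_map_def by blast
qed

end

text \<open>Removes the two layers of cosets: a cycle is a vector whose image has no constant terms,
  and it is a boundary when it agrees with some \<open>d (Suc i) w\<close> up to a vector without
  constant terms. The clause \<open>i = 0\<close> makes every vector of homological degree 0 a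
  cycle.\<close>

lemma tensor_homology_trivial_iff:
  fixes d :: "nat \<Rightarrow> (nat \<Rightarrow> nat set \<Rightarrow> 'k::field) \<Rightarrow> nat \<Rightarrow> nat set \<Rightarrow> 'k" and i :: nat and j :: int
  assumes hom: "\<And>i. ext_free_hom m (ds (Suc i)) (ds i) (d (Suc i))"
  defines "H \<equiv> tensor_homology (exterior_algebra m) (ds, d) (ext_residue m) i j"
  shows "carrier H = {\<one>\<^bsub>H\<^esub>} \<longleftrightarrow>
    (\<forall>v\<in>module_part (ext_free m (ds i)) j. i = 0 \<or> d i v \<in> vec_initial m \<longrightarrow>
       (\<exists>w\<in>module_part (ext_free m (ds (Suc i))) j. v - d (Suc i) w \<in> vec_initial m))"
proof -
  let ?T = "residue_tensor m (ds i)" and ?\<tau> = "tensor_unit m (ds i)"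
  interpret D: ext_free_hom m "ds (Suc i)" "ds i" "d (Suc i)" by (rule hom)
  define Z where "Z = {v \<in> module_part (ext_free m (ds i)) j. i = 0 \<or> d i v \<in> vec_initial m}"
  define B where "B = (\<lambda>w. ?\<tau> (d (Suc i) w)) ` module_part (ext_free m (ds (Suc i))) j"
  have cycle: "i = 0 \<or> tensor_map (exterior_algebra m) (ext_free m (ds (i - 1))) (ext_residue m) (d i) (?\<tau> v)
        = \<one>\<^bsub>residue_tensor m (ds (i - 1))\<^esub> \<longleftrightarrow> i = 0 \<or> d i v \<in> vec_initial m"
    if v: "v \<in> module_part (ext_free m (ds i)) j" for v
  proof (cases i)
    case (Suc i')
    interpret D': ext_free_hom m "ds i" "ds i'" "d i" using hom[of i'] Suc by simp
    have v': "v \<in> carrier (ext_free m (ds i))" using v by (rule ext_free_part_carrier)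
    have "tensor_unit m (ds i') (d i v) = tensor_unit m (ds i') 0 \<longleftrightarrow> d i v - 0 \<in> vec_initial m"
      by (rule tensor_unit_eq_iff) (use v' in blast)+
    moreover have "i - 1 = i'" using Suc by simp
    ultimately show ?thesis
      using D'.tensor_map_unit[OF v'] by (simp only: tensor_unit_zero diff_0_right)
  qed simp
  have cycles: "{X \<in> tensor_part (exterior_algebra m) (ext_free m (ds i)) (ext_residue m) j.
      i = 0 \<or> tensor_map (exterior_algebra m) (ext_free m (ds (i - 1))) (ext_residue m) (d i) X
        = \<one>\<^bsub>residue_tensor m (ds (i - 1))\<^esub>} = ?\<tau> ` Z"
    unfolding residue_tensor_part Z_def using cycle by blast
  have boundaries: "tensor_map (exterior_algebra m) (ext_free m (ds i)) (ext_residue m) (d (Suc i)) `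
      tensor_part (exterior_algebra m) (ext_free m (ds (Suc i))) (ext_residue m) j = B"
    unfolding residue_tensor_part B_def image_image
    by (rule image_cong) (auto simp: D.tensor_map_unit ext_free_part_carrier)
  have H: "H = (?T\<lparr>carrier := ?\<tau> ` Z\<rparr>) Mod B"
    unfolding H_def tensor_homology_def Let_def fst_conv snd_conv cycles boundaries ..
  have dw: "d (Suc i) w \<in> module_part (ext_free m (ds i)) j" "d (Suc i) w \<in> carrier (ext_free m (ds i))"
    if "w \<in> module_part (ext_free m (ds (Suc i))) j" for w
    using D.map_part[OF that] ext_free_part_carrier by blast+
  have coset: "B #>\<^bsub>?T\<lparr>carrier := ?\<tau> ` Z\<rparr>\<^esub> ?\<tau> v =
      (\<lambda>w. ?\<tau> (d (Suc i) w + v)) ` module_part (ext_free m (ds (Suc i))) j" if v: "v \<in> Z" for v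
  proof -
    have v': "v \<in> carrier (ext_free m (ds i))" using v ext_free_part_carrier unfolding Z_def by blast
    have "B #>\<^bsub>?T\<lparr>carrier := ?\<tau> ` Z\<rparr>\<^esub> ?\<tau> v = (\<lambda>b. b \<otimes>\<^bsub>?T\<^esub> ?\<tau> v) ` B"
      by (auto simp: r_coset_def)
    also have "\<dots> = (\<lambda>w. ?\<tau> (d (Suc i) w + v)) ` module_part (ext_free m (ds (Suc i))) j"
      unfolding B_def image_image by (rule image_cong[OF refl]) (rule tensor_unit_add[OF dw(2) v'])
    finally show ?thesis .
  qed
  have trivial: "B #>\<^bsub>?T\<lparr>carrier := ?\<tau> ` Z\<rparr>\<^esub> ?\<tau> v = B \<longleftrightarrow>
      (\<exists>w\<in>module_part (ext_free m (ds (Suc i))) j. v - d (Suc i) w \<in> vec_initial m)" if v: "v \<in> Z" for v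
  proof
    have v': "v \<in> carrier (ext_free m (ds i))" using v ext_free_part_carrier unfolding Z_def by blast
    assume eq: "B #>\<^bsub>?T\<lparr>carrier := ?\<tau> ` Z\<rparr>\<^esub> ?\<tau> v = B"
    have "?\<tau> (d (Suc i) 0 + v) \<in> B #>\<^bsub>?T\<lparr>carrier := ?\<tau> ` Z\<rparr>\<^esub> ?\<tau> v"
      unfolding coset[OF v] by (rule image_eqI[OF refl ext_free_part_closed(1)])
    then have "?\<tau> v \<in> B" unfolding eq D.map_zero add_0 .
    then obtain w where w: "w \<in> module_part (ext_free m (ds (Suc i))) j" "?\<tau> v = ?\<tau> (d (Suc i) w)"
      unfolding B_def by (elim imageE)
    then have "v - d (Suc i) w \<in> vec_initial m"
      using tensor_unit_eq_iff[OF v' dw(2)[OF w(1)]] by simp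
    then show "\<exists>w\<in>module_part (ext_free m (ds (Suc i))) j. v - d (Suc i) w \<in> vec_initial m"
      using w(1) by (rule bexI)
  next
    have v': "v \<in> carrier (ext_free m (ds i))" using v ext_free_part_carrier unfolding Z_def by blast
    assume "\<exists>w\<in>module_part (ext_free m (ds (Suc i))) j. v - d (Suc i) w \<in> vec_initial m"
    then obtain w where w: "w \<in> module_part (ext_free m (ds (Suc i))) j" "v - d (Suc i) w \<in> vec_initial m" by blast
    \<comment> \<open>Modulo vectors without constant terms \<open>v\<close> equals
      \<open>d (Suc i) w\<close>, so translating the boundaries by \<open>v\<close> amounts to
      translating their preimages by \<open>w\<close>, which permutes the homogeneous part.\<close>
    have shift: "?\<tau> (d (Suc i) x + v) = ?\<tau> (d (Suc i) (x + w))" if x: "x \<in> module_part (ext_free m (ds (Suc i))) j" for x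
    proof -
      have "d (Suc i) (x + w) = d (Suc i) x + d (Suc i) w"
        by (rule D.map_add[OF ext_free_part_carrier[OF x] ext_free_part_carrier[OF w(1)]])
      moreover have "(d (Suc i) x + v) - (d (Suc i) x + d (Suc i) w) = v - d (Suc i) w" by simp
      moreover have "d (Suc i) x + v \<in> carrier (ext_free m (ds i))" "d (Suc i) x + d (Suc i) w \<in> carrier (ext_free m (ds i))"
        using dw(2)[OF x] dw(2)[OF w(1)] v' by blast+
      ultimately show ?thesis using w(2) by (metis tensor_unit_eq_iff)
    qed
    have "(\<lambda>x. x + w) ` module_part (ext_free m (ds (Suc i))) j = module_part (ext_free m (ds (Suc i))) j"
    proof (intro subset_antisym subsetI)
      fix y :: "nat \<Rightarrow> nat set \<Rightarrow> 'k"
      assume "y \<in> module_part (ext_free m (ds (Suc i))) j"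
      then have "y - w \<in> module_part (ext_free m (ds (Suc i))) j" using w(1) by blast
      then show "y \<in> (\<lambda>x. x + w) ` module_part (ext_free m (ds (Suc i))) j" by (intro image_eqI[of _ _ "y - w"]) simp_all
    qed (use w(1) in blast)
    then have "(\<lambda>x. ?\<tau> (d (Suc i) (x + w))) ` module_part (ext_free m (ds (Suc i))) j = B"
      unfolding B_def image_image[of "\<lambda>x. ?\<tau> (d (Suc i) x)" "\<lambda>x. x + w", symmetric] by simp
    moreover have "(\<lambda>x. ?\<tau> (d (Suc i) x + v)) ` module_part (ext_free m (ds (Suc i))) j =
       (\<lambda>x. ?\<tau> (d (Suc i) (x + w))) ` module_part (ext_free m (ds (Suc i))) j"
      by (rule image_cong[OF refl shift])
    ultimately show "B #>\<^bsub>?T\<lparr>carrier := ?\<tau> ` Z\<rparr>\<^esub> ?\<tau> v = B" using coset[OF v] by simp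
  qed
  have "carrier H = (\<lambda>v. B #>\<^bsub>?T\<lparr>carrier := ?\<tau> ` Z\<rparr>\<^esub> ?\<tau> v) ` Z"
    unfolding H carrier_FactGroup by (simp add: image_image)
  moreover have "\<one>\<^bsub>H\<^esub> = B" unfolding H by simp
  \<comment> \<open>Without a cycle the carrier would be empty instead of the singleton of
    \<open>B\<close>.\<close>
  moreover have "0 \<in> Z"
  proof (cases i)
    case (Suc i')
    interpret D': ext_free_hom m "ds i" "ds i'" "d i" using hom[of i'] Suc by simp
    show ?thesis unfolding Z_def mem_Collect_eq D'.map_zero by blast
  qed (auto simp: Z_def)
  ultimately have "carrier H = {\<one>\<^bsub>H\<^esub>} \<longleftrightarrow> (\<forall>v\<in>Z. B #>\<^bsub>?T\<lparr>carrier := ?\<tau> ` Z\<rparr>\<^esub> ?\<tau> v = B)"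
    by blast
  also have "\<dots> \<longleftrightarrow> (\<forall>v\<in>Z. \<exists>w\<in>module_part (ext_free m (ds (Suc i))) j. v - d (Suc i) w \<in> vec_initial m)"
    using trivial by blast
  finally show ?thesis unfolding Z_def by blast
qed

section \<open>The upper bound\<close>

text \<open>The map commutes with taking homogeneous components, so the component of degree
  \<open>j\<close> of a preimage is again a preimage.\<close>

lemma (in ext_free_hom) map_lift_homogeneous:
  assumes "w \<in> carrier (ext_free m ds)" "h w \<in> module_part (ext_free m ds') j"
  obtains w' where "w' \<in> module_part (ext_free m ds) j" "h w' = h w"
proof
  show "vec_part ds j w \<in> module_part (ext_free m ds) j" using assms(1) by blast
  show "h (vec_part ds j w) = h w"
    using map_vec_part[OF assms(1), of j] vec_part_homogeneous[OF assms(2), of j] by simp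
qed

text \<open>Exactness is imposed at positive homological degrees only. What the cokernel of
  \<open>d 1\<close> looks like is supplied separately, through \<open>exact0\<close> and the
  augmentation.\<close>

locale ext_complex =
  fixes m :: nat and ds :: "nat \<Rightarrow> int list"
    and d :: "nat \<Rightarrow> (nat \<Rightarrow> nat set \<Rightarrow> 'k::field) \<Rightarrow> nat \<Rightarrow> nat set \<Rightarrow> 'k"
  assumes hom: "ext_free_hom m (ds (Suc i)) (ds i) (d (Suc i))"
    and complex: "w \<in> carrier (ext_free m (ds (Suc (Suc i)))) \<Longrightarrow> d (Suc i) (d (Suc (Suc i)) w) = 0"
    and exact: "z \<in> carrier (ext_free m (ds (Suc i))) \<Longrightarrow> d (Suc i) z = 0 \<Longrightarrow>
      \<exists>w\<in>carrier (ext_free m (ds (Suc (Suc i)))). d (Suc (Suc i)) w = z"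
begin

sublocale D: ext_free_hom m "ds (Suc i)" "ds i" "d (Suc i)" for i
  by (rule hom)

text \<open>
  Modulo the generators up to \<open>k\<close>, multiplication by the next one makes a short exact sequence of
  residue rings; the step below is its long exact sequence for \<open>Tor\<close>, read off on representatives.
\<close>

lemma boundary_modulo_initial:
  assumes exact0: "\<And>z j. z \<in> module_part (ext_free m (ds 0)) j \<Longrightarrow> j > N \<Longrightarrow>
      \<exists>w\<in>carrier (ext_free m (ds (Suc 0))). d (Suc 0) w = z"
    and "k \<le> m" "z \<in> module_part (ext_free m (ds i)) j" "j > int i + N"
    and "i = 0 \<or> d i z \<in> vec_initial k"
  shows "\<exists>w\<in>module_part (ext_free m (ds (Suc i))) j. z - d (Suc i) w \<in> vec_initial k"
  using assms(2-)
proof (induction i arbitrary: z j k)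
  \<comment> \<open>In homological degree 0, \<open>exact0\<close> makes \<open>z\<close> itself a
    boundary, whatever \<open>k\<close> is; only the preimage has to be made homogeneous.\<close>
  case 0
  then obtain w where w: "w \<in> carrier (ext_free m (ds (Suc 0)))" "d (Suc 0) w = z"
    using exact0[of z j] by auto
  then have "d (Suc 0) w \<in> module_part (ext_free m (ds 0)) j" using 0 by simp
  then obtain w' where w': "w' \<in> module_part (ext_free m (ds (Suc 0))) j" "d (Suc 0) w' = d (Suc 0) w"
    using D.map_lift_homogeneous[OF w(1)] by metis
  then have "z - d (Suc 0) w' = 0" using w by simp
  then show "\<exists>w\<in>module_part (ext_free m (ds (Suc 0))) j. z - d (Suc 0) w \<in> vec_initial k"
    using w'(1) vec_initial_intros(1) by metis
next
  case (Suc i)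
  \<comment> \<open>Double induction: the outer hypothesis covers all \<open>k\<close> one
    homological degree lower, the inner one covers smaller \<open>k\<close> in the same degree. For
    \<open>k = 0\<close> the claim is exactness of the complex.\<close>
  note outer = Suc.IH
  from Suc.prems have "k \<le> m" "z \<in> module_part (ext_free m (ds (Suc i))) j" "j > int (Suc i) + N"
    "d (Suc i) z \<in> vec_initial k" by auto
  then show "\<exists>w\<in>module_part (ext_free m (ds (Suc (Suc i)))) j. z - d (Suc (Suc i)) w \<in> vec_initial k"
  proof (induction k arbitrary: z)
    case 0
    have dz: "d (Suc i) z = 0" using 0 by (simp only: vec_initial_0)
    obtain w where w: "w \<in> carrier (ext_free m (ds (Suc (Suc i))))" "d (Suc (Suc i)) w = z"
      using exact[OF ext_free_part_carrier[OF 0(2)] dz] by blast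
    then have "d (Suc (Suc i)) w \<in> module_part (ext_free m (ds (Suc i))) j" using 0 by simp
    then obtain w' where w': "w' \<in> module_part (ext_free m (ds (Suc (Suc i)))) j" "d (Suc (Suc i)) w' = d (Suc (Suc i)) w"
      using D.map_lift_homogeneous[OF w(1)] by metis
    then have "z - d (Suc (Suc i)) w' = 0" using w by simp
    then show "\<exists>w\<in>module_part (ext_free m (ds (Suc (Suc i)))) j. z - d (Suc (Suc i)) w \<in> vec_initial 0"
      using w'(1) vec_initial_intros(1) by metis
  next
    case (Suc k)
    define e where "e = (ext_gen (Suc k) :: nat set \<Rightarrow> 'k)"
    have e: "e \<in> ring_part (exterior_algebra m) 1" "e \<in> carrier (exterior_algebra m)" "e \<in> initial_ideal (Suc k)"
      unfolding e_def using Suc.prems(1) by (auto intro: ext_gen_part ext_gen_initial_ideal)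
    have z: "z \<in> carrier (ext_free m (ds (Suc i)))" using Suc.prems(2) by (rule ext_free_part_carrier)
    have dz: "d (Suc i) z \<in> module_part (ext_free m (ds i)) j" using Suc.prems(2) by blast
    \<comment> \<open>Modulo (e_1,...,e_k) the vector \<open>d z\<close> is \<open>y\<close> times
      \<open>e\<close>; \<open>y\<close> represents the value of the connecting map at
      \<open>z\<close>.\<close>
    obtain y where y: "y \<in> carrier (ext_free m (ds i))" "d (Suc i) z - vec_mult y e \<in> vec_initial k"
      "y \<in> module_part (ext_free m (ds i)) (j - 1)"
      using vec_initial_split[OF ext_free_part_carrier[OF dz] Suc.prems(4)] dz unfolding e_def by metis
    \<comment> \<open>Applying \<open>d\<close> to \<open>d z - y e\<close> and using
      \<open>d d = 0\<close> leaves \<open>(d y) e\<close> in the ideal for \<open>k\<close>.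
      Cancelling \<open>e\<close> costs the step from \<open>k\<close> to
      \<open>Suc k\<close>.\<close>
    have "i = 0 \<or> d i y \<in> vec_initial (Suc k)"
    proof (cases i)
      case (Suc i')
      have c: "d (Suc i) z - vec_mult y e \<in> carrier (ext_free m (ds i))"
        using z y(1) e(2) by blast
      have "d i (d (Suc i) z - vec_mult y e) \<in> vec_initial k"
        using D.map_vec_initial[of _ i' k] c y(2) \<open>Suc k \<le> m\<close> unfolding Suc by simp
      moreover have "d i (d (Suc i) z - vec_mult y e) = d i (d (Suc i) z) - vec_mult (d i y) e"
        using z y(1) e(2) unfolding Suc by (subst D.map_diff) (auto simp: D.map_mult)
      moreover have "d i (d (Suc i) z) = 0" using complex[of z i'] z unfolding Suc by simp
      ultimately have "0 - vec_mult (d i y) e \<in> vec_initial k" by simp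
      from vec_initial_intros(3)[OF vec_initial_intros(1) this]
      have "vec_mult (d i y) e \<in> vec_initial k" by simp
      moreover have "d i y \<in> carrier (ext_free m (ds i'))" using y(1) unfolding Suc by blast
      ultimately show ?thesis
        using vec_initial_times_gen_cancel unfolding e_def by blast
    qed simp
    \<comment> \<open>Homological and internal degree both drop by one, so the strict inequality
      survives.\<close>
    moreover have "j - 1 > int i + N" using Suc.prems(3) by simp
    ultimately obtain w where w: "w \<in> module_part (ext_free m (ds (Suc i))) (j - 1)"
      "y - d (Suc i) w \<in> vec_initial (Suc k)"
      using outer[OF Suc.prems(1) y(3)] by blast
    have wc: "w \<in> carrier (ext_free m (ds (Suc i)))" using w(1) by (rule ext_free_part_carrier)
    \<comment> \<open>Since \<open>y\<close> is \<open>d w\<close> modulo the ideal for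
      \<open>Suc k\<close>, the correction \<open>w e\<close> turns \<open>z\<close> into a cycle
      modulo the smaller ideal for \<open>k\<close>. The correction itself vanishes modulo the ideal
      for \<open>Suc k\<close>.\<close>
    define z' where "z' = z - vec_mult w e"
    have "vec_mult w e \<in> module_part (ext_free m (ds (Suc i))) j"
      using ext_free_part_mult[OF w(1) e(1)] by simp
    then have z': "z' \<in> module_part (ext_free m (ds (Suc i))) j"
      unfolding z'_def using Suc.prems(2) by blast
    have "d (Suc i) z' = d (Suc i) z - vec_mult (d (Suc i) w) e"
      unfolding z'_def using z wc e(2) by (subst D.map_diff) (auto simp: D.map_mult)
    also have "\<dots> = (d (Suc i) z - vec_mult y e) + vec_mult (y - d (Suc i) w) e"
      by (simp add: vec_mult_distrib)
    also have "\<dots> \<in> vec_initial k"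
      using y(2) vec_initial_Suc_times_gen[OF w(2)] unfolding e_def by blast
    finally have dz': "d (Suc i) z' \<in> vec_initial k" .
    obtain u where u: "u \<in> module_part (ext_free m (ds (Suc (Suc i)))) j" "z' - d (Suc (Suc i)) u \<in> vec_initial k"
      using Suc.IH[OF Suc_leD[OF Suc.prems(1)] z' Suc.prems(3) dz'] by blast
    have "z - d (Suc (Suc i)) u = (z' - d (Suc (Suc i)) u) + vec_mult w e"
      unfolding z'_def by simp
    also have "\<dots> \<in> vec_initial (Suc k)"
      using u(2) e(3) by blast
    finally show "\<exists>w\<in>module_part (ext_free m (ds (Suc (Suc i)))) j. z - d (Suc (Suc i)) w \<in> vec_initial (Suc k)"
      using u(1) by blast
  qed
qed

end

section \<open>Existence of resolutions\<close>

definition vec_scale :: "'k \<Rightarrow> (nat \<Rightarrow> nat set \<Rightarrow> 'k::field) \<Rightarrow> nat \<Rightarrow> nat set \<Rightarrow> 'k"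
  where "vec_scale c v = (\<lambda>k. ext_scale c (v k))"

lemma vec_scale_eq_mult:
  "v \<in> carrier (ext_free m ds) \<Longrightarrow> vec_scale c v = vec_mult v (ext_scale c (ext_monomial {}))"
  unfolding vec_scale_def vec_mult_def ext_mult_scale ext_free_carrier_iff by (rule ext) (metis ext_mult_one(1))

text \<open>Gaussian elimination over a finite set of coordinates. That \<open>G\<close> spans
  \<open>W\<close> is expressed through the subspaces \<open>U\<close> containing \<open>G\<close>,
  which avoids writing linear combinations.\<close>

lemma finite_spanning_set:
  fixes W :: "(nat \<Rightarrow> nat set \<Rightarrow> 'k::field) set"
  assumes "finite B" "\<And>w k S. w \<in> W \<Longrightarrow> w k S \<noteq> 0 \<Longrightarrow> (k, S) \<in> B"
    and "\<And>w c. w \<in> W \<Longrightarrow> vec_scale c w \<in> W" "\<And>w w'. w \<in> W \<Longrightarrow> w' \<in> W \<Longrightarrow> w + w' \<in> W"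
  shows "\<exists>G\<subseteq>W. finite G \<and> (\<forall>U. G \<subseteq> U \<longrightarrow> 0 \<in> U \<longrightarrow> (\<forall>u\<in>U. \<forall>c. vec_scale c u \<in> U) \<longrightarrow>
     (\<forall>u\<in>U. \<forall>u'\<in>U. u + u' \<in> U) \<longrightarrow> W \<subseteq> U)"
  using assms
proof (induction B arbitrary: W rule: finite_induct)
  case empty
  then have "w = 0" if "w \<in> W" for w using that by (fastforce simp: fun_eq_iff)
  then have "W \<subseteq> {0}" by blast
  then show ?case by (intro exI[of _ "{}"]) blast
next
  case (insert b B)
  obtain kb Sb where b: "b = (kb, Sb)" by fastforce
  define W' where "W' = {w \<in> W. w kb Sb = 0}"
  have supp: "(k, S) \<in> B" if "w \<in> W'" "w k S \<noteq> 0" for w k S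
    using insert.prems(1)[of w k S] that unfolding W'_def b by auto
  have closed: "vec_scale c w \<in> W'" "w + w' \<in> W'" if "w \<in> W'" "w' \<in> W'" for w w' c
  proof -
    have "vec_scale c w \<in> W" "w + w' \<in> W" using insert.prems(2,3) that unfolding W'_def by blast+
    then show "vec_scale c w \<in> W'" "w + w' \<in> W'"
      using that unfolding W'_def by (simp_all add: vec_scale_def ext_scale_def)
  qed
  have "\<exists>G\<subseteq>W'. finite G \<and> (\<forall>U. G \<subseteq> U \<longrightarrow> 0 \<in> U \<longrightarrow> (\<forall>u\<in>U. \<forall>c. vec_scale c u \<in> U) \<longrightarrow>
     (\<forall>u\<in>U. \<forall>u'\<in>U. u + u' \<in> U) \<longrightarrow> W' \<subseteq> U)"
    by (rule insert.IH[OF supp closed(1) closed(2)])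
  then obtain G where G: "G \<subseteq> W'" "finite G"
    "\<And>U. G \<subseteq> U \<Longrightarrow> 0 \<in> U \<Longrightarrow> (\<forall>u\<in>U. \<forall>c. vec_scale c u \<in> U) \<Longrightarrow> (\<forall>u\<in>U. \<forall>u'\<in>U. u + u' \<in> U) \<Longrightarrow> W' \<subseteq> U"
    by (elim exE conjE) blast
  show ?case
  proof (cases "W' = W")
    case True
    then show ?thesis using G by blast
  next
    case False
    then obtain w0 where w0: "w0 \<in> W" "w0 kb Sb \<noteq> 0" unfolding W'_def by auto
    have "W \<subseteq> U" if U: "insert w0 G \<subseteq> U" "0 \<in> U" "\<forall>u\<in>U. \<forall>c. vec_scale c u \<in> U" "\<forall>u\<in>U. \<forall>u'\<in>U. u + u' \<in> U" for U
    proof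
      fix w assume w: "w \<in> W"
      \<comment> \<open>\<open>w0\<close> is the pivot for the coordinate \<open>b\<close>:
        subtracting \<open>c\<close> times it moves \<open>w\<close> into the subspace
        \<open>W'\<close> where this coordinate is zero.\<close>
      define c where "c = w kb Sb / w0 kb Sb"
      have "w + vec_scale (- c) w0 \<in> W'"
      proof -
        have "w + vec_scale (- c) w0 \<in> W" using insert.prems(2,3) w w0(1) by blast
        then show ?thesis unfolding W'_def using w0(2) by (simp add: vec_scale_def ext_scale_def c_def)
      qed
      then have "w + vec_scale (- c) w0 \<in> U" using G(3)[of U] U by blast
      moreover have "vec_scale c w0 \<in> U" using U by blast
      ultimately have "(w + vec_scale (- c) w0) + vec_scale c w0 \<in> U" using U(4) by blast
      moreover have "(w + vec_scale (- c) w0) + vec_scale c w0 = w"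
        by (simp add: vec_scale_def ext_scale_def fun_eq_iff)
      ultimately show "w \<in> U" by simp
    qed
    moreover have "insert w0 G \<subseteq> W" "finite (insert w0 G)" using w0 G unfolding W'_def by auto
    ultimately show ?thesis by (intro exI[of _ "insert w0 G"]) blast
  qed
qed

text \<open>Only finitely many degrees occur and each homogeneous part is finite-dimensional over
  \<open>K\<close>. Spanning sets of these parts are finitely many homogeneous generators.\<close>

lemma graded_submodule_cover:
  fixes Z :: "(nat \<Rightarrow> nat set \<Rightarrow> 'k::field) set"
  assumes sub: "Z \<subseteq> carrier (ext_free m ds)" and zero: "0 \<in> Z"
    and add: "\<And>v w. v \<in> Z \<Longrightarrow> w \<in> Z \<Longrightarrow> v + w \<in> Z"
    and mult: "\<And>v r. v \<in> Z \<Longrightarrow> r \<in> carrier (exterior_algebra m) \<Longrightarrow> vec_mult v r \<in> Z"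
    and part: "\<And>v j. v \<in> Z \<Longrightarrow> vec_part ds j v \<in> Z"
  shows "\<exists>ds' h. ext_free_hom m ds' ds h \<and> h ` carrier (ext_free m ds') = Z"
proof -
  have scale: "vec_scale c v \<in> Z" if "v \<in> Z" for c v
    using that sub mult by (subst vec_scale_eq_mult[of _ m ds]) auto
  have sum: "(\<Sum>x\<in>A. g x) \<in> Z" if "\<And>x. x \<in> A \<Longrightarrow> g x \<in> Z" for A and g :: "'b \<Rightarrow> nat \<Rightarrow> nat set \<Rightarrow> 'k"
    using that by (induction A rule: infinite_finite_induct) (auto intro: zero add)
  \<comment> \<open>All degrees that can occur: that of a basis vector plus that of a monomial,
    which is at most \<open>m\<close>.\<close>
  define D where "D = (\<lambda>(k, c). ds ! k + int c) ` ({..<length ds} \<times> {..m})"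
  have finD: "finite D" unfolding D_def by simp
  define B where "B = {..<length ds} \<times> Pow {1..m}"
  have supp: "(k, S) \<in> B" if "v \<in> carrier (ext_free m ds)" "v k S \<noteq> 0" for v :: "nat \<Rightarrow> nat set \<Rightarrow> 'k" and k S
    using that by (auto simp: B_def ext_free_carrier_iff ext_carrier_iff not_le[symmetric])
  define Zj where "Zj j = Z \<inter> module_part (ext_free m ds) j" for j
  have "\<exists>G\<subseteq>Zj j. finite G \<and> (\<forall>U. G \<subseteq> U \<longrightarrow> 0 \<in> U \<longrightarrow> (\<forall>u\<in>U. \<forall>c. vec_scale c u \<in> U) \<longrightarrow>
     (\<forall>u\<in>U. \<forall>u'\<in>U. u + u' \<in> U) \<longrightarrow> Zj j \<subseteq> U)" for j
  proof (rule finite_spanning_set[of B])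
    show "finite B" unfolding B_def by simp
    fix w assume w: "w \<in> Zj j"
    then show "(k, S) \<in> B" if "w k S \<noteq> 0" for k S using supp sub that unfolding Zj_def by blast
    show "vec_scale c w \<in> Zj j" for c
      using w scale unfolding Zj_def by (auto simp: ext_free_part_iff vec_scale_def ext_scale_def fun_eq_iff ext_part_iff)
    show "w + w' \<in> Zj j" if "w' \<in> Zj j" for w'
      using w that add unfolding Zj_def by blast
  qed
  then obtain G where G: "\<And>j. G j \<subseteq> Zj j" "\<And>j. finite (G j)"
    "\<And>j U. G j \<subseteq> U \<Longrightarrow> 0 \<in> U \<Longrightarrow> (\<forall>u\<in>U. \<forall>c. vec_scale c u \<in> U) \<Longrightarrow> (\<forall>u\<in>U. \<forall>u'\<in>U. u + u' \<in> U) \<Longrightarrow> Zj j \<subseteq> U"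
    by metis
  have "finite (SIGMA j:D. G j)" using finD G(2) by blast
  \<comment> \<open>The list numbers the generators and keeps the degree with each; these degrees
    become the shifts \<open>ds'\<close> of the covering module.\<close>
  then obtain xs where xs: "set xs = (SIGMA j:D. G j)" using finite_list by blast
  define ds' where "ds' = map fst xs"
  define g where "g k = snd (xs ! k)" for k
  have g: "g k \<in> Z" "g k \<in> module_part (ext_free m ds) (ds' ! k)" if "k < length ds'" for k
  proof -
    have "xs ! k \<in> set xs" using that by (simp add: ds'_def)
    then have "snd (xs ! k) \<in> G (fst (xs ! k))" unfolding xs by auto
    then show "g k \<in> Z" "g k \<in> module_part (ext_free m ds) (ds' ! k)"
      using G(1)[of "fst (xs ! k)"] that unfolding g_def ds'_def Zj_def by auto
  qed
  define h where "h v = (\<Sum>k<length ds'. vec_mult (g k) (v k))" for v :: "nat \<Rightarrow> nat set \<Rightarrow> 'k"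
  have hZ: "h v \<in> Z" if "v \<in> carrier (ext_free m ds')" for v
    unfolding h_def using that by (intro sum mult g) (auto simp: ext_free_carrier_iff)
  have hadd: "h (v + w) = h v + h w" for v w
    by (simp add: h_def vec_mult_distrib sum.distrib)
  have hmult: "h (vec_mult v r) = vec_mult (h v) r" for v r
    by (simp add: h_def vec_mult_def fun_eq_iff sum_fun_apply ext_mult_sum ext_mult_assoc)
  have hpart: "h v \<in> module_part (ext_free m ds) j" if v: "v \<in> module_part (ext_free m ds') j" for v j
  proof -
    have "vec_mult (g k) (v k) \<in> module_part (ext_free m ds) j" if k: "k < length ds'" for k
    proof -
      have "v k \<in> ring_part (exterior_algebra m) (j - ds' ! k)" using v k by (simp add: ext_free_part_iff)
      from ext_free_part_mult[OF g(2)[OF k] this] show ?thesis by simp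
    qed
    then have "(\<Sum>k\<in>A. vec_mult (g k) (v k)) \<in> module_part (ext_free m ds) j" if "A \<subseteq> {..<length ds'}" for A
      using that by (induction A rule: infinite_finite_induct) auto
    then show ?thesis unfolding h_def by blast
  qed
  have hom: "ext_free_hom m ds' ds h"
    unfolding ext_free_hom_def graded_hom_def
    using hZ sub hpart by (auto simp: hadd hmult)
  interpret ext_free_hom m ds' ds h by (rule hom)
  let ?U = "h ` carrier (ext_free m ds')"
  have U0: "0 \<in> ?U" by (rule image_eqI, rule map_zero[symmetric], rule ext_free_closed(1))
  have U1: "\<forall>u\<in>?U. \<forall>u'\<in>?U. u + u' \<in> ?U"
  proof (intro ballI)
    fix u u' assume "u \<in> ?U" "u' \<in> ?U"
    then obtain v v' where "v \<in> carrier (ext_free m ds')" "v' \<in> carrier (ext_free m ds')" "u = h v" "u' = h v'"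
      by (elim imageE)
    then show "u + u' \<in> ?U" by (intro image_eqI[of _ _ "v + v'"]) (simp_all only: hadd ext_free_closed(2))
  qed
  have U2: "\<forall>u\<in>?U. \<forall>c. vec_scale c u \<in> ?U"
  proof (intro ballI allI)
    fix u and c :: 'k assume "u \<in> ?U"
    then obtain v where v: "v \<in> carrier (ext_free m ds')" "u = h v" by blast
    let ?r = "ext_scale c (ext_monomial {})"
    have r: "?r \<in> carrier (exterior_algebra m)" by blast
    have "vec_scale c u = vec_mult u ?r"
      using v by (intro vec_scale_eq_mult[of _ m ds]) blast
    also have "\<dots> = h (vec_mult v ?r)" using v r by (simp add: hmult)
    finally have "vec_scale c u = h (vec_mult v ?r)" .
    then show "vec_scale c u \<in> ?U"
      using imageI[OF ext_free_closed(5)[OF v(1) r], of h] by simp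
  qed
  have "G j \<subseteq> ?U" if "j \<in> D" for j
  proof
    fix x assume "x \<in> G j"
    then have "(j, x) \<in> set xs" using that unfolding xs by blast
    then obtain k where k: "k < length ds'" "g k = x"
      unfolding ds'_def g_def by (metis in_set_conv_nth length_map snd_conv)
    have "h (vec_single k (ext_monomial {})) = (\<Sum>t<length ds'. if t = k then vec_mult (g t) (ext_monomial {}) else 0)"
      unfolding h_def by (rule sum.cong) (auto simp: vec_single_def vec_mult_distrib)
    also have "\<dots> = vec_mult x (ext_monomial {})" using k by simp
    also have "\<dots> = x" using g(1)[OF k(1)] sub k(2) by (intro vec_mult_one[of _ m ds]) auto
    finally show "x \<in> ?U" using k(1) by (metis ext_carrier_intros(6) empty_subsetI ext_free_closed(6) imageI)
  qed
  then have ZjU: "Zj j \<subseteq> ?U" if "j \<in> D" for j using G(3)[OF _ U0 U2 U1] that by blast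
  have "Z \<subseteq> ?U"
  proof
    fix z assume z: "z \<in> Z"
    then have zc: "z \<in> carrier (ext_free m ds)" using sub by blast
    have "z = (\<Sum>j\<in>D. vec_part ds j z)"
    proof (intro ext)
      fix k S
      have "(\<Sum>j\<in>D. vec_part ds j z) k S = (\<Sum>j\<in>D. if j = ds ! k + int (card S) then (if k < length ds then z k S else 0) else 0)"
        unfolding sum_fun_apply by (rule sum.cong) (auto simp: vec_part_def)
      also have "\<dots> = (if ds ! k + int (card S) \<in> D then (if k < length ds then z k S else 0) else 0)"
        using finD by simp
      also have "\<dots> = z k S"
      proof (cases "z k S = 0")
        case False
        then have *: "k < length ds" "S \<subseteq> {1..m}" using supp[OF zc] unfolding B_def by auto
        then have "card S \<le> m" using card_mono[of "{1..m}" S] by simp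
        then have "ds ! k + int (card S) \<in> D" using *(1) unfolding D_def by force
        then show ?thesis using *(1) by simp
      qed simp
      finally show "z k S = (\<Sum>j\<in>D. vec_part ds j z) k S" by simp
    qed
    moreover have "(\<Sum>j\<in>D. vec_part ds j z) \<in> ?U"
    proof (rule ext_free_sum_induct[where P = "\<lambda>v. v \<in> ?U"])
      fix j assume "j \<in> D"
      moreover have "vec_part ds j z \<in> Zj j" using part[OF z] zc unfolding Zj_def by blast
      ultimately show "vec_part ds j z \<in> ?U" using ZjU by blast
    qed (use U0 U1 in blast)+
    ultimately show "z \<in> ?U" by simp
  qed
  moreover have "?U \<subseteq> Z" using hZ by blast
  ultimately show ?thesis using hom by blast
qed

text \<open>The kernel is a graded submodule; it contains the homogeneous components of its elements
  because the map commutes with them.\<close>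

lemma (in ext_free_hom) kernel_cover:
  "\<exists>ds'' g. ext_free_hom m ds'' ds g \<and> g ` carrier (ext_free m ds'') = {v \<in> carrier (ext_free m ds). h v = 0}"
proof (rule graded_submodule_cover)
  show "0 \<in> {v \<in> carrier (ext_free m ds). h v = 0}" using map_zero by blast
  fix v assume v: "v \<in> {v \<in> carrier (ext_free m ds). h v = 0}"
  then show "v + w \<in> {v \<in> carrier (ext_free m ds). h v = 0}" if "w \<in> {v \<in> carrier (ext_free m ds). h v = 0}" for w
    using that map_add by auto
  show "vec_mult v r \<in> {v \<in> carrier (ext_free m ds). h v = 0}" if "r \<in> carrier (exterior_algebra m)" for r
    using v that map_mult by (auto simp: vec_mult_distrib)
  have "vec_part ds' j 0 = 0" for j by (simp add: vec_part_def fun_eq_iff)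
  then show "vec_part ds j v \<in> {v \<in> carrier (ext_free m ds). h v = 0}" for j
    using v map_vec_part[of v j] ext_free_part_carrier[OF vec_part_in] by auto
qed auto

text \<open>Dependent choice on triples of target degrees, source degrees and map, each new map
  covering the kernel of the last; the clause for \<open>i = 0\<close> fixes the start.\<close>

lemma resolution_from_cover:
  assumes "ext_free_hom m b a g"
  shows "\<exists>ds d. ds 0 = a \<and> ds (Suc 0) = b \<and> d (Suc 0) = g \<and>
    (\<forall>i. ext_free_hom m (ds (Suc i)) (ds i) (d (Suc i) :: _ \<Rightarrow> nat \<Rightarrow> nat set \<Rightarrow> 'k::field)) \<and>
    (\<forall>i. d (Suc (Suc i)) ` carrier (ext_free m (ds (Suc (Suc i)))) =
       {v \<in> carrier (ext_free m (ds (Suc i))). d (Suc i) v = 0})"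
proof -
  let ?P = "\<lambda>i (x :: int list \<times> int list \<times> ((nat \<Rightarrow> nat set \<Rightarrow> 'k) \<Rightarrow> nat \<Rightarrow> nat set \<Rightarrow> 'k)).
    ext_free_hom m (fst (snd x)) (fst x) (snd (snd x)) \<and> (i = 0 \<longrightarrow> x = (a, b, g))"
  let ?Q = "\<lambda>i (x :: int list \<times> int list \<times> ((nat \<Rightarrow> nat set \<Rightarrow> 'k) \<Rightarrow> nat \<Rightarrow> nat set \<Rightarrow> 'k))
      (y :: int list \<times> int list \<times> ((nat \<Rightarrow> nat set \<Rightarrow> 'k) \<Rightarrow> nat \<Rightarrow> nat set \<Rightarrow> 'k)). fst y = fst (snd x) \<and>
    snd (snd y) ` carrier (ext_free m (fst (snd y))) = {v \<in> carrier (ext_free m (fst (snd x))). snd (snd x) v = 0}"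
  have "\<exists>x. \<forall>i. ?P i (x i) \<and> ?Q i (x i) (x (Suc i))"
  proof (rule dependent_nat_choice)
    show "\<exists>x. ?P 0 x" using assms by auto
    fix x and i :: nat assume "?P i x"
    then interpret ext_free_hom m "fst (snd x)" "fst x" "snd (snd x)" by simp
    obtain c k where "ext_free_hom m c (fst (snd x)) k"
      "k ` carrier (ext_free m c) = {v \<in> carrier (ext_free m (fst (snd x))). snd (snd x) v = 0}"
      using kernel_cover by blast
    then show "\<exists>y. ?P (Suc i) y \<and> ?Q i x y" by (intro exI[of _ "(fst (snd x), c, k)"]) simp
  qed
  then obtain x where x: "\<And>i. ?P i (x i)" "\<And>i. ?Q i (x i) (x (Suc i))" by blast
  have x0: "x 0 = (a, b, g)" using x(1)[of 0] by simp
  define ds where "ds i = fst (x i)" for i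
  \<comment> \<open>The state of index \<open>i\<close> stores the map into \<open>ds i\<close>,
    which is the differential of index \<open>Suc i\<close>. By truncated subtraction
    \<open>d 0\<close> repeats \<open>g\<close>, and nothing is claimed about it.\<close>
  define d where "d i = snd (snd (x (i - 1)))" for i
  have ds: "fst (snd (x i)) = ds (Suc i)" for i using x(2)[of i] by (simp add: ds_def)
  have "ds 0 = a \<and> ds (Suc 0) = b \<and> d (Suc 0) = g"
    using x0 ds[of 0] by (simp add: ds_def d_def)
  moreover have "ext_free_hom m (ds (Suc i)) (ds i) (d (Suc i))" for i
    using x(1)[of i] unfolding ds by (simp add: ds_def d_def)
  moreover have "d (Suc (Suc i)) ` carrier (ext_free m (ds (Suc (Suc i)))) =
       {v \<in> carrier (ext_free m (ds (Suc i))). d (Suc i) v = 0}" for i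
    using x(2)[of i] unfolding ds by (simp add: d_def)
  ultimately show ?thesis by blast
qed

section \<open>The quotient by the symplectic form\<close>

definition form_ideal :: "nat \<Rightarrow> (nat set \<Rightarrow> 'k::field) set"
  where "form_ideal n = Idl\<^bsub>exterior_algebra (2 * n)\<^esub> {symplectic_form n}"

definition form_class :: "nat \<Rightarrow> (nat set \<Rightarrow> 'k::field) \<Rightarrow> (nat set \<Rightarrow> 'k) set"
  where "form_class n a = form_ideal n +>\<^bsub>exterior_algebra (2 * n)\<^esub> a"

abbreviation form_quotient :: "nat \<Rightarrow> (nat set \<Rightarrow> 'k::field, (nat set \<Rightarrow> 'k) set) graded_module"
  where "form_quotient n \<equiv> right_quotient (exterior_algebra (2 * n)) (form_ideal n)"

lemma ideal_form: "ideal (form_ideal n) (exterior_algebra (2 * n) :: (nat set \<Rightarrow> 'k::field) graded_ring)"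
  unfolding form_ideal_def by (rule ring.genideal_ideal[OF ring_exterior_algebra]) auto

lemma form_ideal_eq: "form_ideal n = ext_mult (symplectic_form n) ` carrier (exterior_algebra (2 * n))"
  unfolding form_ideal_def by (rule symplectic_form_ideal)

lemma form_quotient_carrier: "carrier (form_quotient n) = form_class n ` carrier (exterior_algebra (2 * n))"
  unfolding right_quotient_def FactRing_def A_RCOSETS_def' form_class_def by auto

lemma form_quotient_part: "module_part (form_quotient n) j = form_class n ` ring_part (exterior_algebra (2 * n)) j"
  by (simp add: right_quotient_def form_class_def)

lemma form_quotient_add:
  assumes "a \<in> carrier (exterior_algebra (2 * n))" "b \<in> carrier (exterior_algebra (2 * n))"
  shows "form_class n a \<oplus>\<^bsub>form_quotient n\<^esub> form_class n b = form_class n (a + b)"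
  using ext_coset_add[OF ideal_form assms] by (simp add: right_quotient_def form_class_def)

lemma form_quotient_smult:
  assumes "a \<in> carrier (exterior_algebra (2 * n))" "b \<in> carrier (exterior_algebra (2 * n))"
  shows "smult (form_quotient n) b (form_class n a) = form_class n (ext_mult a b)"
  using ext_coset_mult[OF ideal_form assms] by (simp add: right_quotient_def form_class_def)

lemma form_class_eq_iff:
  assumes "a \<in> carrier (exterior_algebra (2 * n))" "b \<in> carrier (exterior_algebra (2 * n))"
  shows "form_class n a = form_class n b \<longleftrightarrow> a - b \<in> form_ideal n"
  unfolding form_class_def by (rule ext_coset_eq_iff[OF ideal_form assms])

lemma form_quotient_zero: "\<zero>\<^bsub>form_quotient n\<^esub> = form_class n 0"
proof -
  have "form_ideal n = form_class n 0" unfolding form_class_def by (auto simp: ext_coset_mem)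
  then show ?thesis unfolding right_quotient_def FactRing_def by simp
qed

lemma form_class_eq_zero_iff:
  assumes "a \<in> carrier (exterior_algebra (2 * n))"
  shows "form_class n a = \<zero>\<^bsub>form_quotient n\<^esub> \<longleftrightarrow> a \<in> form_ideal n"
  unfolding form_quotient_zero using form_class_eq_iff[OF assms, of 0] by simp

section \<open>Homogeneity of the ideal generated by the form\<close>

definition ext_proj :: "int \<Rightarrow> (nat set \<Rightarrow> 'k::field) \<Rightarrow> nat set \<Rightarrow> 'k"
  where "ext_proj j a = (\<lambda>S. if int (card S) = j then a S else 0)"

lemma ext_proj_part [intro]:
  "a \<in> carrier (exterior_algebra m) \<Longrightarrow> ext_proj j a \<in> ring_part (exterior_algebra m) j"
  by (auto simp: ext_proj_def ext_carrier_iff ext_part_iff)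

lemma ext_proj_homogeneous:
  "a \<in> ring_part (exterior_algebra m) i \<Longrightarrow> ext_proj j a = (if i = j then a else 0)"
  by (auto simp: ext_proj_def ext_part_iff fun_eq_iff)

lemma ext_proj_form: "ext_proj j (ext_mult (symplectic_form n) c) = ext_mult (symplectic_form n) (ext_proj (j - 2) c)"
proof
  fix S
  have "int (card (S - pair_block i)) = j - 2 \<longleftrightarrow> int (card S) = j"
    if "i \<in> {1..n}" "pair_block i \<subseteq> S" "finite S" for i
    using that card_mono[of S "pair_block i"] by (simp add: card_Diff_subset card_pair_block of_nat_diff)
  then show "ext_proj j (ext_mult (symplectic_form n) c) S = ext_mult (symplectic_form n) (ext_proj (j - 2) c) S"
    by (auto simp: ext_proj_def symplectic_form_mult intro!: sum.cong sum.neutral)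
qed

text \<open>The form has degree 2, so projecting a cofactor to degree \<open>j - 2\<close> does not
  change a product that is homogeneous of degree \<open>j\<close>.\<close>

lemma form_ideal_part:
  assumes "a \<in> form_ideal n" "a \<in> ring_part (exterior_algebra (2 * n)) j"
  obtains c where "c \<in> ring_part (exterior_algebra (2 * n)) (j - 2)" "a = ext_mult (symplectic_form n) c"
proof -
  obtain c where c: "c \<in> carrier (exterior_algebra (2 * n))" "a = ext_mult (symplectic_form n) c"
    using assms(1) unfolding form_ideal_eq by blast
  have "a = ext_mult (symplectic_form n) (ext_proj (j - 2) c)"
    using ext_proj_homogeneous[OF assms(2), of j] ext_proj_form[of j n c] c(2) by simp
  then show ?thesis using that c(1) by blast
qed

text \<open>Only the first block fits into \<open>pair_block 1\<close>. This recovers the constant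
  term of a cofactor of the form, which is needed to recognize a cofactor equal to one.\<close>

lemma symplectic_form_mult_first:
  assumes "n \<ge> 1"
  shows "ext_mult (symplectic_form n) a (pair_block 1) = a {}"
proof -
  have "ext_mult (symplectic_form n) a (pair_block 1) = (\<Sum>i\<in>{1..n}. if i = 1 then a {} else 0)"
    unfolding symplectic_form_mult
  proof (rule sum.cong)
    fix i assume i: "i \<in> {1..n}"
    have "pair_block i \<subseteq> pair_block 1 \<longleftrightarrow> i = 1"
      using i pair_block_disjoint[of i 1] by (auto simp: pair_block_def)
    then show "(if pair_block i \<subseteq> pair_block 1 \<and> finite (pair_block 1) then a (pair_block 1 - pair_block i) else 0)
        = (if i = 1 then a {} else 0)" by auto
  qed simp
  then show ?thesis using assms by simp
qed

lemma ext_part_zero_eq_one: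
  assumes "a \<in> ring_part (exterior_algebra m) 0" "a {} = 1"
  shows "a = ext_monomial {}"
proof
  fix S
  have "S = {}" if "a S \<noteq> 0"
  proof -
    have "S \<subseteq> {1..m}" "card S = 0" using assms(1) that by (auto simp: ext_part_iff)
    then show ?thesis using finite_subset[of S "{1..m}"] by auto
  qed
  then show "a S = ext_monomial {} S" using assms(2) by (auto simp: ext_monomial_def)
qed

section \<open>A monomial of degree n annihilated by the form\<close>

definition odd_part :: "nat \<Rightarrow> nat set"
  where "odd_part n = (\<lambda>i. 2 * i - 1) ` {1..n}"

lemma odd_part_subset: "odd_part n \<subseteq> {1..2 * n}"
  by (auto simp: odd_part_def)

lemma card_odd_part: "card (odd_part n) = n"
  unfolding odd_part_def by (subst card_image) (auto simp: inj_on_def)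

text \<open>The monomial takes one generator from each block, so no block can be added to
  it.\<close>

lemma symplectic_form_odd_part: "ext_mult (symplectic_form n) (ext_monomial (odd_part n)) = 0"
proof -
  have "{i. i \<in> {1..n} \<and> pair_block i \<inter> odd_part n = {}} = {}"
    by (auto simp: odd_part_def pair_block_def)
  moreover have "finite (odd_part n)" by (simp add: odd_part_def)
  ultimately show ?thesis by (simp only: symplectic_form_monomial sum.empty)
qed

section \<open>The lower bound\<close>

text \<open>The linear map from a free module to \<open>E\<close> sending the \<open>k\<close>-th
  basis vector to \<open>a k\<close>; coefficients stand on the left because scalars act on the
  right.\<close>

definition vec_pair :: "nat \<Rightarrow> (nat \<Rightarrow> nat set \<Rightarrow> 'k::field) \<Rightarrow> (nat \<Rightarrow> nat set \<Rightarrow> 'k) \<Rightarrow> nat set \<Rightarrow> 'k"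
  where "vec_pair l a v = (\<Sum>k<l. ext_mult (a k) (v k))"

lemma vec_pair_add: "vec_pair l a (v + w) = vec_pair l a v + vec_pair l a w"
  by (simp add: vec_pair_def ext_mult_distrib sum.distrib)

lemma vec_pair_zero: "vec_pair l a 0 = 0"
  by (simp add: vec_pair_def)

lemma vec_pair_mult: "vec_pair l a (vec_mult v r) = ext_mult (vec_pair l a v) r"
  by (simp add: vec_pair_def vec_mult_def ext_mult_sum ext_mult_assoc)

lemma vec_pair_basis:
  assumes "k < l" "r \<in> carrier (exterior_algebra m)"
  shows "vec_pair l a (vec_mult (vec_single k (ext_monomial {})) r) = ext_mult (a k) r"
proof -
  have "vec_pair l a (vec_mult (vec_single k (ext_monomial {})) r) = (\<Sum>t<l. if t = k then ext_mult (a t) r else 0)"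
    unfolding vec_pair_def by (rule sum.cong) (use assms in \<open>auto simp: vec_mult_def vec_single_def\<close>)
  then show ?thesis using assms by simp
qed

text \<open>The shift \<open>s\<close> is the degree of the map; 0 serves for the lift of the
  augmentation, -2 for the component that divides by the form.\<close>

lemma vec_pair_part:
  assumes "\<And>k. k < length ds \<Longrightarrow> a k \<in> ring_part (exterior_algebra m) (ds ! k + s)" "v \<in> module_part (ext_free m ds) j"
  shows "vec_pair (length ds) a v \<in> ring_part (exterior_algebra m) (j + s)"
  unfolding vec_pair_def
proof (rule ext_part_sum)
  fix k assume k: "k \<in> {..<length ds}"
  have "v k \<in> ring_part (exterior_algebra m) (j - ds ! k)" using assms(2) k by (simp add: ext_free_part_iff)
  moreover have "a k \<in> ring_part (exterior_algebra m) (ds ! k + s)" using assms(1) k by simp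
  moreover have "ds ! k + s + (j - ds ! k) = j + s" by simp
  ultimately show "ext_mult (a k) (v k) \<in> ring_part (exterior_algebra m) (j + s)"
    using ext_part_mult by metis
qed

lemma vec_pair_carrier:
  assumes "\<And>k. k < l \<Longrightarrow> a k \<in> carrier (exterior_algebra m)" "v \<in> carrier (ext_free m ds)"
  shows "vec_pair l a v \<in> carrier (exterior_algebra m)"
  unfolding vec_pair_def by (rule ext_sum_closed) (use assms in \<open>auto simp: ext_free_carrier_iff\<close>)

lemma vec_pair_proj:
  assumes a: "\<And>k. k < length ds \<Longrightarrow> a k \<in> ring_part (exterior_algebra m) (ds ! k)" and v: "v \<in> carrier (ext_free m ds)"
  shows "vec_pair (length ds) a (vec_part ds j v) = ext_proj j (vec_pair (length ds) a v)"
  using v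
proof (induction rule: ext_free_induct_homogeneous)
  case (homogeneous i v)
  have "vec_pair (length ds) a v \<in> ring_part (exterior_algebra m) i"
    using vec_pair_part[of ds a m 0 v i] a homogeneous by simp
  then show "vec_pair (length ds) a (vec_part ds j v) = ext_proj j (vec_pair (length ds) a v)"
    unfolding vec_part_homogeneous[OF homogeneous] by (simp add: ext_proj_homogeneous vec_pair_zero)
next
  case (add v w)
  have "ext_proj j (b + c) = ext_proj j b + ext_proj j c" for b c :: "nat set \<Rightarrow> 'a"
    by (simp add: ext_proj_def fun_eq_iff)
  then show "vec_pair (length ds) a (vec_part ds j (v + w)) = ext_proj j (vec_pair (length ds) a (v + w))"
    using add by (simp only: vec_part_add vec_pair_add)
qed

text \<open>An arbitrary graded free resolution of E/(f), since the one chosen in \<open>Tor\<close>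
  has no further known properties.\<close>

locale form_resolution = ext_complex "2 * n" ds d
  for n :: nat and ds :: "nat \<Rightarrow> int list"
    and d :: "nat \<Rightarrow> (nat \<Rightarrow> nat set \<Rightarrow> 'k::field_char_0) \<Rightarrow> nat \<Rightarrow> nat set \<Rightarrow> 'k" +
  fixes aug :: "(nat \<Rightarrow> nat set \<Rightarrow> 'k) \<Rightarrow> (nat set \<Rightarrow> 'k) set"
  assumes pos: "n \<ge> 1"
    and aug_hom: "graded_hom (exterior_algebra (2 * n)) (ext_free (2 * n) (ds 0)) (form_quotient n) aug"
    and aug_surj: "aug ` carrier (ext_free (2 * n) (ds 0)) = carrier (form_quotient n)"
    and aug_exact: "d (Suc 0) ` carrier (ext_free (2 * n) (ds (Suc 0))) =
       {v \<in> carrier (ext_free (2 * n) (ds 0)). aug v = \<zero>\<^bsub>form_quotient n\<^esub>}"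
begin

abbreviation E :: "(nat set \<Rightarrow> 'k) graded_ring" where "E \<equiv> exterior_algebra (2 * n)"
abbreviation F :: "nat \<Rightarrow> (nat set \<Rightarrow> 'k, nat \<Rightarrow> nat set \<Rightarrow> 'k) graded_module" where "F i \<equiv> ext_free (2 * n) (ds i)"

lemma aug_closed: "v \<in> carrier (F 0) \<Longrightarrow> aug v \<in> carrier (form_quotient n)"
  and aug_add: "v \<in> carrier (F 0) \<Longrightarrow> w \<in> carrier (F 0) \<Longrightarrow> aug (v + w) = aug v \<oplus>\<^bsub>form_quotient n\<^esub> aug w"
  and aug_mult: "v \<in> carrier (F 0) \<Longrightarrow> r \<in> carrier E \<Longrightarrow> aug (vec_mult v r) = smult (form_quotient n) r (aug v)"
  and aug_part: "v \<in> module_part (F 0) j \<Longrightarrow> aug v \<in> module_part (form_quotient n) j"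
  using aug_hom by (auto simp: graded_hom_def image_subset_iff)

text \<open>Projectivity of the free module, made explicit: homogeneous representatives of the
  images of the basis vectors define a lift of \<open>aug\<close> to \<open>E\<close>.\<close>

lemma augmentation_lift:
  obtains a where "\<And>k. k < length (ds 0) \<Longrightarrow> a k \<in> ring_part E (ds 0 ! k)"
    "\<And>v. v \<in> carrier (F 0) \<Longrightarrow> aug v = form_class n (vec_pair (length (ds 0)) a v)"
proof -
  have "\<exists>a. a \<in> ring_part E (ds 0 ! k) \<and> aug (vec_single k (ext_monomial {})) = form_class n a"
    if "k < length (ds 0)" for k
  proof -
    have "vec_single k (ext_monomial {}) \<in> module_part (F 0) (ds 0 ! k)"
      using that by (auto simp: ext_free_part_iff vec_single_def)
    from aug_part[OF this] show ?thesis unfolding form_quotient_part by blast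
  qed
  then obtain a where a: "\<And>k. k < length (ds 0) \<Longrightarrow> a k \<in> ring_part E (ds 0 ! k)"
    "\<And>k. k < length (ds 0) \<Longrightarrow> aug (vec_single k (ext_monomial {})) = form_class n (a k)"
    by metis
  have ac: "\<And>k. k < length (ds 0) \<Longrightarrow> a k \<in> carrier E" using a(1) ext_part_carrier by blast
  have "aug v = form_class n (vec_pair (length (ds 0)) a v)" if "v \<in> carrier (F 0)" for v
    using that
  proof (induction rule: ext_free_induct_basis)
    case (basis k r)
    have "vec_single k (ext_monomial {}) \<in> carrier (F 0)" using basis(1) by auto
    from aug_mult[OF this basis(2)]
    show "aug (vec_mult (vec_single k (ext_monomial {})) r) =
        form_class n (vec_pair (length (ds 0)) a (vec_mult (vec_single k (ext_monomial {})) r))"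
      by (simp only: a(2)[OF basis(1)] vec_pair_basis[OF basis] form_quotient_smult[OF ac[OF basis(1)] basis(2)])
  next
    case zero
    have z: "0 \<in> carrier (F 0)" by blast
    obtain b where b: "b \<in> carrier E" "aug 0 = form_class n b"
      using aug_closed[OF z] unfolding form_quotient_carrier by blast
    \<comment> \<open>The value at zero is read off from the rule for scalars, by writing 0 as 0
      times 0.\<close>
    have "aug (vec_mult 0 0) = form_class n (ext_mult b 0)"
      using aug_mult[OF z, of 0] b form_quotient_smult[of b n 0] by simp
    then show "aug 0 = form_class n (vec_pair (length (ds 0)) a 0)"
      by (simp only: vec_mult_distrib vec_pair_zero ext_mult_zero)
  next
    case (add v w)
    then show "aug (v + w) = form_class n (vec_pair (length (ds 0)) a (v + w))"
      by (simp only: aug_add vec_pair_add form_quotient_add vec_pair_carrier[OF ac])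
  qed
  then show ?thesis using that a(1) by blast
qed

text \<open>The quotient E/(f) is zero in degrees above \<open>n\<close>, so the augmentation kills
  such vectors. This starts the filtration argument with \<open>N = n\<close>.\<close>

lemma exact0:
  assumes "z \<in> module_part (F 0) j" "j > int n"
  shows "\<exists>w\<in>carrier (F (Suc 0)). d (Suc 0) w = z"
proof -
  obtain a where a: "a \<in> ring_part E j" "aug z = form_class n a"
    using aug_part[OF assms(1)] unfolding form_quotient_part by blast
  have "a \<in> form_ideal n"
    unfolding form_ideal_eq by (rule symplectic_form_ideal_high_degree[OF a(1) assms(2)])
  then have "aug z = \<zero>\<^bsub>form_quotient n\<^esub>"
    using a form_class_eq_zero_iff[OF ext_part_carrier[OF a(1)]] by simp
  then have "z \<in> d (Suc 0) ` carrier (F (Suc 0))"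
    unfolding aug_exact using ext_free_part_carrier[OF assms(1)] by simp
  then show ?thesis by fast
qed

text \<open>
  Comparison with \<open>0 \<leftarrow> E/(f) \<leftarrow> E \<leftarrow> E(-2)\<close>: the chain map \<open>\<phi>\<^sub>0, \<phi>\<^sub>1\<close> shows that
  the syzygy \<open>e\<^sub>1 e\<^sub>3 \<cdots> e\<^bsub>2n-1\<^esub>\<close> of \<open>f\<close> gives a class in
  \<open>Tor\<^sub>2\<close>, because \<open>f\<close> has no syzygies in degree \<open>n - 1\<close>.
\<close>

lemma nontrivial_second_homology:
  "\<exists>v\<in>module_part (F (Suc (Suc 0))) (int n + 2). d (Suc (Suc 0)) v \<in> vec_initial (2 * n) \<and>
     (\<forall>w\<in>module_part (F (Suc (Suc (Suc 0)))) (int n + 2). v - d (Suc (Suc (Suc 0))) w \<notin> vec_initial (2 * n))"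
proof -
  let ?f = "symplectic_form n :: nat set \<Rightarrow> 'k"
  let ?\<eta> = "ext_monomial (odd_part n) :: nat set \<Rightarrow> 'k"
  obtain a where a: "\<And>k. k < length (ds 0) \<Longrightarrow> a k \<in> ring_part E (ds 0 ! k)"
    "\<And>v. v \<in> carrier (F 0) \<Longrightarrow> aug v = form_class n (vec_pair (length (ds 0)) a v)"
    using augmentation_lift by blast
  define \<phi>0 where "\<phi>0 = vec_pair (length (ds 0)) a"
  have \<phi>0_part: "\<phi>0 v \<in> ring_part E j" if "v \<in> module_part (F 0) j" for v j
    using vec_pair_part[of "ds 0" a "2 * n" 0 v j] a(1) that by (simp add: \<phi>0_def)
  have \<phi>0_carrier: "\<phi>0 v \<in> carrier E" if "v \<in> carrier (F 0)" for v
    unfolding \<phi>0_def by (rule vec_pair_carrier[OF ext_part_carrier[OF a(1)] that])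
  have aug: "aug v = \<zero>\<^bsub>form_quotient n\<^esub> \<longleftrightarrow> \<phi>0 v \<in> form_ideal n" if "v \<in> carrier (F 0)" for v
    using a(2)[OF that] form_class_eq_zero_iff[OF \<phi>0_carrier[OF that]] by (simp add: \<phi>0_def)
  have d1: "\<phi>0 (d (Suc 0) v) \<in> form_ideal n" if "v \<in> carrier (F (Suc 0))" for v
    using aug_exact aug that by blast
  \<comment> \<open>After the first differential the lift lands in the ideal of the form. A
    homogeneous cofactor, chosen for each basis vector, defines \<open>\<phi>1\<close>.\<close>
  have "\<exists>c. c \<in> ring_part E (ds (Suc 0) ! k - 2) \<and> \<phi>0 (d (Suc 0) (vec_single k (ext_monomial {}))) = ext_mult ?f c"
    if "k < length (ds (Suc 0))" for k
  proof -
    have b: "vec_single k (ext_monomial {}) \<in> module_part (F (Suc 0)) (ds (Suc 0) ! k)"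
      using that by (auto simp: ext_free_part_iff vec_single_def)
    show ?thesis
      using form_ideal_part[OF d1[OF ext_free_part_carrier[OF b]] \<phi>0_part[OF D.map_part[OF b]]] by blast
  qed
  then obtain c where c: "\<And>k. k < length (ds (Suc 0)) \<Longrightarrow> c k \<in> ring_part E (ds (Suc 0) ! k - 2)"
    "\<And>k. k < length (ds (Suc 0)) \<Longrightarrow> \<phi>0 (d (Suc 0) (vec_single k (ext_monomial {}))) = ext_mult ?f (c k)"
    by metis
  define \<phi>1 where "\<phi>1 = vec_pair (length (ds (Suc 0))) c"
  have \<phi>1_part: "\<phi>1 v \<in> ring_part E (j - 2)" if "v \<in> module_part (F (Suc 0)) j" for v j
    using vec_pair_part[of "ds (Suc 0)" c "2 * n" "- 2" v j] c(1) that by (simp add: \<phi>1_def)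
  have chain: "ext_mult ?f (\<phi>1 v) = \<phi>0 (d (Suc 0) v)" if "v \<in> carrier (F (Suc 0))" for v
    using that
  proof (induction rule: ext_free_induct_basis)
    case (basis k r)
    have b: "vec_single k (ext_monomial {}) \<in> carrier (F (Suc 0))" using basis(1) by auto
    show "ext_mult ?f (\<phi>1 (vec_mult (vec_single k (ext_monomial {})) r)) =
        \<phi>0 (d (Suc 0) (vec_mult (vec_single k (ext_monomial {})) r))"
      unfolding \<phi>1_def vec_pair_basis[OF basis] D.map_mult[OF b basis(2)]
      unfolding \<phi>0_def vec_pair_mult unfolding \<phi>0_def[symmetric] c(2)[OF basis(1)] ext_mult_assoc ..
  next
    case zero
    show "ext_mult ?f (\<phi>1 0) = \<phi>0 (d (Suc 0) 0)"
      by (simp only: \<phi>0_def \<phi>1_def vec_pair_zero D.map_zero ext_mult_zero)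
  next
    case (add v w)
    then show "ext_mult ?f (\<phi>1 (v + w)) = \<phi>0 (d (Suc 0) (v + w))"
      by (simp only: \<phi>0_def \<phi>1_def vec_pair_add D.map_add ext_mult_distrib)
  qed
  \<comment> \<open>\<open>\<phi>1\<close> lowers degrees by 2, so it sends a cycle of degree
    \<open>n + 1\<close> to an annihilator of the form in degree \<open>n - 1\<close>, which must be
    zero.\<close>
  have cycle: "\<phi>1 z = 0" if "z \<in> module_part (F (Suc 0)) (int n + 1)" "d (Suc 0) z = 0" for z
  proof (rule symplectic_form_annihilator)
    show "\<phi>1 z \<in> ring_part E (int n - 1)" using \<phi>1_part[OF that(1)] by simp
    show "ext_mult ?f (\<phi>1 z) = 0"
      using chain[OF ext_free_part_carrier[OF that(1)]] by (simp only: that(2) \<phi>0_def vec_pair_zero)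
  qed
  \<comment> \<open>Such a \<open>y\<close> is a sum of products \<open>p e\<close> of a generator
    \<open>e\<close> with \<open>p\<close> of degree \<open>n + 1\<close>. Each \<open>d p\<close>
    is a cycle of that degree, hence killed by \<open>\<phi>1\<close>.\<close>
  have boundary: "\<phi>1 (d (Suc (Suc 0)) y) = 0"
    if "k \<le> 2 * n" "y \<in> module_part (F (Suc (Suc 0))) (int n + 2)" "y \<in> vec_initial k" for k y
    using that
  proof (induction k arbitrary: y)
    case 0
    then have "y = 0" by (simp only: vec_initial_0)
    then show "\<phi>1 (d (Suc (Suc 0)) y) = 0" by (simp only: D.map_zero \<phi>1_def vec_pair_zero)
  next
    case (Suc k)
    define e where "e = (ext_gen (Suc k) :: nat set \<Rightarrow> 'k)"
    have e: "e \<in> ring_part E 1" "e \<in> carrier E"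
      unfolding e_def using Suc.prems(1) by (auto intro: ext_gen_part)
    obtain p where p: "p \<in> carrier (F (Suc (Suc 0)))" "y - vec_mult p e \<in> vec_initial k"
      "p \<in> module_part (F (Suc (Suc 0))) (int n + 2 - 1)"
      using vec_initial_split[OF ext_free_part_carrier[OF Suc.prems(2)] Suc.prems(3)] Suc.prems(2) unfolding e_def by metis
    have "int n + 2 - 1 = int n + 1" by simp
    with p(3) have p': "p \<in> module_part (F (Suc (Suc 0))) (int n + 1)" by (simp only:)
    have "int n + 1 + 1 = int n + 2" by simp
    with ext_free_part_mult[OF p' e(1)] have "vec_mult p e \<in> module_part (F (Suc (Suc 0))) (int n + 2)"
      by (simp only:)
    then have y': "y - vec_mult p e \<in> module_part (F (Suc (Suc 0))) (int n + 2)" using Suc.prems(2) by blast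
    have "d (Suc (Suc 0)) p \<in> module_part (F (Suc 0)) (int n + 1)" using p' by blast
    then have 0: "\<phi>1 (d (Suc (Suc 0)) p) = 0" by (rule cycle) (rule complex[OF p(1)])
    have "d (Suc (Suc 0)) y = d (Suc (Suc 0)) ((y - vec_mult p e) + vec_mult p e)" by simp
    also have "\<dots> = d (Suc (Suc 0)) (y - vec_mult p e) + vec_mult (d (Suc (Suc 0)) p) e"
      unfolding D.map_mult[OF p(1) e(2), symmetric]
      by (rule D.map_add[OF ext_free_part_carrier[OF y'] ext_free_closed(5)[OF p(1) e(2)]])
    finally have "\<phi>1 (d (Suc (Suc 0)) y) = \<phi>1 (d (Suc (Suc 0)) (y - vec_mult p e)) + ext_mult (\<phi>1 (d (Suc (Suc 0)) p)) e"
      by (simp only: \<phi>1_def vec_pair_add vec_pair_mult)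
    then show "\<phi>1 (d (Suc (Suc 0)) y) = 0"
      using Suc.IH[OF Suc_leD[OF Suc.prems(1)] y' p(2)] 0 by (simp only: ext_mult_zero add_0)
  qed
  have one: "ext_monomial {} \<in> carrier E" by blast
  have "form_class n (ext_monomial {}) \<in> aug ` carrier (F 0)"
    unfolding aug_surj form_quotient_carrier by (rule imageI[OF one])
  then obtain u' where u': "aug u' = form_class n (ext_monomial {})" "u' \<in> carrier (F 0)"
    by (elim imageE) metis
  \<comment> \<open>The homogeneous component replaces a preimage of 1 by one of degree 0, on which
    \<open>\<phi>0\<close> takes the value 1 exactly and not just modulo the ideal.\<close>
  define u where "u = vec_part (ds 0) 0 u'"
  have u: "u \<in> module_part (F 0) 0" "u \<in> carrier (F 0)"
    unfolding u_def using u'(2) ext_free_part_carrier by blast+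
  have "\<phi>0 u' - ext_monomial {} \<in> form_ideal n"
    using a(2)[OF u'(2)] u'(1) form_class_eq_iff[OF \<phi>0_carrier[OF u'(2)] one] by (simp add: \<phi>0_def)
  then obtain q where "\<phi>0 u' - ext_monomial {} = ext_mult ?f q" unfolding form_ideal_eq by blast
  then have "(\<phi>0 u' - ext_monomial {}) {} = ext_mult ?f q {}" by simp
  then have u'1: "\<phi>0 u' {} = 1"
    by (simp add: ext_mult_empty ext_monomial_def symplectic_form_def sum_fun_apply pair_block_def)
  have "\<phi>0 u = ext_proj 0 (\<phi>0 u')"
    unfolding \<phi>0_def u_def by (rule vec_pair_proj[OF a(1) u'(2)])
  then have "\<phi>0 u {} = 1" using u'1 by (simp add: ext_proj_def)
  then have \<phi>0u: "\<phi>0 u = ext_monomial {}" by (rule ext_part_zero_eq_one[OF \<phi>0_part[OF u(1)]])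
  have uf: "vec_mult u ?f \<in> module_part (F 0) 2" using ext_free_part_mult[OF u(1) symplectic_form_part] by simp
  have \<phi>0uf: "\<phi>0 (vec_mult u ?f) = ?f"
    unfolding \<phi>0_def vec_pair_mult unfolding \<phi>0_def[symmetric] \<phi>0u by (rule ext_mult_one(2)[OF symplectic_form_carrier])
  have "?f \<in> form_ideal n"
    unfolding form_ideal_eq by (rule image_eqI[OF _ one]) (rule ext_mult_one(1)[OF symplectic_form_carrier, symmetric])
  then have "aug (vec_mult u ?f) = \<zero>\<^bsub>form_quotient n\<^esub>"
    using aug[OF ext_free_part_carrier[OF uf]] \<phi>0uf by simp
  then have "vec_mult u ?f \<in> d (Suc 0) ` carrier (F (Suc 0))"
    unfolding aug_exact using ext_free_part_carrier[OF uf] by simp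
  then obtain w' where w': "w' \<in> carrier (F (Suc 0))" "d (Suc 0) w' = vec_mult u ?f"
    by (elim imageE) metis
  then obtain w where w: "w \<in> module_part (F (Suc 0)) 2" "d (Suc 0) w = vec_mult u ?f"
    using D.map_lift_homogeneous[OF w'(1)] uf by metis
  have wc: "w \<in> carrier (F (Suc 0))" using w(1) by (rule ext_free_part_carrier)
  have f\<phi>1w: "ext_mult ?f (\<phi>1 w) = ?f" using chain[OF wc] w(2) \<phi>0uf by simp
  \<comment> \<open>The form cannot be cancelled, but its product with \<open>\<phi>1 w\<close>
    still shows the constant term at the first block. As \<open>\<phi>1 w\<close> has degree 0, that
    term determines it.\<close>
  have "\<phi>1 w {} = ext_mult ?f (\<phi>1 w) (pair_block 1)"
    by (rule symplectic_form_mult_first[OF pos, symmetric])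
  also have "\<dots> = ext_mult ?f (ext_monomial {}) (pair_block 1)"
    unfolding f\<phi>1w ext_mult_one(1)[OF symplectic_form_carrier] ..
  also have "\<dots> = 1" unfolding symplectic_form_mult_first[OF pos] by (simp add: ext_monomial_def)
  finally have "\<phi>1 w {} = 1" .
  moreover have "\<phi>1 w \<in> ring_part E 0" using \<phi>1_part[OF w(1)] by simp
  ultimately have \<phi>1w: "\<phi>1 w = ext_monomial {}" by (intro ext_part_zero_eq_one)
  have \<eta>: "?\<eta> \<in> ring_part E (int n)" "?\<eta> \<in> carrier E"
    by (rule ext_part_monomial[OF odd_part_subset], simp add: card_odd_part)
       (rule ext_carrier_intros(6)[OF odd_part_subset])
  have "2 + int n = int n + 2" by simp
  with ext_free_part_mult[OF w(1) \<eta>(1)] have w\<eta>: "vec_mult w ?\<eta> \<in> module_part (F (Suc 0)) (int n + 2)"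
    by (simp only:)
  \<comment> \<open>The annihilator of the form becomes a cycle by multiplying \<open>w\<close>, and
    exactness lifts it to the vector \<open>v\<close> in homological degree 2.\<close>
  have "d (Suc 0) (vec_mult w ?\<eta>) = vec_mult u (ext_mult ?f ?\<eta>)"
    unfolding D.map_mult[OF wc \<eta>(2)] w(2) vec_mult_assoc ..
  then have "d (Suc 0) (vec_mult w ?\<eta>) = 0"
    unfolding symplectic_form_odd_part vec_mult_distrib .
  then obtain v' where v': "v' \<in> carrier (F (Suc (Suc 0)))" "d (Suc (Suc 0)) v' = vec_mult w ?\<eta>"
    using exact[OF ext_free_part_carrier[OF w\<eta>]] by blast
  then obtain v where v: "v \<in> module_part (F (Suc (Suc 0))) (int n + 2)" "d (Suc (Suc 0)) v = vec_mult w ?\<eta>"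
    using D.map_lift_homogeneous[OF v'(1)] w\<eta> by metis
  \<comment> \<open>Positivity of \<open>n\<close> puts the monomial into the irrelevant ideal, so
    that \<open>v\<close> is a cycle after tensoring with K.\<close>
  have "odd_part n \<noteq> {}" using card_odd_part[of n] pos by auto
  then have "?\<eta> {} = 0" by (simp add: ext_monomial_def)
  then have "?\<eta> \<in> initial_ideal (2 * n)" using initial_ideal_top[OF \<eta>(2)] by simp
  then have 1: "d (Suc (Suc 0)) v \<in> vec_initial (2 * n)" unfolding v(2) by blast
  have 2: "v - d (Suc (Suc (Suc 0))) x \<notin> vec_initial (2 * n)"
    if x: "x \<in> module_part (F (Suc (Suc (Suc 0)))) (int n + 2)" for x
  proof
    let ?y = "v - d (Suc (Suc (Suc 0))) x"
    have dx: "d (Suc (Suc (Suc 0))) x \<in> module_part (F (Suc (Suc 0))) (int n + 2)" using x by blast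
    assume "?y \<in> vec_initial (2 * n)"
    then have "\<phi>1 (d (Suc (Suc 0)) ?y) = 0"
      using boundary[OF order_refl ext_free_part_diff[OF v(1) dx]] by simp
    moreover have "d (Suc (Suc 0)) ?y = d (Suc (Suc 0)) v - d (Suc (Suc 0)) (d (Suc (Suc (Suc 0))) x)"
      by (rule D.map_diff[OF ext_free_part_carrier[OF v(1)] ext_free_part_carrier[OF dx]])
    moreover have "d (Suc (Suc 0)) (d (Suc (Suc (Suc 0))) x) = 0"
      by (rule complex[OF ext_free_part_carrier[OF x]])
    \<comment> \<open>Since \<open>\<phi>1 w\<close> is 1, the left side equals the monomial itself,
      which is not zero.\<close>
    ultimately have "\<phi>1 (vec_mult w ?\<eta>) = 0" by (simp only: v(2) diff_0_right)
    then have "?\<eta> = 0"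
      unfolding \<phi>1_def vec_pair_mult unfolding \<phi>1_def[symmetric] \<phi>1w ext_mult_one(2)[OF \<eta>(2)] .
    then have "?\<eta> (odd_part n) = 0" by simp
    then show False by (simp add: ext_monomial_def)
  qed
  from v(1) 1 2 show ?thesis by blast
qed

lemma regularity_eq:
  "Sup {ereal (of_int (j - int i)) | i j. carrier (tensor_homology E (ds, d) (ext_residue (2 * n)) i j)
      \<noteq> {\<one>\<^bsub>tensor_homology E (ds, d) (ext_residue (2 * n)) i j\<^esub>}} = ereal (real n)"
proof (rule antisym)
  note trivial_iff = tensor_homology_trivial_iff[where m = "2 * n" and ds = ds and d = d, OF hom]
  show "Sup {ereal (of_int (j - int i)) | i j. carrier (tensor_homology E (ds, d) (ext_residue (2 * n)) i j)
      \<noteq> {\<one>\<^bsub>tensor_homology E (ds, d) (ext_residue (2 * n)) i j\<^esub>}} \<le> ereal (real n)"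
  proof (rule Sup_least, elim CollectE exE conjE)
    fix x i j
    assume x: "x = ereal (of_int (j - int i))" and nontriv: "carrier (tensor_homology E (ds, d) (ext_residue (2 * n)) i j)
      \<noteq> {\<one>\<^bsub>tensor_homology E (ds, d) (ext_residue (2 * n)) i j\<^esub>}"
    have "\<not> j > int i + int n"
    proof
      assume "j > int i + int n"
      then have "\<exists>w\<in>module_part (F (Suc i)) j. v - d (Suc i) w \<in> vec_initial (2 * n)"
        if "v \<in> module_part (F i) j" "i = 0 \<or> d i v \<in> vec_initial (2 * n)" for v
        \<comment> \<open>Taking \<open>k = 2 * n\<close> turns the ideal of the filtration into the
          irrelevant ideal, the one that occurs in \<open>Tor\<close>.\<close>
        using that by (intro boundary_modulo_initial[where N = "int n"] exact0) simp_all
      then show False using nontriv trivial_iff by blast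
    qed
    then have "j - int i \<le> int n" by simp
    then have "real_of_int (j - int i) \<le> real n" by linarith
    then show "x \<le> ereal (real n)" unfolding x by simp
  qed
  have "\<not> (\<forall>v\<in>module_part (F (Suc (Suc 0))) (int n + 2).
      Suc (Suc 0) = 0 \<or> d (Suc (Suc 0)) v \<in> vec_initial (2 * n) \<longrightarrow>
         (\<exists>w\<in>module_part (F (Suc (Suc (Suc 0)))) (int n + 2). v - d (Suc (Suc (Suc 0))) w \<in> vec_initial (2 * n)))"
    using nontrivial_second_homology by blast
  then have "carrier (tensor_homology E (ds, d) (ext_residue (2 * n)) (Suc (Suc 0)) (int n + 2))
      \<noteq> {\<one>\<^bsub>tensor_homology E (ds, d) (ext_residue (2 * n)) (Suc (Suc 0)) (int n + 2)\<^esub>}"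
    using trivial_iff by blast
  moreover have "ereal (real n) = ereal (of_int ((int n + 2) - int (Suc (Suc 0))))" by simp
  ultimately show "ereal (real n) \<le> Sup {ereal (of_int (j - int i)) | i j. carrier (tensor_homology E (ds, d) (ext_residue (2 * n)) i j)
      \<noteq> {\<one>\<^bsub>tensor_homology E (ds, d) (ext_residue (2 * n)) i j\<^esub>}}"
    by (intro Sup_upper) blast
qed

end

lemma form_resolutionI:
  fixes d :: "nat \<Rightarrow> (nat \<Rightarrow> nat set \<Rightarrow> 'k::field_char_0) \<Rightarrow> nat \<Rightarrow> nat set \<Rightarrow> 'k"
  assumes "n \<ge> 1" "graded_free_resolution (exterior_algebra (2 * n)) (form_quotient n) (ds, d) aug"
  shows "form_resolution n ds d aug"
proof -
  let ?F = "\<lambda>i. ext_free (2 * n) (ds i) :: (nat set \<Rightarrow> 'k, _) graded_module"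
  have res: "graded_hom (exterior_algebra (2 * n)) (?F 0) (form_quotient n) aug"
    "\<And>i. graded_hom (exterior_algebra (2 * n)) (?F (Suc i)) (?F i) (d (Suc i))"
    "aug ` carrier (?F 0) = carrier (form_quotient n)"
    "d (Suc 0) ` carrier (?F (Suc 0)) = {v \<in> carrier (?F 0). aug v = \<zero>\<^bsub>form_quotient n\<^esub>}"
    "\<And>i. d (Suc (Suc i)) ` carrier (?F (Suc (Suc i))) = {v \<in> carrier (?F (Suc i)). d (Suc i) v = 0}"
    using assms(2) unfolding graded_free_resolution_def Let_def by simp_all
  show ?thesis
  proof unfold_locales
    show "graded_hom (exterior_algebra (2 * n)) (?F (Suc i)) (?F i) (d (Suc i))" for i by (rule res(2))
    show "d (Suc i) (d (Suc (Suc i)) w) = 0" if "w \<in> carrier (?F (Suc (Suc i)))" for i w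
      using res(5)[of i] that by blast
    show "\<exists>w\<in>carrier (?F (Suc (Suc i))). d (Suc (Suc i)) w = z"
      if "z \<in> carrier (?F (Suc i))" "d (Suc i) z = 0" for i z
    proof -
      have "z \<in> d (Suc (Suc i)) ` carrier (?F (Suc (Suc i)))" unfolding res(5) using that by simp
      then show ?thesis by fast
    qed
  qed (rule assms(1) res)+
qed

text \<open>Gives the \<open>SOME\<close> in \<open>Tor\<close> its meaning. The first module is
  \<open>E\<close> itself, augmented by the quotient map.\<close>

lemma form_quotient_resolution_exists:
  "\<exists>C aug. graded_free_resolution (exterior_algebra (2 * n)) (form_quotient n :: (nat set \<Rightarrow> 'k::field, _) graded_module) C aug"
proof -
  let ?E = "exterior_algebra (2 * n) :: (nat set \<Rightarrow> 'k) graded_ring"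
  let ?F = "ext_free (2 * n) [0] :: (nat set \<Rightarrow> 'k, _) graded_module"
  define aug where "aug v = form_class n (v 0)" for v :: "nat \<Rightarrow> nat set \<Rightarrow> 'k"
  \<comment> \<open>The kernel of the augmentation: the ideal of the form, seen as vectors of length
    one.\<close>
  define Z where "Z = {v \<in> carrier ?F. v 0 \<in> form_ideal n}"
  have c0: "v 0 \<in> carrier ?E" if "v \<in> carrier ?F" for v using that by (simp add: ext_free_carrier_iff)
  have Z: "Z = {v \<in> carrier ?F. aug v = \<zero>\<^bsub>form_quotient n\<^esub>}"
    unfolding Z_def aug_def using form_class_eq_zero_iff[OF c0] by blast
  have aug_hom: "graded_hom ?E ?F (form_quotient n) aug"
    unfolding graded_hom_def
    by (auto simp: aug_def form_quotient_carrier form_quotient_part form_quotient_add form_quotient_smult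
        vec_mult_def c0 ext_free_part_iff)
  have surj: "aug ` carrier ?F = carrier (form_quotient n)"
  proof
    show "aug ` carrier ?F \<subseteq> carrier (form_quotient n)" using aug_hom unfolding graded_hom_def by auto
    show "carrier (form_quotient n) \<subseteq> aug ` carrier ?F"
    proof
      fix X :: "(nat set \<Rightarrow> 'k) set" assume "X \<in> carrier (form_quotient n)"
      then obtain a where a: "a \<in> carrier ?E" "X = form_class n a" unfolding form_quotient_carrier by blast
      have "X = aug (vec_single 0 a)" unfolding a(2) aug_def by (simp add: vec_single_def)
      moreover have "vec_single 0 a \<in> carrier ?F" using a(1) by (intro ext_free_closed) auto
      ultimately show "X \<in> aug ` carrier ?F" by (rule image_eqI)
    qed
  qed
  have I: "ideal (form_ideal n) ?E" by (rule ideal_form)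
  have "\<exists>b g. ext_free_hom (2 * n) b [0] g \<and> g ` carrier (ext_free (2 * n) b) = Z"
  proof (rule graded_submodule_cover)
    show "Z \<subseteq> carrier ?F" unfolding Z_def by blast
    have "(0 :: nat set \<Rightarrow> 'k) \<in> form_ideal n" using additive_subgroup.zero_closed[OF ideal.axioms(1)[OF I]] by simp
    then show "0 \<in> Z" unfolding Z_def by auto
    fix v assume v: "v \<in> Z"
    show "v + w \<in> Z" if "w \<in> Z" for w
      using v that additive_subgroup.a_closed[OF ideal.axioms(1)[OF I]] unfolding Z_def by auto
    show "vec_mult v r \<in> Z" if r: "r \<in> carrier ?E" for r
    proof -
      have "vec_mult v r 0 \<in> form_ideal n"
        using v r ideal.I_r_closed[OF I] unfolding Z_def by (simp add: vec_mult_def)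
      then show ?thesis using v ext_free_closed(5)[OF _ r] unfolding Z_def by blast
    qed
    show "vec_part [0] j v \<in> Z" for j
    proof -
      have vc: "v \<in> carrier ?F" using v unfolding Z_def by blast
      obtain q where q: "q \<in> carrier ?E" "v 0 = ext_mult (symplectic_form n) q"
        using v unfolding Z_def form_ideal_eq by blast
      have "vec_part [0] j v 0 = ext_proj j (v 0)" by (simp add: vec_part_def ext_proj_def fun_eq_iff)
      also have "\<dots> \<in> form_ideal n"
        unfolding q(2) ext_proj_form form_ideal_eq using q(1) ext_part_carrier[OF ext_proj_part] by blast
      finally show ?thesis using ext_free_part_carrier[OF vec_part_in[OF vc]] unfolding Z_def by blast
    qed
  qed
  then obtain b g where g: "ext_free_hom (2 * n) b [0] g" "g ` carrier (ext_free (2 * n) b) = Z" by blast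
  obtain ds d where ds: "ds 0 = [0]" "ds (Suc 0) = b" "d (Suc 0) = g"
    "\<And>i. ext_free_hom (2 * n) (ds (Suc i)) (ds i) (d (Suc i) :: _ \<Rightarrow> nat \<Rightarrow> nat set \<Rightarrow> 'k)"
    "\<And>i. d (Suc (Suc i)) ` carrier (ext_free (2 * n) (ds (Suc (Suc i)))) =
       {v \<in> carrier (ext_free (2 * n) (ds (Suc i))). d (Suc i) v = 0}"
    using resolution_from_cover[OF g(1)] by blast
  have "graded_free_resolution ?E (form_quotient n) (ds, d) aug"
    unfolding graded_free_resolution_def Let_def
    using aug_hom surj ds g Z by (simp add: ext_free_hom_def)
  then show ?thesis by blast
qed

theorem theorem4p1:
  fixes n :: nat
    and E :: "(nat set \<Rightarrow> 'k::field_char_0) graded_ring"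
    and f :: "nat set \<Rightarrow> 'k"
  assumes "n \<ge> 1"
    and "E = exterior_algebra (2 * n)"
    and "f = (\<Oplus>\<^bsub>E\<^esub> i \<in> {1..n}. ext_gen (2 * i - 1) \<otimes>\<^bsub>E\<^esub> ext_gen (2 * i))"
  shows "ext_regularity (2 * n) (right_quotient E (Idl\<^bsub>E\<^esub> {f})) = ereal (real n)"
proof -
  have f: "f = symplectic_form n"
    unfolding assms(3) assms(2) symplectic_form_eq_gens
    by (subst finsum_exterior_algebra) auto
  have M: "right_quotient E (Idl\<^bsub>E\<^esub> {f}) = form_quotient n"
    unfolding f assms(2) form_ideal_def ..
  define C where "C = (SOME C. \<exists>aug. graded_free_resolution E (form_quotient n :: (nat set \<Rightarrow> 'k, _) graded_module) C aug)"
  obtain ds d where C: "C = (ds, d)" by fastforce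
  have "\<exists>C aug. graded_free_resolution E (form_quotient n :: (nat set \<Rightarrow> 'k, _) graded_module) C aug"
    unfolding assms(2) by (rule form_quotient_resolution_exists)
  \<comment> \<open>Existence becomes a property of the particular complex from which
    \<open>Tor\<close> is computed, so the result for arbitrary resolutions applies to it.\<close>
  then have "\<exists>aug. graded_free_resolution E (form_quotient n :: (nat set \<Rightarrow> 'k, _) graded_module) C aug"
    unfolding C_def by (rule someI_ex)
  then obtain aug where "form_resolution n ds d aug"
    unfolding C assms(2) using form_resolutionI[OF assms(1)] by blast
  then interpret form_resolution n ds d aug .
  have "Tor E (form_quotient n) (ext_residue (2 * n)) i j = tensor_homology E (ds, d) (ext_residue (2 * n)) i j" for i j
    unfolding Tor_def C_def[symmetric] C ..
  moreover have "Idl\<^bsub>E\<^esub> (ext_gen ` {1..2 * n}) = irrelevant_ideal (2 * n)"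
    unfolding irrelevant_ideal_def assms(2) ..
  ultimately show ?thesis
    using regularity_eq unfolding M ext_regularity_def regularity_def Let_def assms(2)[symmetric] by simp
qed

end
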